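(* Let $n\ge 1$ and let $G=\mathbb{Z}^n$ be the free abelian group on $X_1,\dots,X_n$. Then $$H^n(G,C^*_{red}(G))\cong\frac{C(\mathbb{T}^n)}{(Z_1-1)C(\mathbb{T}^n)+\dots+(Z_n-1)C(\mathbb{T}^n)}.$$
   Context: $\mathbb{T}^n=\{(z_1,\dots,z_n)\in\mathbb{C}^n:|z_i|=1\text{ for all }i\}$, $C(\mathbb{T}^n)$ is the algebra of continuous complex-valued functions on $\mathbb{T}^n$, and $Z_i\in C(\mathbb{T}^n)$ is the $i$-th coordinate function $(z_1,\dots,z_n)\mapsto z_i$. $\cong$ denotes isomorphism of groups. For a group $G$, $C^*_{red}(G)$ is the completion of the group ring $\mathbb{C}G$ in the operator norm $\|\alpha\|_{op}=\sup\{\|\alpha\cdot\beta\|_2:\beta\in L^2(G),\ \|\beta\|_2=1\}$, where $L^2(G)$ is the Hilbert space of formal sums $\sum_{g\in G}a_g g$ with $\sum_g|a_g|^2<\infty$ and $\mathbb{C}G$ acts by left multiplication; $G$ acts on $C^*_{red}(G)$ by left multiplication. $H^n(G,M)$ denotes the usual group cohomology: for a projective resolution $\cdots\to P_1\to P_0$ of the trivial module $\mathbb{Z}$ by $\mathbb{Z}G$-modules, it is the $n$-th cohomology of the complex $\mathrm{Hom}_{\mathbb{Z}G}(P_\bullet,M)$. *)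

theory Defs
  imports "HOL-Algebra.Algebra" "HOL-Analysis.Analysis"
begin

section \<open>Modules over a ring that need not be commutative\<close>

text \<open>The library locale \<open>module\<close> requires a commutative ring; group rings are only rings in general.
  The multiplicative fields of the record of a module carry no meaning.\<close>

locale left_module = R?: ring R + M?: abelian_group M
  for R :: "('r, 'c) ring_scheme" (structure) and M :: "('r, 'a, 'd) module_scheme" (structure) +
  assumes smult_closed: "\<lbrakk>a \<in> carrier R; x \<in> carrier M\<rbrakk> \<Longrightarrow> a \<odot>\<^bsub>M\<^esub> x \<in> carrier M"
    and smult_l_distr: "\<lbrakk>a \<in> carrier R; b \<in> carrier R; x \<in> carrier M\<rbrakk> \<Longrightarrow>
      (a \<oplus>\<^bsub>R\<^esub> b) \<odot>\<^bsub>M\<^esub> x = a \<odot>\<^bsub>M\<^esub> x \<oplus>\<^bsub>M\<^esub> b \<odot>\<^bsub>M\<^esub> x"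
    and smult_r_distr: "\<lbrakk>a \<in> carrier R; x \<in> carrier M; y \<in> carrier M\<rbrakk> \<Longrightarrow>
      a \<odot>\<^bsub>M\<^esub> (x \<oplus>\<^bsub>M\<^esub> y) = a \<odot>\<^bsub>M\<^esub> x \<oplus>\<^bsub>M\<^esub> a \<odot>\<^bsub>M\<^esub> y"
    and smult_assoc: "\<lbrakk>a \<in> carrier R; b \<in> carrier R; x \<in> carrier M\<rbrakk> \<Longrightarrow>
      (a \<otimes>\<^bsub>R\<^esub> b) \<odot>\<^bsub>M\<^esub> x = a \<odot>\<^bsub>M\<^esub> (b \<odot>\<^bsub>M\<^esub> x)"
    and smult_one: "x \<in> carrier M \<Longrightarrow> \<one>\<^bsub>R\<^esub> \<odot>\<^bsub>M\<^esub> x = x"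

definition linear_maps ::
  "('r, 'c) ring_scheme \<Rightarrow> ('r, 'a) module \<Rightarrow> ('r, 'b) module \<Rightarrow> ('a \<Rightarrow> 'b) set" where
  "linear_maps R M N = {f \<in> carrier M \<rightarrow> carrier N.
     (\<forall>x\<in>carrier M. \<forall>y\<in>carrier M. f (x \<oplus>\<^bsub>M\<^esub> y) = f x \<oplus>\<^bsub>N\<^esub> f y) \<and>
     (\<forall>r\<in>carrier R. \<forall>x\<in>carrier M. f (r \<odot>\<^bsub>M\<^esub> x) = r \<odot>\<^bsub>N\<^esub> f x)}"

definition module_along ::
  "('r \<Rightarrow> 'a) \<Rightarrow> ('a, 'c) ring_scheme \<Rightarrow> ('r, 'a) module" where
  "module_along \<phi> A = \<lparr>carrier = carrier A, monoid.mult = (\<otimes>\<^bsub>A\<^esub>), one = \<one>\<^bsub>A\<^esub>,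
     ring.zero = \<zero>\<^bsub>A\<^esub>, add = (\<oplus>\<^bsub>A\<^esub>),
     module.smult = (\<lambda>r x. \<phi> r \<otimes>\<^bsub>A\<^esub> x)\<rparr>"

text \<open>Projectivity by the lifting property along surjections \<open>f: M \<rightarrow> N\<close>. HOL cannot quantify over the
  types of \<open>M\<close> and \<open>N\<close>, but the two types below suffice for the lifting property at all types: the
  free module \<open>F\<close> on the set \<open>carrier P\<close> consists of functions of type \<open>'p \<Rightarrow> 'r\<close>, so the case
  \<open>M = F\<close>, \<open>N = P\<close>, \<open>g = id\<close> exhibits \<open>P\<close> as a direct summand of \<open>F\<close>, and direct summands
  of free modules lift along every surjection.\<close>

definition projective_module :: "('r, 'c) ring_scheme \<Rightarrow> ('r, 'p) module \<Rightarrow> bool" where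
  "projective_module R P \<longleftrightarrow> left_module R P \<and>
     (\<forall>(M :: ('r, 'p \<Rightarrow> 'r) module) (N :: ('r, 'p) module) f g.
        left_module R M \<and> left_module R N \<and>
        f \<in> linear_maps R M N \<and> f ` carrier M = carrier N \<and> g \<in> linear_maps R P N \<longrightarrow>
        (\<exists>h \<in> linear_maps R P M. \<forall>x\<in>carrier P. f (h x) = g x))"

text \<open>Here \<open>d i\<close> is the map from \<open>P (Suc i)\<close> to \<open>P i\<close>, and \<open>\<epsilon>\<close> is the augmentation from \<open>P 0\<close>
  to \<open>A\<close>. That all \<open>P i\<close> live in one type is no restriction up to isomorphism. Projective
  resolutions over the integral group ring of a group with elements of type \<open>'g\<close> exist whenever
  \<open>'p\<close> is large enough; the standard resolution lives in \<open>'g list \<Rightarrow> int\<close>.\<close>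

definition projective_resolution ::
  "('r, 'c) ring_scheme \<Rightarrow> ('r, 'a) module \<Rightarrow> (nat \<Rightarrow> ('r, 'p) module) \<Rightarrow>
   (nat \<Rightarrow> 'p \<Rightarrow> 'p) \<Rightarrow> ('p \<Rightarrow> 'a) \<Rightarrow> bool" where
  "projective_resolution R A P d \<epsilon> \<longleftrightarrow>
     (\<forall>i. projective_module R (P i)) \<and>
     (\<forall>i. d i \<in> linear_maps R (P (Suc i)) (P i)) \<and>
     \<epsilon> \<in> linear_maps R (P 0) A \<and>
     \<epsilon> ` carrier (P 0) = carrier A \<and>
     d 0 ` carrier (P 1) = {x \<in> carrier (P 0). \<epsilon> x = \<zero>\<^bsub>A\<^esub>} \<and>
     (\<forall>i. d (Suc i) ` carrier (P (Suc (Suc i))) =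
        {x \<in> carrier (P (Suc i)). d i x = \<zero>\<^bsub>P i\<^esub>})"

section \<open>Cohomology of the complex of homomorphisms into a module\<close>

definition Hom_group ::
  "('r, 'c) ring_scheme \<Rightarrow> ('r, 'p) module \<Rightarrow> ('r, 'm) module \<Rightarrow> ('p \<Rightarrow> 'm) monoid" where
  "Hom_group R P M = \<lparr>carrier = linear_maps R P M \<inter> extensional (carrier P),
     monoid.mult = (\<lambda>f g. \<lambda>x\<in>carrier P. f x \<oplus>\<^bsub>M\<^esub> g x),
     one = (\<lambda>x\<in>carrier P. \<zero>\<^bsub>M\<^esub>)\<rparr>"

definition cocycles ::
  "('r, 'c) ring_scheme \<Rightarrow> (nat \<Rightarrow> ('r, 'p) module) \<Rightarrow> (nat \<Rightarrow> 'p \<Rightarrow> 'p) \<Rightarrow>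
   ('r, 'm) module \<Rightarrow> nat \<Rightarrow> ('p \<Rightarrow> 'm) set" where
  "cocycles R P d M n =
     {f \<in> carrier (Hom_group R (P n) M). \<forall>x\<in>carrier (P (Suc n)). f (d n x) = \<zero>\<^bsub>M\<^esub>}"

definition coboundaries ::
  "('r, 'c) ring_scheme \<Rightarrow> (nat \<Rightarrow> ('r, 'p) module) \<Rightarrow> (nat \<Rightarrow> 'p \<Rightarrow> 'p) \<Rightarrow>
   ('r, 'm) module \<Rightarrow> nat \<Rightarrow> ('p \<Rightarrow> 'm) set" where
  "coboundaries R P d M n = (case n of
     0 \<Rightarrow> {\<one>\<^bsub>Hom_group R (P 0) M\<^esub>}
   | Suc m \<Rightarrow> (\<lambda>f. compose (carrier (P (Suc m))) f (d m)) ` carrier (Hom_group R (P m) M))"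

text \<open>The group cohomology of \<open>G\<close> with coefficients in \<open>M\<close> is the following group when \<open>R\<close> is
  the integral group ring of \<open>G\<close> and \<open>(P, d)\<close> is any projective resolution of the trivial module.
  It depends on the choice of the resolution only up to isomorphism.\<close>

definition Hom_cohomology ::
  "('r, 'c) ring_scheme \<Rightarrow> (nat \<Rightarrow> ('r, 'p) module) \<Rightarrow> (nat \<Rightarrow> 'p \<Rightarrow> 'p) \<Rightarrow>
   ('r, 'm) module \<Rightarrow> nat \<Rightarrow> ('p \<Rightarrow> 'm) set monoid" where
  "Hom_cohomology R P d M n =
     (Hom_group R (P n) M)\<lparr>carrier := cocycles R P d M n\<rparr> Mod coboundaries R P d M n"

section \<open>Group rings\<close>

text \<open>Formal sums \<open>\<Sum>g. a g * g\<close> are functions that vanish off the group. The product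
  makes sense for finitely supported \<open>a\<close> and arbitrary \<open>b\<close>.\<close>

definition convolution ::
  "('g, 'c) monoid_scheme \<Rightarrow> ('g \<Rightarrow> 'k) \<Rightarrow> ('g \<Rightarrow> 'k) \<Rightarrow> 'g \<Rightarrow> 'k::comm_ring_1" where
  "convolution G a b = (\<lambda>g. if g \<in> carrier G
     then \<Sum>h | h \<in> carrier G \<and> a h \<noteq> 0. a h * b (inv\<^bsub>G\<^esub> h \<otimes>\<^bsub>G\<^esub> g) else 0)"

definition group_ring :: "('g, 'c) monoid_scheme \<Rightarrow> ('g \<Rightarrow> 'k::comm_ring_1) ring" where
  "group_ring G = \<lparr>carrier = {a. finite {g. a g \<noteq> 0} \<and> {g. a g \<noteq> 0} \<subseteq> carrier G},
     monoid.mult = convolution G,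
     one = (\<lambda>g. if g = \<one>\<^bsub>G\<^esub> then 1 else 0),
     ring.zero = (\<lambda>g. 0),
     add = (\<lambda>a b g. a g + b g)\<rparr>"

abbreviation integral_group_ring :: "('g, 'c) monoid_scheme \<Rightarrow> ('g \<Rightarrow> int) ring" where
  "integral_group_ring \<equiv> group_ring"

abbreviation complex_group_ring :: "('g, 'c) monoid_scheme \<Rightarrow> ('g \<Rightarrow> complex) ring" where
  "complex_group_ring \<equiv> group_ring"

definition trivial_module :: "('g \<Rightarrow> int, int) module" where
  "trivial_module = module_along (\<lambda>r. \<Sum>g | r g \<noteq> 0. r g) \<Z>"

section \<open>The reduced group C*-algebra\<close>

definition L2 :: "('g, 'c) monoid_scheme \<Rightarrow> ('g \<Rightarrow> complex) set" where
  "L2 G = {b. (\<forall>g. g \<notin> carrier G \<longrightarrow> b g = 0) \<and> (\<lambda>g. (cmod (b g))\<^sup>2) summable_on carrier G}"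

definition L2_norm :: "('g, 'c) monoid_scheme \<Rightarrow> ('g \<Rightarrow> complex) \<Rightarrow> real" where
  "L2_norm G b = sqrt (\<Sum>\<^sub>\<infinity>g\<in>carrier G. (cmod (b g))\<^sup>2)"

definition op_norm :: "('g, 'c) monoid_scheme \<Rightarrow> ('g \<Rightarrow> complex) \<Rightarrow> real" where
  "op_norm G a = Sup {L2_norm G (convolution G a b) | b. b \<in> L2 G \<and> L2_norm G b = 1}"

text \<open>The completion is the ring of Cauchy sequences modulo the ideal of null sequences.\<close>

definition Cauchy_ring :: "('g, 'c) monoid_scheme \<Rightarrow> (nat \<Rightarrow> 'g \<Rightarrow> complex) ring" where
  "Cauchy_ring G = \<lparr>carrier = {s. (\<forall>k. s k \<in> carrier (complex_group_ring G)) \<and>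
       (\<forall>e>0. \<exists>N. \<forall>j\<ge>N. \<forall>k\<ge>N. op_norm G (\<lambda>g. s j g - s k g) < e)},
     monoid.mult = (\<lambda>s t k. s k \<otimes>\<^bsub>complex_group_ring G\<^esub> t k),
     one = (\<lambda>k. \<one>\<^bsub>complex_group_ring G\<^esub>),
     ring.zero = (\<lambda>k. \<zero>\<^bsub>complex_group_ring G\<^esub>),
     add = (\<lambda>s t k. s k \<oplus>\<^bsub>complex_group_ring G\<^esub> t k)\<rparr>"

definition null_sequences :: "('g, 'c) monoid_scheme \<Rightarrow> (nat \<Rightarrow> 'g \<Rightarrow> complex) set" where
  "null_sequences G = {s. (\<forall>k. s k \<in> carrier (complex_group_ring G)) \<and>
     (\<lambda>k. op_norm G (s k)) \<longlonglongrightarrow> 0}"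

definition reduced_Cstar :: "('g, 'c) monoid_scheme \<Rightarrow> (nat \<Rightarrow> 'g \<Rightarrow> complex) set ring" where
  "reduced_Cstar G = Cauchy_ring G Quot null_sequences G"

definition to_reduced_Cstar ::
  "('g, 'c) monoid_scheme \<Rightarrow> ('g \<Rightarrow> complex) \<Rightarrow> (nat \<Rightarrow> 'g \<Rightarrow> complex) set" where
  "to_reduced_Cstar G a = null_sequences G +>\<^bsub>Cauchy_ring G\<^esub> (\<lambda>k. a)"

definition reduced_Cstar_module ::
  "('g, 'c) monoid_scheme \<Rightarrow> ('g \<Rightarrow> int, (nat \<Rightarrow> 'g \<Rightarrow> complex) set) module" where
  "reduced_Cstar_module G =
     module_along (\<lambda>r. to_reduced_Cstar G (\<lambda>g. of_int (r g))) (reduced_Cstar G)"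

section \<open>Continuous functions on the torus\<close>

text \<open>The topology on \<open>nat \<Rightarrow> complex\<close> is the product topology.\<close>

definition torus :: "nat \<Rightarrow> (nat \<Rightarrow> complex) set" where
  "torus n = {1..n} \<rightarrow>\<^sub>E {z. cmod z = 1}"

definition C_torus :: "nat \<Rightarrow> ((nat \<Rightarrow> complex) \<Rightarrow> complex) ring" where
  "C_torus n = \<lparr>carrier = {f \<in> extensional (torus n). continuous_on (torus n) f},
     monoid.mult = (\<lambda>f g. \<lambda>z\<in>torus n. f z * g z),
     one = (\<lambda>z\<in>torus n. 1),
     ring.zero = (\<lambda>z\<in>torus n. 0),
     add = (\<lambda>f g. \<lambda>z\<in>torus n. f z + g z)\<rparr>"

definition coordinate_ideal :: "nat \<Rightarrow> ((nat \<Rightarrow> complex) \<Rightarrow> complex) set" where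
  "coordinate_ideal n = {\<lambda>z\<in>torus n. \<Sum>i\<in>{1..n}. (z i - 1) * f i z | f.
     \<forall>i\<in>{1..n}. f i \<in> carrier (C_torus n)}"

end

theory Submission
  imports Defs
begin

text \<open>Let \<open>R\<close> be the integral group ring of \<open>G\<close>, the free abelian group on \<open>X 1, ..., X n\<close>,
  and let \<open>M\<close> be an \<open>R\<close>-module. The proof has an algebraic and an analytic half.

  Algebra: for every \<open>M\<close>, the \<open>n\<close>-th cohomology of \<open>G\<close> with coefficients in \<open>M\<close> is the quotient of
  \<open>M\<close> by \<open>(X 1 - 1) M + ... + (X n - 1) M\<close>. The elements \<open>X j - 1\<close> form a regular sequence in \<open>R\<close>
  (\<open>difference_ideal_regular\<close>) that generates the augmentation ideal (\<open>augmentation_ideal\<close>), so the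
  Koszul complex on them is a free resolution of the trivial module (\<open>koszul_resolution\<close>). Its last
  nonzero module, in degree \<open>n\<close>, is free on one element, and the boundary of that element is the
  sum of the elements of the basis in degree \<open>n - 1\<close> with the coefficients \<open>X j - 1\<close>, up to sign;
  this gives the claim for the Koszul resolution. The comparison theorem (\<open>chain_map_exists\<close>,
  \<open>chain_maps_homotopic\<close>) carries it over to an arbitrary projective resolution
  (\<open>top_cohomology\<close>). Comparison needs liftings between modules of different types; these come
  from the dual basis of a projective module (\<open>projective_imp_dual_basis\<close>, \<open>projective_lift\<close>).

  Analysis: the Fourier transform, which sends the generator \<open>X i\<close> to the coordinate function
  \<open>Z i\<close>, extends to a ring isomorphism from the reduced C*-algebra to the continuous functions on
  the torus (\<open>gelfand_ring_iso\<close>). It is isometric: \<open>op_norm_le\<close> bounds the operator norm by the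
  supremum of the Fourier transform, by the Parseval identity on a sufficiently fine grid of roots of
  unity, and \<open>norm_fourier_le_op_norm\<close> gives the other inequality by testing the operator on
  characters cut off to large boxes. Hence a sequence in the complex group ring is Cauchy, or null, if and
  only if its Fourier transforms converge uniformly, or converge uniformly to zero. Surjectivity is the
  Stone-Weierstrass theorem (\<open>fourier_dense\<close>).

  The isomorphism turns multiplication by \<open>X j - 1\<close> into multiplication by \<open>Z j - 1\<close>, so it maps
  the submodule generated by the multiples of the \<open>X j - 1\<close> onto the coordinate ideal
  (\<open>gelfand_difference_submodule\<close>), and the two quotients agree.\<close>

abbreviation "lookup \<equiv> Poly_Mapping.lookup"
abbreviation "keys \<equiv> Poly_Mapping.keys"
abbreviation "single \<equiv> Poly_Mapping.single"

section \<open>Linear maps and dual bases\<close>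

lemma linear_mapsI:
  assumes "\<And>x. x \<in> carrier M \<Longrightarrow> f x \<in> carrier N"
    and "\<And>x y. \<lbrakk>x \<in> carrier M; y \<in> carrier M\<rbrakk> \<Longrightarrow> f (x \<oplus>\<^bsub>M\<^esub> y) = f x \<oplus>\<^bsub>N\<^esub> f y"
    and "\<And>r x. \<lbrakk>r \<in> carrier R; x \<in> carrier M\<rbrakk> \<Longrightarrow> f (r \<odot>\<^bsub>M\<^esub> x) = r \<odot>\<^bsub>N\<^esub> f x"
  shows "f \<in> linear_maps R M N"
  using assms by (auto simp: linear_maps_def)

lemma linear_maps_closed: "\<lbrakk>f \<in> linear_maps R M N; x \<in> carrier M\<rbrakk> \<Longrightarrow> f x \<in> carrier N"
  and linear_maps_add: "\<lbrakk>f \<in> linear_maps R M N; x \<in> carrier M; y \<in> carrier M\<rbrakk>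
    \<Longrightarrow> f (x \<oplus>\<^bsub>M\<^esub> y) = f x \<oplus>\<^bsub>N\<^esub> f y"
  and linear_maps_smult: "\<lbrakk>f \<in> linear_maps R M N; r \<in> carrier R; x \<in> carrier M\<rbrakk>
    \<Longrightarrow> f (r \<odot>\<^bsub>M\<^esub> x) = r \<odot>\<^bsub>N\<^esub> f x"
  by (auto simp: linear_maps_def)

lemma linear_maps_comp:
  assumes "f \<in> linear_maps R M N" "g \<in> linear_maps R N Q"
  shows "(\<lambda>x. g (f x)) \<in> linear_maps R M Q"
  using assms by (auto simp: linear_maps_def Pi_iff)

lemma linear_maps_zero:
  assumes "left_module R M" "left_module R N" "f \<in> linear_maps R M N"
  shows "f \<zero>\<^bsub>M\<^esub> = \<zero>\<^bsub>N\<^esub>"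
proof -
  interpret M: left_module R M by fact
  interpret N: left_module R N by fact
  have "f \<zero>\<^bsub>M\<^esub> \<oplus>\<^bsub>N\<^esub> f \<zero>\<^bsub>M\<^esub> = f \<zero>\<^bsub>M\<^esub> \<oplus>\<^bsub>N\<^esub> \<zero>\<^bsub>N\<^esub>"
    using linear_maps_add[OF assms(3), of "\<zero>\<^bsub>M\<^esub>" "\<zero>\<^bsub>M\<^esub>"] linear_maps_closed[OF assms(3), of "\<zero>\<^bsub>M\<^esub>"]
    by simp
  then show ?thesis
    using linear_maps_closed[OF assms(3), of "\<zero>\<^bsub>M\<^esub>"] by simp
qed

lemma linear_maps_uminus:
  assumes "left_module R M" "left_module R N" "f \<in> linear_maps R M N" "x \<in> carrier M"
  shows "f (\<ominus>\<^bsub>M\<^esub> x) = \<ominus>\<^bsub>N\<^esub> f x"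
proof -
  interpret M: left_module R M by fact
  interpret N: left_module R N by fact
  have "f (\<ominus>\<^bsub>M\<^esub> x) \<oplus>\<^bsub>N\<^esub> f x = \<zero>\<^bsub>N\<^esub>"
    using linear_maps_add[OF assms(3), of "\<ominus>\<^bsub>M\<^esub> x" x] assms linear_maps_zero[OF assms(1-3)]
    by (simp add: M.M.l_neg)
  then show ?thesis
    using assms by (simp add: N.M.minus_equality linear_maps_closed)
qed

lemma linear_maps_minus:
  assumes "left_module R M" "left_module R N" "f \<in> linear_maps R M N" "x \<in> carrier M" "y \<in> carrier M"
  shows "f (x \<ominus>\<^bsub>M\<^esub> y) = f x \<ominus>\<^bsub>N\<^esub> f y"
proof -
  interpret M: left_module R M by fact
  show ?thesis
    using assms by (simp add: a_minus_def linear_maps_add linear_maps_uminus)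
qed

lemma linear_maps_finsum:
  assumes "left_module R M" "left_module R N" "f \<in> linear_maps R M N" "finite A" "g \<in> A \<rightarrow> carrier M"
  shows "f (finsum M g A) = finsum N (\<lambda>a. f (g a)) A"
proof -
  interpret M: left_module R M by fact
  interpret N: left_module R N by fact
  show ?thesis
    using assms(4,5)
  proof (induction A)
    case empty
    then show ?case using linear_maps_zero[OF assms(1-3)] by simp
  next
    case (insert a A)
    then have "g a \<in> carrier M" "g \<in> A \<rightarrow> carrier M" by auto
    then show ?case
      using insert linear_maps_add[OF assms(3), of "g a" "finsum M g A"] linear_maps_closed[OF assms(3)]
      by (simp add: Pi_iff)
  qed
qed

context left_module
begin

lemma smult_l_zero: assumes "x \<in> carrier M" shows "\<zero>\<^bsub>R\<^esub> \<odot>\<^bsub>M\<^esub> x = \<zero>\<^bsub>M\<^esub>"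
proof -
  have "\<zero>\<^bsub>R\<^esub> \<odot>\<^bsub>M\<^esub> x \<oplus>\<^bsub>M\<^esub> \<zero>\<^bsub>R\<^esub> \<odot>\<^bsub>M\<^esub> x = \<zero>\<^bsub>R\<^esub> \<odot>\<^bsub>M\<^esub> x \<oplus>\<^bsub>M\<^esub> \<zero>\<^bsub>M\<^esub>"
    using smult_l_distr[of "\<zero>\<^bsub>R\<^esub>" "\<zero>\<^bsub>R\<^esub>" x] assms by (simp add: smult_closed)
  then show ?thesis
    using assms by (simp add: smult_closed)
qed

lemma smult_r_zero: assumes "a \<in> carrier R" shows "a \<odot>\<^bsub>M\<^esub> \<zero>\<^bsub>M\<^esub> = \<zero>\<^bsub>M\<^esub>"
proof -
  have "a \<odot>\<^bsub>M\<^esub> \<zero>\<^bsub>M\<^esub> \<oplus>\<^bsub>M\<^esub> a \<odot>\<^bsub>M\<^esub> \<zero>\<^bsub>M\<^esub> = a \<odot>\<^bsub>M\<^esub> \<zero>\<^bsub>M\<^esub> \<oplus>\<^bsub>M\<^esub> \<zero>\<^bsub>M\<^esub>"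
    using smult_r_distr[of a "\<zero>\<^bsub>M\<^esub>" "\<zero>\<^bsub>M\<^esub>"] assms by (simp add: smult_closed)
  then show ?thesis
    using assms by (simp add: smult_closed)
qed

lemma smult_finsum:
  assumes "a \<in> carrier R" "finite A" "g \<in> A \<rightarrow> carrier M"
  shows "a \<odot>\<^bsub>M\<^esub> finsum M g A = finsum M (\<lambda>i. a \<odot>\<^bsub>M\<^esub> g i) A"
  using assms(2,3)
proof (induction A)
  case empty
  then show ?case using assms(1) by (simp add: smult_r_zero)
next
  case (insert i A)
  then show ?case using assms(1) by (simp add: smult_r_distr smult_closed Pi_iff)
qed

text \<open>Linear combinations, taken over the support of the coefficients, because \<open>finsum\<close> over an
  infinite set is zero.\<close>

definition lincomb :: "'i set \<Rightarrow> ('i \<Rightarrow> 'r) \<Rightarrow> ('i \<Rightarrow> 'a) \<Rightarrow> 'a" where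
  "lincomb I c m = finsum M (\<lambda>i. c i \<odot>\<^bsub>M\<^esub> m i) {i \<in> I. c i \<noteq> \<zero>\<^bsub>R\<^esub>}"

lemma lincomb_eq_finsum:
  assumes "finite U" "U \<subseteq> I" "{i \<in> I. c i \<noteq> \<zero>\<^bsub>R\<^esub>} \<subseteq> U" "c \<in> I \<rightarrow> carrier R" "m \<in> I \<rightarrow> carrier M"
  shows "lincomb I c m = finsum M (\<lambda>i. c i \<odot>\<^bsub>M\<^esub> m i) U"
  unfolding lincomb_def
  by (rule M.add.finprod_mono_neutral_cong_left)
    (use assms in \<open>auto simp: Pi_iff subset_iff smult_closed smult_l_zero\<close>)

lemma lincomb_closed:
  assumes "c \<in> I \<rightarrow> carrier R" "m \<in> I \<rightarrow> carrier M"
  shows "lincomb I c m \<in> carrier M"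
  unfolding lincomb_def by (rule M.finsum_closed) (use assms in \<open>auto simp: Pi_iff smult_closed\<close>)

lemma lincomb_add:
  assumes "c \<in> I \<rightarrow> carrier R" "c' \<in> I \<rightarrow> carrier R" "m \<in> I \<rightarrow> carrier M"
    and "finite {i \<in> I. c i \<noteq> \<zero>\<^bsub>R\<^esub>}" "finite {i \<in> I. c' i \<noteq> \<zero>\<^bsub>R\<^esub>}"
  shows "lincomb I (\<lambda>i. c i \<oplus>\<^bsub>R\<^esub> c' i) m = lincomb I c m \<oplus>\<^bsub>M\<^esub> lincomb I c' m"
proof -
  define U where "U = {i \<in> I. c i \<noteq> \<zero>\<^bsub>R\<^esub>} \<union> {i \<in> I. c' i \<noteq> \<zero>\<^bsub>R\<^esub>}"
  have U: "finite U" "U \<subseteq> I" using assms by (auto simp: U_def)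
  have *: "lincomb I b m = finsum M (\<lambda>i. b i \<odot>\<^bsub>M\<^esub> m i) U"
    if "{i \<in> I. b i \<noteq> \<zero>\<^bsub>R\<^esub>} \<subseteq> U" "b \<in> I \<rightarrow> carrier R" for b
    using lincomb_eq_finsum[OF U that assms(3)] .
  have "lincomb I (\<lambda>i. c i \<oplus>\<^bsub>R\<^esub> c' i) m = finsum M (\<lambda>i. (c i \<oplus>\<^bsub>R\<^esub> c' i) \<odot>\<^bsub>M\<^esub> m i) U"
    by (rule *) (use assms in \<open>auto simp: U_def Pi_iff\<close>)
  also have "\<dots> = finsum M (\<lambda>i. c i \<odot>\<^bsub>M\<^esub> m i \<oplus>\<^bsub>M\<^esub> c' i \<odot>\<^bsub>M\<^esub> m i) U"
    by (rule M.add.finprod_cong')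
      (use assms U(2) in \<open>auto simp: Pi_iff subset_iff smult_closed smult_l_distr\<close>)
  also have "\<dots> = finsum M (\<lambda>i. c i \<odot>\<^bsub>M\<^esub> m i) U \<oplus>\<^bsub>M\<^esub> finsum M (\<lambda>i. c' i \<odot>\<^bsub>M\<^esub> m i) U"
    by (rule M.finsum_addf) (use assms U(2) in \<open>auto simp: Pi_iff subset_iff smult_closed\<close>)
  also have "\<dots> = lincomb I c m \<oplus>\<^bsub>M\<^esub> lincomb I c' m"
    using *[of c] *[of c'] assms by (simp add: U_def)
  finally show ?thesis .
qed

lemma lincomb_smult:
  assumes "c \<in> I \<rightarrow> carrier R" "m \<in> I \<rightarrow> carrier M" "r \<in> carrier R"
    and "finite {i \<in> I. c i \<noteq> \<zero>\<^bsub>R\<^esub>}"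
  shows "lincomb I (\<lambda>i. r \<otimes>\<^bsub>R\<^esub> c i) m = r \<odot>\<^bsub>M\<^esub> lincomb I c m"
proof -
  define U where "U = {i \<in> I. c i \<noteq> \<zero>\<^bsub>R\<^esub>}"
  have U: "finite U" "U \<subseteq> I" using assms by (auto simp: U_def)
  have "lincomb I (\<lambda>i. r \<otimes>\<^bsub>R\<^esub> c i) m = finsum M (\<lambda>i. (r \<otimes>\<^bsub>R\<^esub> c i) \<odot>\<^bsub>M\<^esub> m i) U"
    by (rule lincomb_eq_finsum[OF U]) (use assms in \<open>auto simp: U_def Pi_iff\<close>)
  also have "\<dots> = finsum M (\<lambda>i. r \<odot>\<^bsub>M\<^esub> (c i \<odot>\<^bsub>M\<^esub> m i)) U"
    by (rule M.add.finprod_cong')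
      (use assms U(2) in \<open>auto simp: Pi_iff subset_iff smult_closed smult_assoc\<close>)
  also have "\<dots> = r \<odot>\<^bsub>M\<^esub> finsum M (\<lambda>i. c i \<odot>\<^bsub>M\<^esub> m i) U"
    by (rule smult_finsum[symmetric])
      (use assms U in \<open>auto simp: Pi_iff subset_iff smult_closed\<close>)
  finally show ?thesis by (simp add: lincomb_def U_def)
qed

end

lemma linear_maps_diff:
  assumes "left_module R Q" and f: "f \<in> linear_maps R M Q" and g: "g \<in> linear_maps R M Q"
  shows "(\<lambda>x. f x \<ominus>\<^bsub>Q\<^esub> g x) \<in> linear_maps R M Q"
proof (rule linear_mapsI)
  interpret left_module R Q by fact
  show "f x \<ominus>\<^bsub>Q\<^esub> g x \<in> carrier Q" if "x \<in> carrier M" for x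
    using that linear_maps_closed[OF f] linear_maps_closed[OF g] by simp
  show "f (x \<oplus>\<^bsub>M\<^esub> y) \<ominus>\<^bsub>Q\<^esub> g (x \<oplus>\<^bsub>M\<^esub> y) = (f x \<ominus>\<^bsub>Q\<^esub> g x) \<oplus>\<^bsub>Q\<^esub> (f y \<ominus>\<^bsub>Q\<^esub> g y)"
    if "x \<in> carrier M" "y \<in> carrier M" for x y
    using that linear_maps_closed[OF f] linear_maps_closed[OF g]
    by (simp add: linear_maps_add[OF f] linear_maps_add[OF g] a_minus_def M.minus_add M.a_ac)
  show "f (r \<odot>\<^bsub>M\<^esub> x) \<ominus>\<^bsub>Q\<^esub> g (r \<odot>\<^bsub>M\<^esub> x) = r \<odot>\<^bsub>Q\<^esub> (f x \<ominus>\<^bsub>Q\<^esub> g x)"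
    if r: "r \<in> carrier R" and x: "x \<in> carrier M" for r x
  proof -
    have fg: "f x \<in> carrier Q" "g x \<in> carrier Q"
      using x linear_maps_closed[OF f] linear_maps_closed[OF g] by auto
    then have "r \<odot>\<^bsub>Q\<^esub> (\<ominus>\<^bsub>Q\<^esub> g x) \<oplus>\<^bsub>Q\<^esub> r \<odot>\<^bsub>Q\<^esub> g x = \<zero>\<^bsub>Q\<^esub>"
      using r by (simp add: M.l_neg smult_r_zero flip: smult_r_distr)
    then have "r \<odot>\<^bsub>Q\<^esub> (\<ominus>\<^bsub>Q\<^esub> g x) = \<ominus>\<^bsub>Q\<^esub> (r \<odot>\<^bsub>Q\<^esub> g x)"
      using r fg by (simp add: M.minus_equality smult_closed)
    then show ?thesis
      using r x fg by (simp add: linear_maps_smult[OF f] linear_maps_smult[OF g] a_minus_def smult_r_distr)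
  qed
qed

lemma linear_maps_restrict:
  assumes "left_module R P" and f: "f \<in> linear_maps R P M"
  shows "restrict f (carrier P) \<in> linear_maps R P M"
proof (rule linear_mapsI)
  interpret left_module R P by fact
  show "restrict f (carrier P) (x \<oplus>\<^bsub>P\<^esub> y) = restrict f (carrier P) x \<oplus>\<^bsub>M\<^esub> restrict f (carrier P) y"
    if "x \<in> carrier P" "y \<in> carrier P" for x y
    using that by (simp add: linear_maps_add[OF f])
  show "restrict f (carrier P) (r \<odot>\<^bsub>P\<^esub> x) = r \<odot>\<^bsub>M\<^esub> restrict f (carrier P) x"
    if "r \<in> carrier R" "x \<in> carrier P" for r x
    using that by (simp add: linear_maps_smult[OF f] smult_closed)
qed (use linear_maps_closed[OF f] in simp)

lemma linear_maps_lincomb: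
  assumes "left_module R M" "left_module R N" "f \<in> linear_maps R M N"
    and "c \<in> I \<rightarrow> carrier R" "m \<in> I \<rightarrow> carrier M" "finite {i \<in> I. c i \<noteq> \<zero>\<^bsub>R\<^esub>}"
  shows "f (left_module.lincomb R M I c m) = left_module.lincomb R N I c (\<lambda>i. f (m i))"
proof -
  interpret M: left_module R M by fact
  interpret N: left_module R N by fact
  have "f (M.lincomb I c m) = finsum N (\<lambda>i. f (c i \<odot>\<^bsub>M\<^esub> m i)) {i \<in> I. c i \<noteq> \<zero>\<^bsub>R\<^esub>}"
    unfolding M.lincomb_def
    by (rule linear_maps_finsum) (use assms in \<open>auto simp: Pi_iff M.smult_closed\<close>)
  also have "\<dots> = N.lincomb I c (\<lambda>i. f (m i))"
    unfolding N.lincomb_def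
    by (rule N.M.add.finprod_cong')
      (use assms in \<open>auto simp: Pi_iff N.smult_closed linear_maps_closed linear_maps_smult\<close>)
  finally show ?thesis .
qed

text \<open>A dual basis \<open>(b, c)\<close> of \<open>P\<close>, indexed by \<open>I\<close>: elements \<open>b i\<close> of \<open>P\<close> and linear
  forms \<open>\<lambda>x. c x i\<close> such that every \<open>x\<close> is the finite sum of the \<open>c x i * b i\<close>.\<close>

definition dual_basis ::
  "('r, 'c) ring_scheme \<Rightarrow> ('r, 'p) module \<Rightarrow> 'i set \<Rightarrow> ('i \<Rightarrow> 'p) \<Rightarrow> ('p \<Rightarrow> 'i \<Rightarrow> 'r) \<Rightarrow> bool" where
  "dual_basis R P I b c \<longleftrightarrow> b \<in> I \<rightarrow> carrier P \<and>
     (\<forall>x\<in>carrier P. c x \<in> I \<rightarrow> carrier R \<and> finite {i \<in> I. c x i \<noteq> \<zero>\<^bsub>R\<^esub>} \<and>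
        left_module.lincomb R P I (c x) b = x) \<and>
     (\<forall>i\<in>I. \<forall>x\<in>carrier P. \<forall>y\<in>carrier P. c (x \<oplus>\<^bsub>P\<^esub> y) i = c x i \<oplus>\<^bsub>R\<^esub> c y i) \<and>
     (\<forall>i\<in>I. \<forall>r\<in>carrier R. \<forall>x\<in>carrier P. c (r \<odot>\<^bsub>P\<^esub> x) i = r \<otimes>\<^bsub>R\<^esub> c x i)"

lemma dual_basis_linear:
  assumes P: "left_module R P" and M: "left_module R M"
    and db: "dual_basis R P I b c" and m: "m \<in> I \<rightarrow> carrier M"
  shows "(\<lambda>x. left_module.lincomb R M I (c x) m) \<in> linear_maps R P M"
proof -
  interpret P: left_module R P by fact
  interpret M: left_module R M by fact
  have cong: "M.lincomb I a m = M.lincomb I a' m" if "\<And>i. i \<in> I \<Longrightarrow> a i = a' i" "a' \<in> I \<rightarrow> carrier R" for a a'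
    unfolding M.lincomb_def
    by (rule M.M.add.finprod_cong') (use that m in \<open>auto simp: Pi_iff M.smult_closed\<close>)
  show ?thesis
  proof (rule linear_mapsI)
    fix x assume "x \<in> carrier P"
    then show "M.lincomb I (c x) m \<in> carrier M"
      using db m by (auto simp: dual_basis_def intro!: M.lincomb_closed)
  next
    fix x y assume xy: "x \<in> carrier P" "y \<in> carrier P"
    have "M.lincomb I (c (x \<oplus>\<^bsub>P\<^esub> y)) m = M.lincomb I (\<lambda>i. c x i \<oplus>\<^bsub>R\<^esub> c y i) m"
      by (rule cong) (use db xy in \<open>auto simp: dual_basis_def Pi_iff\<close>)
    also have "\<dots> = M.lincomb I (c x) m \<oplus>\<^bsub>M\<^esub> M.lincomb I (c y) m"
      by (rule M.lincomb_add) (use db xy m in \<open>auto simp: dual_basis_def\<close>)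
    finally show "M.lincomb I (c (x \<oplus>\<^bsub>P\<^esub> y)) m = M.lincomb I (c x) m \<oplus>\<^bsub>M\<^esub> M.lincomb I (c y) m" .
  next
    fix r x assume rx: "r \<in> carrier R" "x \<in> carrier P"
    have "M.lincomb I (c (r \<odot>\<^bsub>P\<^esub> x)) m = M.lincomb I (\<lambda>i. r \<otimes>\<^bsub>R\<^esub> c x i) m"
      by (rule cong) (use db rx in \<open>auto simp: dual_basis_def Pi_iff\<close>)
    also have "\<dots> = r \<odot>\<^bsub>M\<^esub> M.lincomb I (c x) m"
      by (rule M.lincomb_smult) (use db rx m in \<open>auto simp: dual_basis_def\<close>)
    finally show "M.lincomb I (c (r \<odot>\<^bsub>P\<^esub> x)) m = r \<odot>\<^bsub>M\<^esub> M.lincomb I (c x) m" .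
  qed
qed

lemma dual_basis_lift:
  assumes P: "left_module R P" and M: "left_module R M" and N: "left_module R N"
    and db: "dual_basis R P I b c"
    and f: "f \<in> linear_maps R M N" and g: "g \<in> linear_maps R P N"
    and sub: "g ` carrier P \<subseteq> f ` carrier M"
  shows "\<exists>h \<in> linear_maps R P M. \<forall>x\<in>carrier P. f (h x) = g x"
proof -
  interpret P: left_module R P by fact
  interpret M: left_module R M by fact
  interpret N: left_module R N by fact
  have b: "b \<in> I \<rightarrow> carrier P" using db by (simp add: dual_basis_def)
  have "\<exists>y\<in>carrier M. f y = g (b i)" if "i \<in> I" for i
  proof -
    have "g (b i) \<in> f ` carrier M" by (rule subsetD[OF sub]) (use b that in \<open>auto simp: Pi_iff\<close>)
    then show ?thesis by (simp add: image_iff eq_commute)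
  qed
  then obtain m where m: "\<And>i. i \<in> I \<Longrightarrow> m i \<in> carrier M" "\<And>i. i \<in> I \<Longrightarrow> f (m i) = g (b i)"
    by metis
  have "f (M.lincomb I (c x) m) = g x" if x: "x \<in> carrier P" for x
  proof -
    have cx: "c x \<in> I \<rightarrow> carrier R" "finite {i \<in> I. c x i \<noteq> \<zero>\<^bsub>R\<^esub>}" "P.lincomb I (c x) b = x"
      using db x by (auto simp: dual_basis_def)
    have "f (M.lincomb I (c x) m) = N.lincomb I (c x) (\<lambda>i. f (m i))"
      by (rule linear_maps_lincomb[OF M N f]) (use cx m in auto)
    also have "\<dots> = N.lincomb I (c x) (\<lambda>i. g (b i))"
      unfolding N.lincomb_def
      by (rule N.M.add.finprod_cong')
        (use cx m b g in \<open>auto simp: Pi_iff N.smult_closed linear_maps_closed\<close>)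
    also have "\<dots> = g (P.lincomb I (c x) b)"
      by (rule linear_maps_lincomb[OF P N g, symmetric]) (use cx b in auto)
    finally show ?thesis using cx by simp
  qed
  moreover have "(\<lambda>x. M.lincomb I (c x) m) \<in> linear_maps R P M"
    by (rule dual_basis_linear[OF P M db]) (use m(1) in \<open>simp add: Pi_iff\<close>)
  ultimately show ?thesis by (intro bexI[of _ "\<lambda>x. M.lincomb I (c x) m"] ballI)
qed

lemma dual_basis_imp_projective:
  assumes "left_module R P" "dual_basis R P I b c"
  shows "projective_module R P"
  unfolding projective_module_def
proof (intro conjI allI impI)
  fix M :: "('a, 'c \<Rightarrow> 'a) module" and N :: "('a, 'c) module" and f g
  assume "left_module R M \<and> left_module R N \<and>
        f \<in> linear_maps R M N \<and> f ` carrier M = carrier N \<and> g \<in> linear_maps R P N"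
  then show "\<exists>h \<in> linear_maps R P M. \<forall>x\<in>carrier P. f (h x) = g x"
    by (intro dual_basis_lift[OF assms(1) _ _ assms(2), of M N]) (auto simp: linear_maps_closed)
qed fact

text \<open>The free module on the set \<open>B\<close>: the functions of finite support that vanish off \<open>B\<close>.\<close>

definition free_module :: "('r, 'c) ring_scheme \<Rightarrow> 'i set \<Rightarrow> ('r, 'i \<Rightarrow> 'r) module" where
  "free_module R B = \<lparr>carrier = {a. (\<forall>i. a i \<in> carrier R) \<and> (\<forall>i. i \<notin> B \<longrightarrow> a i = \<zero>\<^bsub>R\<^esub>) \<and>
       finite {i. a i \<noteq> \<zero>\<^bsub>R\<^esub>}},
     monoid.mult = undefined, one = undefined,
     ring.zero = (\<lambda>i. \<zero>\<^bsub>R\<^esub>), add = (\<lambda>a b i. a i \<oplus>\<^bsub>R\<^esub> b i),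
     module.smult = (\<lambda>r a i. r \<otimes>\<^bsub>R\<^esub> a i)\<rparr>"

lemma left_module_free_module:
  assumes "ring R"
  shows "left_module R (free_module R B)"
proof -
  interpret ring R by fact
  have fin: "finite {i. a i \<oplus>\<^bsub>R\<^esub> b i \<noteq> \<zero>\<^bsub>R\<^esub>}"
    if "finite {i. a i \<noteq> \<zero>\<^bsub>R\<^esub>}" "finite {i. b i \<noteq> \<zero>\<^bsub>R\<^esub>}" for a b :: "'c \<Rightarrow> 'a"
    by (rule finite_subset[OF _ finite_UnI[OF that]]) auto
  have fin2: "finite {i. r \<otimes>\<^bsub>R\<^esub> a i \<noteq> \<zero>\<^bsub>R\<^esub>}"
    if "finite {i. a i \<noteq> \<zero>\<^bsub>R\<^esub>}" "r \<in> carrier R" for a :: "'c \<Rightarrow> 'a" and r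
    by (rule finite_subset[OF _ that(1)]) (use that in auto)
  have "abelian_group (free_module R B)"
  proof (rule abelian_groupI)
    fix x assume x: "x \<in> carrier (free_module R B)"
    have "(\<lambda>i. \<ominus>\<^bsub>R\<^esub> x i) \<in> carrier (free_module R B)"
      using x by (auto simp: free_module_def elim!: finite_subset[rotated])
    then show "\<exists>y\<in>carrier (free_module R B). y \<oplus>\<^bsub>free_module R B\<^esub> x = \<zero>\<^bsub>free_module R B\<^esub>"
      using x by (intro bexI[of _ "\<lambda>i. \<ominus>\<^bsub>R\<^esub> x i"]) (auto simp: free_module_def l_neg)
  qed (auto simp: free_module_def a_ac fin)
  then show ?thesis
    by (auto intro!: left_module.intro left_module_axioms.intro ring_axioms
        simp: free_module_def l_distr r_distr m_assoc fin2)
qed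

text \<open>A projective module is a direct summand of the free module on its carrier; the projections to
  the coordinates give a dual basis.\<close>

lemma projective_imp_dual_basis:
  assumes "projective_module R P"
  shows "\<exists>c. dual_basis R P (carrier P) (\<lambda>x. x) c"
proof -
  have P: "left_module R P" using assms by (simp add: projective_module_def)
  interpret P: left_module R P by fact
  define F where "F = free_module R (carrier P)"
  have F: "left_module R F" unfolding F_def by (rule left_module_free_module) (rule P.R.ring_axioms)
  define \<pi> where "\<pi> a = P.lincomb (carrier P) a (\<lambda>x. x)" for a
  have fin: "finite {i \<in> carrier P. a i \<noteq> \<zero>\<^bsub>R\<^esub>}" if "a \<in> carrier F" for a
    using that by (auto simp: F_def free_module_def elim!: finite_subset[rotated])
  have \<pi>: "\<pi> \<in> linear_maps R F P"
  proof (rule linear_mapsI)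
    show "\<pi> x \<in> carrier P" if "x \<in> carrier F" for x
      using that by (auto simp: F_def free_module_def \<pi>_def intro!: P.lincomb_closed)
    show "\<pi> (x \<oplus>\<^bsub>F\<^esub> y) = \<pi> x \<oplus>\<^bsub>P\<^esub> \<pi> y" if "x \<in> carrier F" "y \<in> carrier F" for x y
      using that fin[OF that(1)] fin[OF that(2)] P.lincomb_add[of x "carrier P" y "\<lambda>x. x"]
      by (auto simp: F_def free_module_def \<pi>_def)
    show "\<pi> (r \<odot>\<^bsub>F\<^esub> x) = r \<odot>\<^bsub>P\<^esub> \<pi> x" if "r \<in> carrier R" "x \<in> carrier F" for r x
      using that fin[OF that(2)] P.lincomb_smult[of x "carrier P" "\<lambda>x. x"]
      by (auto simp: F_def free_module_def \<pi>_def)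
  qed
  have surj: "x \<in> \<pi> ` carrier F" if x: "x \<in> carrier P" for x
  proof
    let ?a = "\<lambda>y. if y = x then \<one>\<^bsub>R\<^esub> else \<zero>\<^bsub>R\<^esub>"
    have "{y. ?a y \<noteq> \<zero>\<^bsub>R\<^esub>} \<subseteq> {x}" by auto
    then show "?a \<in> carrier F"
      using x finite_subset[of _ "{x}"] by (simp add: F_def free_module_def)
    have "\<pi> ?a = finsum P (\<lambda>i. ?a i \<odot>\<^bsub>P\<^esub> i) {x}"
      unfolding \<pi>_def by (rule P.lincomb_eq_finsum) (use x in auto)
    then show "x = \<pi> ?a" using x by (simp add: P.smult_one)
  qed
  have "(\<lambda>x. x) \<in> linear_maps R P P" by (rule linear_mapsI) auto
  moreover have "\<pi> ` carrier F = carrier P" using surj linear_maps_closed[OF \<pi>] by auto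
  ultimately obtain h where h: "h \<in> linear_maps R P F" "\<forall>x\<in>carrier P. \<pi> (h x) = x"
    using assms P F \<pi> unfolding projective_module_def by blast
  have "dual_basis R P (carrier P) (\<lambda>x. x) h"
    unfolding dual_basis_def
  proof (intro conjI ballI)
    fix x assume x: "x \<in> carrier P"
    then show "h x \<in> carrier P \<rightarrow> carrier R"
      using linear_maps_closed[OF h(1)] by (auto simp: F_def free_module_def)
    show "finite {i \<in> carrier P. h x i \<noteq> \<zero>\<^bsub>R\<^esub>}" using fin linear_maps_closed[OF h(1) x] .
    show "P.lincomb (carrier P) (h x) (\<lambda>x. x) = x" using h x by (simp add: \<pi>_def)
  qed (use linear_maps_add[OF h(1)] linear_maps_smult[OF h(1)] in \<open>auto simp: F_def free_module_def\<close>)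
  then show ?thesis by (rule exI[of _ h])
qed

text \<open>Lifting along maps between modules of arbitrary types.\<close>

lemma projective_lift:
  assumes "projective_module R P" "left_module R M" "left_module R N"
    and "f \<in> linear_maps R M N" "g \<in> linear_maps R P N" "g ` carrier P \<subseteq> f ` carrier M"
  obtains h where "h \<in> linear_maps R P M" "\<And>x. x \<in> carrier P \<Longrightarrow> f (h x) = g x"
proof -
  obtain c where "dual_basis R P (carrier P) (\<lambda>x. x) c"
    using projective_imp_dual_basis[OF assms(1)] by blast
  then have "\<exists>h \<in> linear_maps R P M. \<forall>x\<in>carrier P. f (h x) = g x"
    using assms by (intro dual_basis_lift[of R P M N]) (simp_all add: projective_module_def)
  then show thesis by (elim bexE) (rule that, assumption, simp)
qed

section \<open>Comparison of projective resolutions\<close>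

lemma projective_resolution_simps:
  assumes "projective_resolution R A P d \<epsilon>"
  shows resolution_projective: "\<And>i. projective_module R (P i)"
    and resolution_module: "\<And>i. left_module R (P i)"
    and resolution_linear: "\<And>i. d i \<in> linear_maps R (P (Suc i)) (P i)"
    and resolution_augmentation: "\<epsilon> \<in> linear_maps R (P 0) A"
    and resolution_surj: "\<epsilon> ` carrier (P 0) = carrier A"
    and resolution_exact: "\<And>i x. \<lbrakk>x \<in> carrier (P (Suc i)); d i x = \<zero>\<^bsub>P i\<^esub>\<rbrakk>
      \<Longrightarrow> x \<in> d (Suc i) ` carrier (P (Suc (Suc i)))"
    and resolution_exact_0: "\<And>x. \<lbrakk>x \<in> carrier (P 0); \<epsilon> x = \<zero>\<^bsub>A\<^esub>\<rbrakk> \<Longrightarrow> x \<in> d 0 ` carrier (P (Suc 0))"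
    and resolution_dd: "\<And>i x. x \<in> carrier (P (Suc (Suc i))) \<Longrightarrow> d i (d (Suc i) x) = \<zero>\<^bsub>P i\<^esub>"
    and resolution_augmentation_d: "\<And>x. x \<in> carrier (P (Suc 0)) \<Longrightarrow> \<epsilon> (d 0 x) = \<zero>\<^bsub>A\<^esub>"
proof -
  show dd: "d i (d (Suc i) x) = \<zero>\<^bsub>P i\<^esub>" if "x \<in> carrier (P (Suc (Suc i)))" for i x
  proof -
    have "d (Suc i) x \<in> d (Suc i) ` carrier (P (Suc (Suc i)))" using that by simp
    also have "\<dots> = {x \<in> carrier (P (Suc i)). d i x = \<zero>\<^bsub>P i\<^esub>}"
      using assms by (simp add: projective_resolution_def)
    finally show ?thesis by simp
  qed
qed (use assms in \<open>auto simp: projective_resolution_def projective_module_def\<close>)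

text \<open>The chain map is required to commute with the augmentations, that is, to lift the identity of
  the resolved module. Nothing is required of the \<open>\<phi> i\<close> outside the carriers.\<close>

definition chain_map ::
  "('r, 'c) ring_scheme \<Rightarrow> (nat \<Rightarrow> ('r, 'p) module) \<Rightarrow> (nat \<Rightarrow> 'p \<Rightarrow> 'p) \<Rightarrow> ('p \<Rightarrow> 'a) \<Rightarrow>
   (nat \<Rightarrow> ('r, 'q) module) \<Rightarrow> (nat \<Rightarrow> 'q \<Rightarrow> 'q) \<Rightarrow> ('q \<Rightarrow> 'a) \<Rightarrow> (nat \<Rightarrow> 'p \<Rightarrow> 'q) \<Rightarrow> bool" where
  "chain_map R P d \<epsilon> Q d' \<epsilon>' \<phi> \<longleftrightarrow>
     (\<forall>i. \<phi> i \<in> linear_maps R (P i) (Q i)) \<and>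
     (\<forall>i. \<forall>x\<in>carrier (P (Suc i)). d' i (\<phi> (Suc i) x) = \<phi> i (d i x)) \<and>
     (\<forall>x\<in>carrier (P 0). \<epsilon>' (\<phi> 0 x) = \<epsilon> x)"

lemma chain_map_id: "chain_map R P d \<epsilon> P d \<epsilon> (\<lambda>i x. x)"
  by (auto simp: chain_map_def intro!: linear_mapsI)

lemma chain_map_comp:
  assumes "chain_map R P d \<epsilon> Q d' \<epsilon>' \<phi>" "chain_map R Q d' \<epsilon>' S d'' \<epsilon>'' \<psi>"
  shows "chain_map R P d \<epsilon> S d'' \<epsilon>'' (\<lambda>i x. \<psi> i (\<phi> i x))"
proof -
  have "\<phi> i x \<in> carrier (Q i)" if "x \<in> carrier (P i)" for i x
    using assms(1) that by (auto simp: chain_map_def intro: linear_maps_closed)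
  then show ?thesis
    using assms unfolding chain_map_def by (auto intro: linear_maps_comp)
qed

text \<open>Dependent choice: each map is lifted along the differential of the target from the previous
  one, which takes boundaries to boundaries.\<close>

theorem chain_map_exists:
  assumes P: "projective_resolution R A P d \<epsilon>" and Q: "projective_resolution R A Q d' \<epsilon>'"
    and A: "left_module R A"
  shows "\<exists>\<phi>. chain_map R P d \<epsilon> Q d' \<epsilon>' \<phi>"
proof -
  note P = projective_resolution_simps[OF P] and Q = projective_resolution_simps[OF Q]
  define good where "good i \<phi> \<longleftrightarrow> \<phi> \<in> linear_maps R (P i) (Q i) \<and>
      (\<forall>y\<in>carrier (P (Suc i)). \<phi> (d i y) \<in> d' i ` carrier (Q (Suc i))) \<and>
      (i = 0 \<longrightarrow> (\<forall>x\<in>carrier (P i). \<epsilon>' (\<phi> x) = \<epsilon> x))" for i \<phi>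
  have start: "\<exists>\<phi>. good 0 \<phi>"
  proof -
    obtain \<phi> where \<phi>: "\<phi> \<in> linear_maps R (P 0) (Q 0)" "\<And>x. x \<in> carrier (P 0) \<Longrightarrow> \<epsilon>' (\<phi> x) = \<epsilon> x"
    proof (rule projective_lift[OF P(1) Q(2) A Q(4) P(4)])
      show "\<epsilon> ` carrier (P 0) \<subseteq> \<epsilon>' ` carrier (Q 0)" by (simp add: P(5) Q(5))
    qed blast
    have "\<phi> (d 0 y) \<in> d' 0 ` carrier (Q (Suc 0))" if "y \<in> carrier (P (Suc 0))" for y
      using that by (intro Q(7)) (simp_all add: \<phi> P(9) linear_maps_closed[OF P(3)] linear_maps_closed[OF \<phi>(1)])
    then show ?thesis using \<phi> by (auto simp: good_def)
  qed
  have step: "\<exists>\<psi>. good (Suc i) \<psi> \<and> (\<forall>x\<in>carrier (P (Suc i)). d' i (\<psi> x) = \<phi> (d i x))"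
    if \<phi>: "good i \<phi>" for i \<phi>
  proof -
    have lin: "(\<lambda>x. \<phi> (d i x)) \<in> linear_maps R (P (Suc i)) (Q i)"
      using \<phi> by (auto simp: good_def intro!: linear_maps_comp[OF P(3)])
    obtain \<psi> where \<psi>: "\<psi> \<in> linear_maps R (P (Suc i)) (Q (Suc i))"
      "\<And>x. x \<in> carrier (P (Suc i)) \<Longrightarrow> d' i (\<psi> x) = \<phi> (d i x)"
    proof (rule projective_lift[OF P(1) Q(2) Q(2) Q(3) lin])
      show "(\<lambda>x. \<phi> (d i x)) ` carrier (P (Suc i)) \<subseteq> d' i ` carrier (Q (Suc i))"
        using \<phi> by (auto simp: good_def)
    qed blast
    have "\<psi> (d (Suc i) y) \<in> d' (Suc i) ` carrier (Q (Suc (Suc i)))" if y: "y \<in> carrier (P (Suc (Suc i)))" for y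
    proof (rule Q(6))
      show "\<psi> (d (Suc i) y) \<in> carrier (Q (Suc i))"
        using y by (simp add: linear_maps_closed[OF P(3)] linear_maps_closed[OF \<psi>(1)])
      show "d' i (\<psi> (d (Suc i) y)) = \<zero>\<^bsub>Q i\<^esub>"
        using y \<phi> linear_maps_zero[OF P(2) Q(2), of \<phi> i]
        by (simp add: \<psi>(2) linear_maps_closed[OF P(3)] P(8) good_def)
    qed
    then show ?thesis using \<psi> by (auto simp: good_def)
  qed
  obtain \<phi> where "\<And>i. good i (\<phi> i)" "\<And>i. \<forall>x\<in>carrier (P (Suc i)). d' i (\<phi> (Suc i) x) = \<phi> i (d i x)"
    using dependent_nat_choice[of good "\<lambda>i \<phi> \<psi>. \<forall>x\<in>carrier (P (Suc i)). d' i (\<psi> x) = \<phi> (d i x)"] start step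
    by metis
  then have "chain_map R P d \<epsilon> Q d' \<epsilon>' \<phi>"
    unfolding chain_map_def good_def by blast
  then show ?thesis by (rule exI[of _ \<phi>])
qed

text \<open>Only the degrees above 0 are stated; in degree 0 the same formula holds without the term
  \<open>h i (d i x)\<close>.\<close>

theorem chain_maps_homotopic:
  assumes P: "projective_resolution R A P d \<epsilon>" and Q: "projective_resolution R A Q d' \<epsilon>'"
    and A: "left_module R A"
    and \<phi>: "chain_map R P d \<epsilon> Q d' \<epsilon>' \<phi>" and \<psi>: "chain_map R P d \<epsilon> Q d' \<epsilon>' \<psi>"
  shows "\<exists>h. (\<forall>i. h i \<in> linear_maps R (P i) (Q (Suc i))) \<and>
    (\<forall>i. \<forall>x\<in>carrier (P (Suc i)).
       \<phi> (Suc i) x \<ominus>\<^bsub>Q (Suc i)\<^esub> \<psi> (Suc i) x = d' (Suc i) (h (Suc i) x) \<oplus>\<^bsub>Q (Suc i)\<^esub> h i (d i x))"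
proof -
  note P = projective_resolution_simps[OF P] and Q = projective_resolution_simps[OF Q]
  define \<delta> where "\<delta> i x = \<phi> i x \<ominus>\<^bsub>Q i\<^esub> \<psi> i x" for i x
  have lin: "\<phi> i \<in> linear_maps R (P i) (Q i)" "\<psi> i \<in> linear_maps R (P i) (Q i)" for i
    using \<phi> \<psi> by (auto simp: chain_map_def)
  have \<delta>: "\<delta> i \<in> linear_maps R (P i) (Q i)" for i
    unfolding \<delta>_def by (intro linear_maps_diff Q(2) lin)
  have \<delta>_d: "d' i (\<delta> (Suc i) x) = \<delta> i (d i x)" if x: "x \<in> carrier (P (Suc i))" for i x
  proof -
    have "d' i (\<delta> (Suc i) x) = d' i (\<phi> (Suc i) x) \<ominus>\<^bsub>Q i\<^esub> d' i (\<psi> (Suc i) x)"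
      unfolding \<delta>_def
      by (rule linear_maps_minus[OF Q(2) Q(2) Q(3)])
        (use x in \<open>auto intro: linear_maps_closed[OF lin(1)] linear_maps_closed[OF lin(2)]\<close>)
    also have "\<dots> = \<delta> i (d i x)" using \<phi> \<psi> x by (simp add: \<delta>_def chain_map_def)
    finally show ?thesis .
  qed
  have \<delta>_0: "\<epsilon>' (\<delta> 0 x) = \<zero>\<^bsub>A\<^esub>" if x: "x \<in> carrier (P 0)" for x
  proof -
    interpret A: left_module R A by fact
    have "\<epsilon>' (\<delta> 0 x) = \<epsilon>' (\<phi> 0 x) \<ominus>\<^bsub>A\<^esub> \<epsilon>' (\<psi> 0 x)"
      unfolding \<delta>_def
      by (rule linear_maps_minus[OF Q(2) A Q(4)])
        (use x in \<open>auto intro: linear_maps_closed[OF lin(1)] linear_maps_closed[OF lin(2)]\<close>)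
    also have "\<dots> = \<zero>\<^bsub>A\<^esub>"
      using \<phi> \<psi> x linear_maps_closed[OF P(4) x] by (simp add: chain_map_def A.M.r_neg a_minus_def)
    finally show ?thesis .
  qed
  define good where "good i h \<longleftrightarrow> h \<in> linear_maps R (P i) (Q (Suc i)) \<and>
      (\<forall>y\<in>carrier (P (Suc i)). d' i (h (d i y)) = d' i (\<delta> (Suc i) y))" for i h
  have start: "\<exists>h. good 0 h"
  proof -
    obtain h where h: "h \<in> linear_maps R (P 0) (Q (Suc 0))" "\<And>x. x \<in> carrier (P 0) \<Longrightarrow> d' 0 (h x) = \<delta> 0 x"
    proof (rule projective_lift[OF P(1) Q(2) Q(2) Q(3) \<delta>])
      show "\<delta> 0 ` carrier (P 0) \<subseteq> d' 0 ` carrier (Q (Suc 0))"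
        using Q(7) \<delta>_0 linear_maps_closed[OF \<delta>] by auto
    qed blast
    then show ?thesis by (auto simp: good_def \<delta>_d linear_maps_closed[OF P(3)])
  qed
  have step: "\<exists>h'. good (Suc i) h' \<and>
      (\<forall>x\<in>carrier (P (Suc i)). d' (Suc i) (h' x) = \<delta> (Suc i) x \<ominus>\<^bsub>Q (Suc i)\<^esub> h (d i x))"
    if h: "good i h" for i h
  proof -
    have h_lin: "h \<in> linear_maps R (P i) (Q (Suc i))" using h by (simp add: good_def)
    define g where "g x = \<delta> (Suc i) x \<ominus>\<^bsub>Q (Suc i)\<^esub> h (d i x)" for x
    have hd: "h (d i x) \<in> carrier (Q (Suc i))" if "x \<in> carrier (P (Suc i))" for x
      using that by (intro linear_maps_closed[OF h_lin] linear_maps_closed[OF P(3)])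
    have g: "g \<in> linear_maps R (P (Suc i)) (Q (Suc i))"
      unfolding g_def by (intro linear_maps_diff Q(2) \<delta> linear_maps_comp[OF P(3)] h_lin)
    have dg: "d' i (g x) = \<zero>\<^bsub>Q i\<^esub>" if x: "x \<in> carrier (P (Suc i))" for x
    proof -
      interpret left_module R "Q i" by (rule Q(2))
      have "d' i (g x) = d' i (\<delta> (Suc i) x) \<ominus>\<^bsub>Q i\<^esub> d' i (h (d i x))"
        unfolding g_def
        by (rule linear_maps_minus[OF Q(2) Q(2) Q(3)]) (use x hd in \<open>auto intro: linear_maps_closed[OF \<delta>]\<close>)
      then show ?thesis
        using h x linear_maps_closed[OF Q(3) linear_maps_closed[OF \<delta> x]]
        by (simp add: good_def M.r_neg a_minus_def)
    qed
    obtain h' where h': "h' \<in> linear_maps R (P (Suc i)) (Q (Suc (Suc i)))"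
      "\<And>x. x \<in> carrier (P (Suc i)) \<Longrightarrow> d' (Suc i) (h' x) = g x"
    proof (rule projective_lift[OF P(1) Q(2) Q(2) Q(3) g])
      show "g ` carrier (P (Suc i)) \<subseteq> d' (Suc i) ` carrier (Q (Suc (Suc i)))"
        using Q(6) dg linear_maps_closed[OF g] by auto
    qed blast
    have "d' (Suc i) (h' (d (Suc i) y)) = d' (Suc i) (\<delta> (Suc (Suc i)) y)"
      if y: "y \<in> carrier (P (Suc (Suc i)))" for y
    proof -
      interpret left_module R "Q (Suc i)" by (rule Q(2))
      have dy: "d (Suc i) y \<in> carrier (P (Suc i))" using y by (rule linear_maps_closed[OF P(3)])
      have "g (d (Suc i) y) = \<delta> (Suc i) (d (Suc i) y)"
        using linear_maps_zero[OF P(2) Q(2) h_lin] linear_maps_closed[OF \<delta> dy]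
        by (simp add: g_def P(8) y a_minus_def)
      then show ?thesis using y dy by (simp add: h'(2) \<delta>_d)
    qed
    then show ?thesis using h' by (auto simp: good_def g_def)
  qed
  obtain h where h: "\<And>i. good i (h i)"
    "\<And>i. \<forall>x\<in>carrier (P (Suc i)). d' (Suc i) (h (Suc i) x) = \<delta> (Suc i) x \<ominus>\<^bsub>Q (Suc i)\<^esub> h i (d i x)"
    using dependent_nat_choice[of good "\<lambda>i h h'. \<forall>x\<in>carrier (P (Suc i)).
        d' (Suc i) (h' x) = \<delta> (Suc i) x \<ominus>\<^bsub>Q (Suc i)\<^esub> h (d i x)"] start step
    by metis
  have "\<delta> (Suc i) x = d' (Suc i) (h (Suc i) x) \<oplus>\<^bsub>Q (Suc i)\<^esub> h i (d i x)" if x: "x \<in> carrier (P (Suc i))" for i x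
  proof -
    interpret left_module R "Q (Suc i)" by (rule Q(2))
    have "h i (d i x) \<in> carrier (Q (Suc i))"
      using h(1)[of i] linear_maps_closed[OF P(3) x] by (auto simp: good_def intro: linear_maps_closed)
    then show ?thesis
      using h(2)[of i] x linear_maps_closed[OF \<delta> x] by (simp add: a_minus_def M.a_assoc M.l_neg)
  qed
  then show ?thesis using h(1) by (auto simp: good_def \<delta>_def)
qed

section \<open>Group rings of free abelian groups\<close>

text \<open>The type of finitely supported functions on an additive monoid carries the convolution product,
  which makes it a commutative ring, even an integral domain for coefficients in \<open>int\<close> and exponents
  in \<open>nat \<Rightarrow>\<^sub>0 int\<close>. Computations in group rings are done in this type: \<open>lookup\<close>, with inverse
  \<open>Abs_poly_mapping\<close>, identifies the elements supported on a free abelian group with the carrier of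
  its group ring.\<close>

lemma poly_mapping_sum_single: "p = (\<Sum>g\<in>keys p. single g (lookup p g))"
  by (rule poly_mapping_eqI) (simp add: lookup_sum lookup_single when_def sum.delta in_keys_iff)

lemma lookup_mult_group:
  fixes p q :: "'g::ab_group_add \<Rightarrow>\<^sub>0 'k::comm_ring_1"
  shows "lookup (p * q) g =
    (\<Sum>h\<in>keys p. lookup p h * lookup q (g - h))"
proof -
  have "lookup (p * q) g =
      Sum_any (\<lambda>h. lookup p h * (Sum_any (\<lambda>l. lookup q l when g = h + l)))"
    by (rule lookup_mult)
  also have "\<dots> = Sum_any (\<lambda>h. lookup p h * lookup q (g - h))"
  proof -
    have "(g = h + l) = (l = g - h)" for h l by (auto simp: algebra_simps)
    then show ?thesis by simp
  qed
  also have "\<dots> = (\<Sum>h\<in>keys p. lookup p h * lookup q (g - h))"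
    by (rule Sum_any.expand_superset) (auto simp: in_keys_iff)
  finally show ?thesis .
qed

text \<open>The linear extension of \<open>u\<close> from the basis to finite formal sums. The augmentation is the
  evaluation at \<open>u = 1\<close>, and the Fourier transform is the evaluation at a character.\<close>

definition evaluation :: "('g \<Rightarrow> 'k) \<Rightarrow> ('g \<Rightarrow>\<^sub>0 'k) \<Rightarrow> 'k::comm_ring_1" where
  "evaluation u p = (\<Sum>g\<in>keys p. lookup p g * u g)"

lemma evaluation_superset:
  assumes "finite U" "keys p \<subseteq> U"
  shows "evaluation u p = (\<Sum>g\<in>U. lookup p g * u g)"
  unfolding evaluation_def by (rule sum.mono_neutral_left) (use assms in \<open>auto simp: in_keys_iff\<close>)

lemma evaluation_add: "evaluation u (p + q) = evaluation u p + evaluation u q"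
proof -
  let ?U = "keys p \<union> keys q"
  have "evaluation u r = (\<Sum>g\<in>?U. lookup r g * u g)" if "keys r \<subseteq> ?U" for r
    using that by (intro evaluation_superset) auto
  then show ?thesis
    using Poly_Mapping.keys_add[of p q] by (simp add: lookup_add algebra_simps sum.distrib)
qed

lemma evaluation_0 [simp]: "evaluation u 0 = 0"
  by (simp add: evaluation_def)

lemma evaluation_sum: "evaluation u (sum f A) = (\<Sum>a\<in>A. evaluation u (f a))"
  by (induction A rule: infinite_finite_induct) (simp_all add: evaluation_add)

lemma evaluation_single [simp]: "evaluation u (single g c) = c * u g"
  by (simp add: evaluation_def)

lemma evaluation_minus: "evaluation u (p - q) = evaluation u p - evaluation u q"
  using evaluation_add[of u "p - q" q] by simp

lemma evaluation_mult:
  assumes "\<And>g h. u (g + h) = u g * u h"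
  shows "evaluation u (p * q) = evaluation u p * evaluation u q"
proof -
  have "p * q = (\<Sum>g\<in>keys p. \<Sum>h\<in>keys q.
      single (g + h) (lookup p g * lookup q h))"
    by (subst (1) poly_mapping_sum_single[of p], subst (1) poly_mapping_sum_single[of q])
      (simp add: sum_product mult_single)
  then show ?thesis
    by (simp add: evaluation_sum assms evaluation_def[of u p] evaluation_def[of u q] sum_product mult_ac)
qed

text \<open>The formal sums of elements of the free abelian group on \<open>S\<close>.\<close>

definition supported :: "'i set \<Rightarrow> (('i \<Rightarrow>\<^sub>0 int) \<Rightarrow>\<^sub>0 'k::comm_ring_1) set" where
  "supported S = {p. \<forall>g\<in>keys p. keys g \<subseteq> S}"

lemma supported_0 [simp]: "0 \<in> supported S"
  and supported_1 [simp]: "1 \<in> supported S"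
  by (auto simp: supported_def simp flip: single_one split: if_splits)

lemma supported_single: "keys g \<subseteq> S \<Longrightarrow> single g c \<in> supported S"
  by (auto simp: supported_def split: if_splits)

lemma supported_add: "\<lbrakk>p \<in> supported S; q \<in> supported S\<rbrakk> \<Longrightarrow> p + q \<in> supported S"
  using Poly_Mapping.keys_add[of p q] by (auto simp: supported_def)

lemma supported_uminus [simp]: "- p \<in> supported S \<longleftrightarrow> p \<in> supported S"
  by (auto simp: supported_def)

lemma supported_diff: "\<lbrakk>p \<in> supported S; q \<in> supported S\<rbrakk> \<Longrightarrow> p - q \<in> supported S"
  using supported_add[of p S "- q"] by simp

lemma supported_mult: "\<lbrakk>p \<in> supported S; q \<in> supported S\<rbrakk> \<Longrightarrow> p * q \<in> supported S"
  unfolding supported_def mem_Collect_eq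
proof
  fix g assume p: "\<forall>g\<in>keys p. keys g \<subseteq> S"
    and q: "\<forall>g\<in>keys q. keys g \<subseteq> S" and "g \<in> keys (p * q)"
  then obtain a b where "g = a + b" "a \<in> keys p" "b \<in> keys q"
    using keys_mult[of p q] by auto
  then show "keys g \<subseteq> S"
    using p q Poly_Mapping.keys_add[of a b] by blast
qed

lemma supported_sum: "(\<And>a. a \<in> A \<Longrightarrow> f a \<in> supported S) \<Longrightarrow> sum f A \<in> supported S"
  by (induction A rule: infinite_finite_induct) (auto intro: supported_add)

lemma supported_sign: "(-1) ^ m \<in> supported S"
  by (induction m) auto

lemma lookup_Abs_group_ring:
  "a \<in> carrier (group_ring G) \<Longrightarrow> lookup (Abs_poly_mapping a) = a"
  by (simp add: group_ring_def)

lemma lookup_in_group_ring_iff: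
  "lookup p \<in> carrier (group_ring (free_Abelian_group S)) \<longleftrightarrow> p \<in> supported S"
  by (auto simp: group_ring_def supported_def subset_iff in_keys_iff)

lemma Abs_supported_iff:
  "a \<in> carrier (group_ring (free_Abelian_group S)) \<Longrightarrow> Abs_poly_mapping a \<in> supported S"
  using lookup_in_group_ring_iff lookup_Abs_group_ring by metis

lemma lookup_one_group_ring: "lookup (1 :: _ \<Rightarrow>\<^sub>0 'k::comm_ring_1) = \<one>\<^bsub>group_ring (free_Abelian_group S)\<^esub>"
  by (auto simp: group_ring_def Poly_Mapping.lookup_one when_def fun_eq_iff)

lemma lookup_zero_group_ring: "lookup 0 = \<zero>\<^bsub>group_ring G\<^esub>"
  by (auto simp: group_ring_def fun_eq_iff)

lemma lookup_add_group_ring: "lookup (p + q) = lookup p \<oplus>\<^bsub>group_ring G\<^esub> lookup q"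
  by (auto simp: group_ring_def fun_eq_iff lookup_add)

lemma lookup_mult_group_ring:
  assumes "p \<in> supported S" "q \<in> supported S"
  shows "lookup (p * q) =
    lookup p \<otimes>\<^bsub>group_ring (free_Abelian_group S)\<^esub> lookup q"
proof
  fix g
  let ?G = "free_Abelian_group S"
  show "lookup (p * q) g = (lookup p \<otimes>\<^bsub>group_ring ?G\<^esub> lookup q) g"
  proof (cases "keys g \<subseteq> S")
    case True
    have "(\<Sum>h | h \<in> carrier ?G \<and> lookup p h \<noteq> 0.
          lookup p h * lookup q (inv\<^bsub>?G\<^esub> h \<otimes>\<^bsub>?G\<^esub> g)) =
        (\<Sum>h\<in>keys p. lookup p h * lookup q (g - h))"
      using assms(1) by (intro sum.cong) (auto simp: supported_def in_keys_iff)
    then show ?thesis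
      using True by (simp add: group_ring_def convolution_def lookup_mult_group)
  next
    case False
    then have "g \<notin> keys (p * q)"
      using supported_mult[OF assms] by (auto simp: supported_def)
    then show ?thesis
      using False by (simp add: group_ring_def convolution_def in_keys_iff)
  qed
qed

lemma lookup_Abs_group_ring_bij:
  assumes "a \<in> carrier (group_ring (free_Abelian_group S))"
  obtains p where "p \<in> supported S" "a = lookup p"
  using Abs_supported_iff lookup_Abs_group_ring assms by metis

lemma ring_group_ring: "ring (group_ring (free_Abelian_group S) :: (_ \<Rightarrow> 'k::comm_ring_1) ring)"
  (is "ring ?R")
proof -
  have zero: "\<zero>\<^bsub>?R\<^esub> = (\<lambda>g. 0)" "(\<lambda>g. 0) \<oplus>\<^bsub>?R\<^esub> x = x" "(\<lambda>g. 0) \<in> carrier ?R" for x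
    by (simp_all add: group_ring_def)
  note hom = lookup_one_group_ring[of S, symmetric]
    lookup_add_group_ring[of _ _ "free_Abelian_group S", symmetric] lookup_mult_group_ring[of _ S, symmetric]
    lookup_in_group_ring_iff
  have add: "\<exists>y\<in>carrier ?R. y \<oplus>\<^bsub>?R\<^esub> x = \<zero>\<^bsub>?R\<^esub>" if "x \<in> carrier ?R" for x
    using that
  proof (rule lookup_Abs_group_ring_bij)
    fix p :: "_ \<Rightarrow>\<^sub>0 'k" assume "p \<in> supported S" "x = lookup p"
    then show ?thesis
      by (intro bexI[of _ "lookup (- p)"]) (simp_all add: hom zero, simp add: fun_eq_iff)
  qed
  have *: "P x y z" if "x \<in> carrier ?R" "y \<in> carrier ?R" "z \<in> carrier ?R"
    "\<And>p q r. \<lbrakk>p \<in> supported S; q \<in> supported S; r \<in> supported S\<rbrakk>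
      \<Longrightarrow> P (lookup p) (lookup q) (lookup r)" for P x y z
    using that(1-3) by (elim lookup_Abs_group_ring_bij) (simp add: that(4))
  have 1: "x \<oplus>\<^bsub>?R\<^esub> y \<in> carrier ?R" "x \<otimes>\<^bsub>?R\<^esub> y \<in> carrier ?R" "x \<oplus>\<^bsub>?R\<^esub> y = y \<oplus>\<^bsub>?R\<^esub> x"
    "\<zero>\<^bsub>?R\<^esub> \<oplus>\<^bsub>?R\<^esub> x = x" "\<one>\<^bsub>?R\<^esub> \<otimes>\<^bsub>?R\<^esub> x = x" "x \<otimes>\<^bsub>?R\<^esub> \<one>\<^bsub>?R\<^esub> = x"
    if "x \<in> carrier ?R" "y \<in> carrier ?R" for x y
    by (rule *[OF that that(2)], simp add: hom supported_add supported_mult add.commute zero)+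
  have 2: "x \<oplus>\<^bsub>?R\<^esub> y \<oplus>\<^bsub>?R\<^esub> z = x \<oplus>\<^bsub>?R\<^esub> (y \<oplus>\<^bsub>?R\<^esub> z)" "x \<otimes>\<^bsub>?R\<^esub> y \<otimes>\<^bsub>?R\<^esub> z = x \<otimes>\<^bsub>?R\<^esub> (y \<otimes>\<^bsub>?R\<^esub> z)"
    "(x \<oplus>\<^bsub>?R\<^esub> y) \<otimes>\<^bsub>?R\<^esub> z = x \<otimes>\<^bsub>?R\<^esub> z \<oplus>\<^bsub>?R\<^esub> y \<otimes>\<^bsub>?R\<^esub> z"
    "z \<otimes>\<^bsub>?R\<^esub> (x \<oplus>\<^bsub>?R\<^esub> y) = z \<otimes>\<^bsub>?R\<^esub> x \<oplus>\<^bsub>?R\<^esub> z \<otimes>\<^bsub>?R\<^esub> y"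
    if "x \<in> carrier ?R" "y \<in> carrier ?R" "z \<in> carrier ?R" for x y z
    by (rule *[OF that], simp add: hom supported_add supported_mult distrib_left distrib_right add.assoc mult.assoc)+
  have 3: "\<zero>\<^bsub>?R\<^esub> \<in> carrier ?R" "\<one>\<^bsub>?R\<^esub> \<in> carrier ?R" by (simp_all add: hom zero)
  show ?thesis
    by (intro ringI abelian_groupI monoidI) (use 1 2 3 add in \<open>simp_all\<close>)
qed

section \<open>Exactness of the Koszul complex\<close>

text \<open>The element \<open>X j - 1\<close>, where \<open>X j\<close> is the generator with index \<open>j\<close>, as an element of the group ring.\<close>

definition shift_diff :: "'i \<Rightarrow> (('i \<Rightarrow>\<^sub>0 int) \<Rightarrow>\<^sub>0 int)" where
  "shift_diff j = frag_of (frag_of j) - 1"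

lemma shift_diff_supported [simp]: "j \<in> S \<Longrightarrow> shift_diff j \<in> supported S"
  by (simp add: shift_diff_def supported_diff supported_single)

text \<open>\<open>X j - 1\<close> divides \<open>X j ^ m - 1\<close> for every integer \<open>m\<close>.\<close>

lemma shift_diff_dvd:
  assumes "j \<in> S"
  shows "\<exists>b\<in>supported S. single (single j m) 1 - 1 = shift_diff j * b"
proof -
  define u where "u m = (single (single j m) 1 :: ('a \<Rightarrow>\<^sub>0 int) \<Rightarrow>\<^sub>0 int)" for m :: int
  have u: "u (a + b) = u a * u b" for a b by (simp add: u_def mult_single single_add)
  have u0: "u 0 = 1" by (simp add: u_def)
  have supp: "u m \<in> supported S" for m using assms by (auto simp: u_def intro!: supported_single split: if_splits)
  have x: "shift_diff j = u 1 - 1" by (simp add: shift_diff_def u_def)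
  have "\<exists>b\<in>supported S. u m - 1 = shift_diff j * b"
  proof (induction m rule: int_induct[where k = 0])
    case base
    show ?case by (intro bexI[of _ 0]) (simp_all add: u0)
  next
    case (step1 i)
    then obtain b where b: "b \<in> supported S" "u i - 1 = shift_diff j * b" by blast
    have "u (i + 1) - 1 = (u i - 1) * u 1 + (u 1 - 1)" by (simp add: u algebra_simps)
    also have "\<dots> = shift_diff j * (b * u 1 + 1)" by (simp add: b(2) x[symmetric] algebra_simps)
    finally show ?case by (intro bexI[of _ "b * u 1 + 1"]) (simp_all add: supported_add supported_mult b supp)
  next
    case (step2 i)
    then obtain b where b: "b \<in> supported S" "u i - 1 = shift_diff j * b" by blast
    have "u (-1) * u 1 = 1" using u[of "-1" 1] u0 by simp
    then have "u (i - 1) - 1 = (u i - 1) * u (-1) - (u 1 - 1) * u (-1)"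
      using u[of i "-1"] by (simp add: algebra_simps)
    also have "\<dots> = shift_diff j * (b * u (-1) - u (-1))" by (simp add: b(2) x[symmetric] algebra_simps)
    finally show ?case by (intro bexI[of _ "b * u (-1) - u (-1)"]) (simp_all add: supported_diff supported_mult b supp)
  qed
  then show ?thesis by (simp add: u_def)
qed

text \<open>The ideal generated by \<open>X 1 - 1, ..., X k - 1\<close> in the group ring of the free abelian group
  on \<open>S\<close>, for \<open>S\<close> containing \<open>{1..k}\<close>.\<close>

definition difference_ideal :: "nat set \<Rightarrow> nat \<Rightarrow> ((nat \<Rightarrow>\<^sub>0 int) \<Rightarrow>\<^sub>0 int) set" where
  "difference_ideal S k = {\<Sum>j\<in>{1..k}. shift_diff j * b j | b. \<forall>j. b j \<in> supported S}"

lemma difference_ideal_0: "0 \<in> difference_ideal S k"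
  unfolding difference_ideal_def by (rule CollectI, rule exI[of _ "\<lambda>_. 0"]) simp

lemma difference_ideal_diff: "\<lbrakk>a \<in> difference_ideal S k; b \<in> difference_ideal S k\<rbrakk> \<Longrightarrow> a - b \<in> difference_ideal S k"
  unfolding difference_ideal_def
proof safe
  fix b b' :: "nat \<Rightarrow> (nat \<Rightarrow>\<^sub>0 int) \<Rightarrow>\<^sub>0 int"
  assume "\<forall>j. b j \<in> supported S" "\<forall>j. b' j \<in> supported S"
  then show "\<exists>c. (\<Sum>j = 1..k. shift_diff j * b j) - (\<Sum>j = 1..k. shift_diff j * b' j) =
      (\<Sum>j = 1..k. shift_diff j * c j) \<and> (\<forall>j. c j \<in> supported S)"
    by (intro exI[of _ "\<lambda>j. b j - b' j"]) (simp add: supported_diff sum_subtractf algebra_simps)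
qed

lemma difference_ideal_uminus: "a \<in> difference_ideal S k \<Longrightarrow> - a \<in> difference_ideal S k"
  using difference_ideal_diff[OF difference_ideal_0] by fastforce

lemma difference_ideal_add: "\<lbrakk>a \<in> difference_ideal S k; b \<in> difference_ideal S k\<rbrakk> \<Longrightarrow> a + b \<in> difference_ideal S k"
  using difference_ideal_diff[OF _ difference_ideal_uminus] by fastforce

lemma difference_ideal_generator:
  assumes "j \<in> {1..k}" "b \<in> supported S"
  shows "shift_diff j * b \<in> difference_ideal S k"
  unfolding difference_ideal_def
  by (rule CollectI, rule exI[of _ "\<lambda>i. if i = j then b else 0"])
    (use assms in \<open>simp add: if_distrib[where f = "\<lambda>x. _ * x"] sum.delta cong: if_cong\<close>)

lemma difference_ideal_Suc: "difference_ideal S k \<subseteq> difference_ideal S (Suc k)"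
proof
  fix a assume "a \<in> difference_ideal S k"
  then obtain b where "a = (\<Sum>j\<in>{1..k}. shift_diff j * b j)" "\<forall>j. b j \<in> supported S"
    by (auto simp: difference_ideal_def)
  then show "a \<in> difference_ideal S (Suc k)"
    unfolding difference_ideal_def
    by (intro CollectI exI[of _ "\<lambda>j. if j \<le> k then b j else 0"]) (auto intro!: sum.cong)
qed

text \<open>Sets the coordinates \<open>0, ..., k\<close> to zero; coordinate 0 already vanishes on the groups
  considered here, whose generators are numbered from 1.\<close>

lift_definition drop_coords :: "nat \<Rightarrow> (nat \<Rightarrow>\<^sub>0 int) \<Rightarrow> (nat \<Rightarrow>\<^sub>0 int)" is
  "\<lambda>k g i. if i \<le> k then 0 else g i"
  by (erule finite_subset[rotated]) auto

lemma drop_coords_add: "drop_coords k (g + h) = drop_coords k g + drop_coords k h"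
  by transfer (auto simp: fun_eq_iff)

lemma drop_coords_single: "drop_coords k (single j m) = (if j \<le> k then 0 else single j m)"
  by transfer (auto simp: fun_eq_iff when_def)

lemma keys_drop_coords: "keys (drop_coords k g) \<subseteq> keys g"
  by transfer auto

lemma drop_coords_Suc:
  "drop_coords k g = drop_coords (Suc k) g + single (Suc k) (lookup g (Suc k))"
  by transfer (auto simp: fun_eq_iff when_def)

lemma drop_coords_0: "0 \<notin> keys g \<Longrightarrow> drop_coords 0 g = g"
  by transfer (auto simp: fun_eq_iff)

text \<open>The map of group rings induced by \<open>drop_coords k\<close>. For \<open>k \<le> n\<close>, its kernel on the group ring of
  the free abelian group on \<open>{1..n}\<close> is the ideal generated by \<open>X 1 - 1, ..., X k - 1\<close>: see
  \<open>collapse_difference_ideal\<close> and \<open>diff_collapse_in_difference_ideal\<close>.\<close>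

definition collapse :: "nat \<Rightarrow> ((nat \<Rightarrow>\<^sub>0 int) \<Rightarrow>\<^sub>0 int) \<Rightarrow> ((nat \<Rightarrow>\<^sub>0 int) \<Rightarrow>\<^sub>0 int)" where
  "collapse k = frag_extend (\<lambda>g. frag_of (drop_coords k g))"

lemma collapse_shift_diff:
  "collapse k (shift_diff j * a) = (if j \<le> k then 0 else shift_diff j * collapse k a)"
proof -
  have *: "collapse k (frag_of (frag_of j) * a) = frag_of (drop_coords k (frag_of j)) * collapse k a"
    using order_refl[of "keys a"]
  proof (induction a rule: frag_induction)
    case (one g)
    then show ?case by (simp add: collapse_def mult_single drop_coords_add)
  next
    case (diff a b)
    then show ?case by (simp add: collapse_def frag_extend_diff algebra_simps)
  qed (simp add: collapse_def)
  have "collapse k (shift_diff j * a) = collapse k (frag_of (frag_of j) * a) - collapse k a"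
    by (simp add: shift_diff_def algebra_simps collapse_def frag_extend_diff)
  also have "\<dots> = (frag_of (drop_coords k (frag_of j)) - 1) * collapse k a"
    unfolding * by (simp add: algebra_simps)
  finally show ?thesis
    by (simp add: drop_coords_single shift_diff_def)
qed

lemma collapse_difference_ideal: "a \<in> difference_ideal S k \<Longrightarrow> collapse k a = 0"
proof -
  assume "a \<in> difference_ideal S k"
  then obtain b where "a = (\<Sum>j\<in>{1..k}. shift_diff j * b j)" by (auto simp: difference_ideal_def)
  then have "collapse k a = (\<Sum>j\<in>{1..k}. collapse k (shift_diff j * b j))"
    by (simp add: collapse_def frag_extend_sum o_def)
  also have "\<dots> = 0" by (intro sum.neutral) (simp add: collapse_shift_diff)
  finally show ?thesis .
qed

lemma diff_collapse_in_difference_ideal: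
  assumes "k \<le> n" "a \<in> supported {1..n}"
  shows "a - collapse k a \<in> difference_ideal {1..n} k"
proof -
  have gen: "frag_of g - frag_of (drop_coords k g) \<in> difference_ideal {1..n} k" if "keys g \<subseteq> {1..n}" for g
    using assms(1)
  proof (induction k)
    case 0
    then show ?case using that by (subst drop_coords_0) (auto simp: difference_ideal_0)
  next
    case (Suc k)
    let ?h = "drop_coords (Suc k) g" and ?m = "lookup g (Suc k)"
    obtain b where b: "b \<in> supported {1..n}"
      "single (single (Suc k) ?m) 1 - 1 = shift_diff (Suc k) * b"
      using shift_diff_dvd[of "Suc k" "{1..n}" ?m] Suc.prems by auto
    have "frag_of (drop_coords k g) - frag_of ?h =
        frag_of ?h * (single (single (Suc k) ?m) 1 - 1)"
      by (subst drop_coords_Suc[of k g]) (simp add: algebra_simps mult_single)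
    also have "\<dots> = shift_diff (Suc k) * (frag_of ?h * b)"
      by (simp add: b(2) algebra_simps)
    also have "\<dots> \<in> difference_ideal {1..n} (Suc k)"
      using keys_drop_coords[of "Suc k" g] that
      by (intro difference_ideal_generator supported_mult b supported_single) auto
    finally have "frag_of (drop_coords k g) - frag_of ?h \<in> difference_ideal {1..n} (Suc k)" .
    moreover have "frag_of g - frag_of (drop_coords k g) \<in> difference_ideal {1..n} (Suc k)"
      using Suc difference_ideal_Suc by auto
    ultimately show ?case using difference_ideal_add by fastforce
  qed
  have "keys a \<subseteq> {g. keys g \<subseteq> {1..n}}"
    using assms(2) by (auto simp: supported_def)
  then show ?thesis
  proof (induction a rule: frag_induction)
    case (one g)
    then show ?case using gen[of g] by (simp add: collapse_def)
  next
    case (diff a b)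
    then show ?case
      using difference_ideal_diff[of "a - collapse k a" "{1..n}" k "b - collapse k b"]
      by (simp add: collapse_def frag_extend_diff algebra_simps)
  qed (simp add: collapse_def difference_ideal_0)
qed

text \<open>\<open>X (k+1) - 1\<close> is not a zero divisor modulo \<open>X 1 - 1, ..., X k - 1\<close>: the quotient is the
  group ring on the remaining coordinates, which has no zero divisors.\<close>

lemma difference_ideal_regular:
  assumes "k < n" "a \<in> supported {1..n}" "shift_diff (Suc k) * a \<in> difference_ideal {1..n} k"
  shows "a \<in> difference_ideal {1..n} k"
proof -
  have "shift_diff (Suc k) * collapse k a = 0"
    using collapse_difference_ideal[OF assms(3)] by (simp add: collapse_shift_diff)
  moreover have "shift_diff (Suc k) \<noteq> 0"
    by (simp add: shift_diff_def frag_of_eq flip: single_one)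
  ultimately have "collapse k a = 0" by simp
  then show ?thesis using diff_collapse_in_difference_ideal[of k n a] assms by simp
qed

lemma evaluation_difference_ideal: "a \<in> difference_ideal S k \<Longrightarrow> evaluation (\<lambda>_. 1) a = 0"
  by (auto simp: difference_ideal_def evaluation_sum evaluation_mult shift_diff_def evaluation_minus simp flip: single_one)

lemma augmentation_ideal:
  assumes "a \<in> supported {1..n}" "evaluation (\<lambda>_. 1) a = 0"
  shows "a \<in> difference_ideal {1..n} n"
proof -
  have "collapse n a = single 0 (evaluation (\<lambda>_. 1) a)"
  proof -
    have "keys a \<subseteq> {g. keys g \<subseteq> {1..n}}"
      using assms(1) by (auto simp: supported_def)
    then show ?thesis
    proof (induction a rule: frag_induction)
      case (one g)
      then have "drop_coords n g = 0"
        by (transfer) (auto simp: fun_eq_iff)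
      then show ?case by (simp add: collapse_def)
    next
      case (diff a b)
      then show ?case by (simp add: collapse_def frag_extend_diff evaluation_minus single_diff)
    qed (simp add: collapse_def)
  qed
  then show ?thesis using diff_collapse_in_difference_ideal[of n n a] assms by simp
qed

text \<open>The differential of the Koszul complex on \<open>X 1 - 1, ..., X k - 1\<close>, all degrees at once. A chain
  is the family of its coefficients, indexed by the subsets of \<open>{1..k}\<close>; the degree of a coefficient
  is the cardinality of its index. The sign counts the elements above \<open>j\<close>, so that adjoining the
  largest index \<open>k + 1\<close> does not change the signs of the old terms.\<close>

definition koszul_diff :: "nat \<Rightarrow> (nat set \<Rightarrow> ((nat \<Rightarrow>\<^sub>0 int) \<Rightarrow>\<^sub>0 int)) \<Rightarrow> nat set \<Rightarrow> ((nat \<Rightarrow>\<^sub>0 int) \<Rightarrow>\<^sub>0 int)" where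
  "koszul_diff k f S = (\<Sum>j\<in>{1..k} - S. (-1) ^ card {l\<in>S. j < l} * (shift_diff j * f (insert j S)))"

lemma koszul_diff_cong:
  "\<lbrakk>\<And>S. S \<subseteq> {1..k} \<Longrightarrow> f S = g S; S \<subseteq> {1..k}\<rbrakk> \<Longrightarrow> koszul_diff k f S = koszul_diff k g S"
  unfolding koszul_diff_def by (intro sum.cong) auto

lemma koszul_diff_add: "koszul_diff k (\<lambda>S. f S + g S) S = koszul_diff k f S + koszul_diff k g S"
  by (simp add: koszul_diff_def sum.distrib algebra_simps)

lemma koszul_diff_mult: "koszul_diff k (\<lambda>S. r * f S) S = r * koszul_diff k f S"
  by (simp add: koszul_diff_def sum_distrib_left algebra_simps)

lemma koszul_diff_uminus: "koszul_diff k (\<lambda>S. - f S) S = - koszul_diff k f S"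
  using koszul_diff_mult[of k "-1" f S] by simp

lemma koszul_diff_minus: "koszul_diff k (\<lambda>S. f S - g S) S = koszul_diff k f S - koszul_diff k g S"
  using koszul_diff_add[of k f "\<lambda>S. - g S" S] by (simp add: koszul_diff_uminus)

text \<open>The next two lemmas describe the complex on \<open>k + 1\<close> elements as the mapping cone of the
  multiplication by \<open>X (k+1) - 1\<close> on the complex on \<open>k\<close> elements.\<close>

lemma koszul_diff_Suc_notin:
  assumes "S \<subseteq> {1..k}"
  shows "koszul_diff (Suc k) f S = koszul_diff k f S + shift_diff (Suc k) * f (insert (Suc k) S)"
proof -
  have 1: "{1..Suc k} - S = insert (Suc k) ({1..k} - S)" and 2: "{l\<in>S. Suc k < l} = {}"
    using assms by (auto simp: atLeastAtMostSuc_conv)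
  show ?thesis unfolding koszul_diff_def 1 by (simp add: 2 add.commute)
qed

lemma koszul_diff_Suc_in:
  assumes "S \<subseteq> {1..k}"
  shows "koszul_diff (Suc k) f (insert (Suc k) S) = - koszul_diff k (\<lambda>T. f (insert (Suc k) T)) S"
proof -
  have "{1..Suc k} - insert (Suc k) S = {1..k} - S" by auto
  moreover have "card {l \<in> insert (Suc k) S. j < l} = Suc (card {l\<in>S. j < l})" if "j \<in> {1..k}" for j
  proof -
    have "{l \<in> insert (Suc k) S. j < l} = insert (Suc k) {l\<in>S. j < l}" using that by auto
    moreover have "finite S" "Suc k \<notin> S" using assms finite_subset by auto
    ultimately show ?thesis by simp
  qed
  ultimately show ?thesis
    by (simp add: koszul_diff_def insert_commute sum_negf)
qed

lemma subset_Suc_cases: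
  assumes "S \<subseteq> {1..Suc k}"
  obtains "S \<subseteq> {1..k}" | T where "T \<subseteq> {1..k}" "S = insert (Suc k) T"
proof (cases "Suc k \<in> S")
  case True
  then show ?thesis using assms that(2)[of "S - {Suc k}"] by (auto simp: atLeastAtMostSuc_conv)
next
  case False
  then show ?thesis using assms that(1) by (auto simp: atLeastAtMostSuc_conv)
qed

lemma koszul_diff_koszul_diff: "S \<subseteq> {1..k} \<Longrightarrow> koszul_diff k (koszul_diff k f) S = 0"
proof (induction k arbitrary: f S)
  case 0
  then show ?case by (simp add: koszul_diff_def)
next
  case (Suc k)
  let ?f = "\<lambda>T. f (insert (Suc k) T)"
  show ?case
    using Suc.prems
  proof (cases rule: subset_Suc_cases)
    case 1
    have "koszul_diff k (koszul_diff (Suc k) f) S =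
        koszul_diff k (\<lambda>T. koszul_diff k f T + shift_diff (Suc k) * ?f T) S"
      using 1 by (intro koszul_diff_cong koszul_diff_Suc_notin) auto
    also have "\<dots> = shift_diff (Suc k) * koszul_diff k ?f S"
      using Suc.IH 1 by (simp add: koszul_diff_add koszul_diff_mult)
    finally show ?thesis
      using 1 by (simp add: koszul_diff_Suc_notin koszul_diff_Suc_in)
  next
    case (2 T)
    have "koszul_diff k (\<lambda>T. koszul_diff (Suc k) f (insert (Suc k) T)) T =
        koszul_diff k (\<lambda>T. - koszul_diff k ?f T) T"
      using 2 by (intro koszul_diff_cong koszul_diff_Suc_in) auto
    then show ?thesis
      using 2 Suc.IH by (simp add: koszul_diff_Suc_in koszul_diff_uminus)
  qed
qed

lemma koszul_diff_supported:
  "\<lbrakk>k \<le> n; \<And>S. f S \<in> supported {1..n}\<rbrakk> \<Longrightarrow> koszul_diff k f S \<in> supported {1..n}"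
  unfolding koszul_diff_def by (intro supported_sum supported_mult supported_sign shift_diff_supported) auto

lemma koszul_diff_empty_in_difference_ideal:
  assumes "\<And>S. f S \<in> supported I"
  shows "koszul_diff k f {} \<in> difference_ideal I k"
proof -
  have "koszul_diff k f {} = (\<Sum>j\<in>{1..k}. shift_diff j * f {j})"
    by (simp add: koszul_diff_def)
  then show ?thesis
    unfolding difference_ideal_def using assms by (intro CollectI exI[of _ "\<lambda>j. f {j}"]) simp
qed

text \<open>Every cycle whose coefficient in degree 0 lies in the ideal is a boundary. The
  coefficients at index sets not contained in \<open>{1..k}\<close> play no role.\<close>

lemma koszul_exact:
  assumes "k \<le> n" "\<And>S. f S \<in> supported {1..n}"
    and "\<And>S. S \<subseteq> {1..k} \<Longrightarrow> koszul_diff k f S = 0"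
    and "f {} \<in> difference_ideal {1..n} k"
  shows "\<exists>g. (\<forall>S. g S \<in> supported {1..n}) \<and> (\<forall>S\<subseteq>{1..k}. koszul_diff k g S = f S)"
  using assms
proof (induction k arbitrary: f)
  case 0
  then have "f {} = 0" by (simp add: difference_ideal_def)
  then show ?case by (intro exI[of _ "\<lambda>_. 0"]) (simp add: koszul_diff_def)
next
  case (Suc k)
  \<comment> \<open>The part of f with Suc k in the index is a cycle f1 of the smaller complex, and
    (X (k+1) - 1) f1 is a boundary there; regularity puts f1 {} into the ideal.\<close>
  define f1 where "f1 T = f (insert (Suc k) T)" for T
  have closed1: "koszul_diff k f1 S = 0" if "S \<subseteq> {1..k}" for S
  proof -
    have "insert (Suc k) S \<subseteq> {1..Suc k}" using that by auto
    from Suc.prems(3)[OF this] show ?thesis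
      unfolding koszul_diff_Suc_in[OF that] f1_def[abs_def] by simp
  qed
  have closed0: "koszul_diff k f S + shift_diff (Suc k) * f1 S = 0" if "S \<subseteq> {1..k}" for S
  proof -
    have "S \<subseteq> {1..Suc k}" using that by auto
    from Suc.prems(3)[OF this] show ?thesis
      unfolding koszul_diff_Suc_notin[OF that] f1_def .
  qed
  have "shift_diff (Suc k) * f1 {} = - koszul_diff k f {}"
    using closed0[of "{}"] by (simp add: eq_neg_iff_add_eq_0 add.commute)
  also have "\<dots> \<in> difference_ideal {1..n} k"
    by (intro difference_ideal_uminus koszul_diff_empty_in_difference_ideal Suc.prems)
  finally have "f1 {} \<in> difference_ideal {1..n} k"
    by (rule difference_ideal_regular[rotated 2]) (use Suc.prems(1,2) in \<open>simp_all add: f1_def\<close>)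
  then obtain g1 where g1: "\<And>S. g1 S \<in> supported {1..n}" "\<And>S. S \<subseteq> {1..k} \<Longrightarrow> koszul_diff k g1 S = f1 S"
  proof -
    have "\<exists>g. (\<forall>S. g S \<in> supported {1..n}) \<and> (\<forall>S\<subseteq>{1..k}. koszul_diff k g S = f1 S)"
      if "f1 {} \<in> difference_ideal {1..n} k"
      by (rule Suc.IH[OF _ _ closed1 that]) (use Suc.prems(1,2) in \<open>simp_all add: f1_def\<close>)
    then show thesis using \<open>f1 {} \<in> _\<close> that by blast
  qed
  obtain b where b: "f {} = (\<Sum>j\<in>{1..Suc k}. shift_diff j * b j)" "\<And>j. b j \<in> supported {1..n}"
    using Suc.prems(4) by (auto simp: difference_ideal_def)
  \<comment> \<open>The coefficient at the empty set does not enter the differential and can be chosen freely;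
    with b (Suc k) the remaining cycle f0 has its coefficient at the empty set in the ideal.\<close>
  define g1' where "g1' T = (if T = {} then b (Suc k) else - g1 T)" for T
  have g1'_supp: "g1' T \<in> supported {1..n}" for T using g1 b by (simp add: g1'_def)
  have g1'_diff: "koszul_diff k g1' S = - f1 S" if "S \<subseteq> {1..k}" for S
  proof -
    have "koszul_diff k g1' S = koszul_diff k (\<lambda>S. - g1 S) S"
      by (simp add: koszul_diff_def g1'_def)
    then show ?thesis using g1 that by (simp add: koszul_diff_uminus)
  qed
  define f0 where "f0 T = f T - shift_diff (Suc k) * g1' T" for T
  have "f0 {} = (\<Sum>j\<in>{1..k}. shift_diff j * b j)" by (simp add: f0_def g1'_def b)
  then have "f0 {} \<in> difference_ideal {1..n} k" using b by (auto simp: difference_ideal_def)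
  moreover have "koszul_diff k f0 S = 0" if "S \<subseteq> {1..k}" for S
    unfolding f0_def using closed0[OF that] g1'_diff[OF that]
    by (simp add: koszul_diff_minus koszul_diff_mult)
  moreover have "f0 S \<in> supported {1..n}" for S
    unfolding f0_def using Suc.prems g1'_supp
    by (intro supported_diff supported_mult shift_diff_supported) auto
  ultimately obtain g0 where g0: "\<And>S. g0 S \<in> supported {1..n}" "\<And>S. S \<subseteq> {1..k} \<Longrightarrow> koszul_diff k g0 S = f0 S"
    using Suc.IH[of f0] Suc_leD[OF Suc.prems(1)] by blast
  define g where "g S = (if Suc k \<in> S then g1' (S - {Suc k}) else g0 S)" for S
  have eq1: "g (insert (Suc k) S) = g1' S" if "S \<subseteq> {1..k}" for S
  proof -
    have "insert (Suc k) S - {Suc k} = S" using that by auto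
    then show ?thesis by (simp add: g_def)
  qed
  have eq0: "g S = g0 S" if "S \<subseteq> {1..k}" for S using that by (auto simp: g_def)
  have "koszul_diff (Suc k) g S = f S" if "S \<subseteq> {1..Suc k}" for S
    using that
  proof (cases rule: subset_Suc_cases)
    case 1
    have "koszul_diff k g S = koszul_diff k g0 S" using eq0 1 by (rule koszul_diff_cong)
    then show ?thesis using 1 g0 by (simp add: koszul_diff_Suc_notin eq1 f0_def)
  next
    case (2 T)
    have "koszul_diff k (\<lambda>T. g (insert (Suc k) T)) T = koszul_diff k g1' T"
      using eq1 2(1) by (rule koszul_diff_cong)
    then show ?thesis using 2 g1'_diff by (simp add: koszul_diff_Suc_in f1_def)
  qed
  moreover have "g S \<in> supported {1..n}" for S using g1'_supp g0 by (simp add: g_def)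
  ultimately show ?case by blast
qed

text \<open>From here on \<open>{1..n}\<close> is kept from being rewritten to \<open>{Suc 0..n}\<close>, which would hide the
  instances of lemmas about it.\<close>

declare One_nat_def [simp del]

section \<open>The Koszul resolution\<close>

abbreviation ZG :: "nat \<Rightarrow> ((nat \<Rightarrow>\<^sub>0 int) \<Rightarrow> int) ring" where
  "ZG n \<equiv> integral_group_ring (free_Abelian_group {1..n})"

lemma ring_ZG: "ring (ZG n)" by (rule ring_group_ring)

lemma Abs_group_ring_simps:
  assumes "r \<in> carrier (group_ring (free_Abelian_group S))" "s \<in> carrier (group_ring (free_Abelian_group S))"
  shows "Abs_poly_mapping (r \<oplus>\<^bsub>group_ring (free_Abelian_group S)\<^esub> s) = Abs_poly_mapping r + Abs_poly_mapping s"
    and "Abs_poly_mapping (r \<otimes>\<^bsub>group_ring (free_Abelian_group S)\<^esub> s) = Abs_poly_mapping r * Abs_poly_mapping s"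
proof -
  obtain p q where pq: "p \<in> supported S" "r = lookup p" "q \<in> supported S" "s = lookup q"
    using assms by (elim lookup_Abs_group_ring_bij)
  then show "Abs_poly_mapping (r \<oplus>\<^bsub>group_ring (free_Abelian_group S)\<^esub> s) = Abs_poly_mapping r + Abs_poly_mapping s"
    and "Abs_poly_mapping (r \<otimes>\<^bsub>group_ring (free_Abelian_group S)\<^esub> s) = Abs_poly_mapping r * Abs_poly_mapping s"
    by (simp_all add: lookup_inverse flip: lookup_add_group_ring lookup_mult_group_ring)
qed

lemma Abs_group_ring_one:
  "Abs_poly_mapping \<one>\<^bsub>group_ring (free_Abelian_group S) :: (_ \<Rightarrow> 'k::comm_ring_1) ring\<^esub> = 1"
  by (simp add: lookup_inverse flip: lookup_one_group_ring)

lemma left_module_trivial_module: "left_module (ZG n) trivial_module"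
proof -
  have eval: "(\<Sum>g | r g \<noteq> 0. r g) = evaluation (\<lambda>_. 1) (Abs_poly_mapping r)"
    if "r \<in> carrier (ZG n)" for r
    using that by (auto simp: evaluation_def lookup_Abs_group_ring keys.rep_eq)
  interpret R: ring "ZG n" by (rule ring_ZG)
  have "abelian_group (trivial_module :: ((nat \<Rightarrow>\<^sub>0 int) \<Rightarrow> int, int) module)"
    by (rule abelian_groupI) (auto simp: trivial_module_def module_along_def intro: exI[of _ "- _"])
  then show ?thesis
    by (intro left_module.intro left_module_axioms.intro ring_ZG)
      (simp_all add: trivial_module_def module_along_def eval Abs_group_ring_simps Abs_group_ring_one evaluation_add
        evaluation_mult algebra_simps flip: single_one)
qed

text \<open>The module of degree \<open>i\<close>, free on the subsets of \<open>{1..n}\<close> with \<open>i\<close> elements. The coefficients of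
  a chain have the ring type of finitely supported functions, hence the conversion
  \<open>Abs_poly_mapping\<close> of the scalars.\<close>

definition koszul_module :: "nat \<Rightarrow> nat \<Rightarrow> ((nat \<Rightarrow>\<^sub>0 int) \<Rightarrow> int, nat set \<Rightarrow> (nat \<Rightarrow>\<^sub>0 int) \<Rightarrow>\<^sub>0 int) module" where
  "koszul_module n i = \<lparr>carrier = {f. (\<forall>S. f S \<in> supported {1..n}) \<and>
       (\<forall>S. f S \<noteq> 0 \<longrightarrow> S \<subseteq> {1..n} \<and> card S = i)},
     monoid.mult = undefined, one = undefined,
     ring.zero = (\<lambda>S. 0), add = (\<lambda>f g S. f S + g S),
     module.smult = (\<lambda>r f S. Abs_poly_mapping r * f S)\<rparr>"

lemma koszul_module_sel:
  "\<zero>\<^bsub>koszul_module n i\<^esub> = (\<lambda>S. 0)" "f \<oplus>\<^bsub>koszul_module n i\<^esub> g = (\<lambda>S. f S + g S)"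
  "r \<odot>\<^bsub>koszul_module n i\<^esub> f = (\<lambda>S. Abs_poly_mapping r * f S)"
  by (simp_all add: koszul_module_def)

lemma koszul_module_carrier:
  "f \<in> carrier (koszul_module n i) \<longleftrightarrow> (\<forall>S. f S \<in> supported {1..n}) \<and> (\<forall>S. f S \<noteq> 0 \<longrightarrow> S \<subseteq> {1..n} \<and> card S = i)"
  by (simp add: koszul_module_def)

lemma left_module_koszul_module: "left_module (ZG n) (koszul_module n i)"
proof -
  interpret R: ring "ZG n" by (rule ring_ZG)
  have "abelian_group (koszul_module n i)"
  proof (rule abelian_groupI)
    fix f assume "f \<in> carrier (koszul_module n i)"
    then show "\<exists>g\<in>carrier (koszul_module n i). g \<oplus>\<^bsub>koszul_module n i\<^esub> f = \<zero>\<^bsub>koszul_module n i\<^esub>"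
      by (intro bexI[of _ "\<lambda>S. - f S"]) (simp_all add: koszul_module_carrier koszul_module_sel)
  next
    fix f g assume fg: "f \<in> carrier (koszul_module n i)" "g \<in> carrier (koszul_module n i)"
    have "f S \<noteq> 0 \<or> g S \<noteq> 0" if "f S + g S \<noteq> 0" for S
      using that by auto
    then have "S \<subseteq> {1..n} \<and> card S = i" if "f S + g S \<noteq> 0" for S
      using fg that unfolding koszul_module_carrier by blast
    then show "f \<oplus>\<^bsub>koszul_module n i\<^esub> g \<in> carrier (koszul_module n i)"
      using fg by (simp add: koszul_module_carrier koszul_module_sel supported_add)
  qed (simp_all add: koszul_module_carrier koszul_module_sel add_ac)
  moreover have "r \<odot>\<^bsub>koszul_module n i\<^esub> f \<in> carrier (koszul_module n i)"
    if "r \<in> carrier (ZG n)" "f \<in> carrier (koszul_module n i)" for r f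
    using that by (auto simp: koszul_module_carrier koszul_module_sel intro!: supported_mult Abs_supported_iff)
  ultimately show ?thesis
    by (intro left_module.intro left_module_axioms.intro ring_ZG)
      (simp_all add: koszul_module_sel Abs_group_ring_simps Abs_group_ring_one algebra_simps)
qed

lemma koszul_module_finsum:
  assumes "finite A" "F \<in> A \<rightarrow> carrier (koszul_module n i)"
  shows "finsum (koszul_module n i) F A = (\<lambda>S. \<Sum>a\<in>A. F a S)"
  using assms
proof (induction A)
  case (insert a A)
  interpret left_module "ZG n" "koszul_module n i" by (rule left_module_koszul_module)
  show ?case using insert by (simp add: koszul_module_sel Pi_iff)
next
  case empty
  interpret left_module "ZG n" "koszul_module n i" by (rule left_module_koszul_module)
  show ?case by (simp add: koszul_module_sel)
qed

text \<open>The element of the basis with index \<open>S\<close>.\<close>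

definition koszul_basis :: "nat set \<Rightarrow> nat set \<Rightarrow> (nat \<Rightarrow>\<^sub>0 int) \<Rightarrow>\<^sub>0 int" where
  "koszul_basis S T = (if T = S then 1 else 0)"

lemma koszul_basis_carrier:
  "\<lbrakk>S \<subseteq> {1..n}; card S = i\<rbrakk> \<Longrightarrow> koszul_basis S \<in> carrier (koszul_module n i)"
  by (simp add: koszul_basis_def koszul_module_carrier)

lemma dual_basis_koszul_module:
  "dual_basis (ZG n) (koszul_module n i) {S. S \<subseteq> {1..n} \<and> card S = i} koszul_basis (\<lambda>f S. lookup (f S))"
  (is "dual_basis _ ?K ?I _ ?c")
proof -
  interpret left_module "ZG n" ?K by (rule left_module_koszul_module)
  have fin: "finite ?I" by (rule finite_subset[of _ "Pow {1..n}"]) auto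
  have "lincomb ?I (?c f) koszul_basis = f" if f: "f \<in> carrier ?K" for f
  proof -
    have "lincomb ?I (?c f) koszul_basis = finsum ?K (\<lambda>S. ?c f S \<odot>\<^bsub>?K\<^esub> koszul_basis S) ?I"
      by (rule lincomb_eq_finsum)
        (use f fin in \<open>auto simp: koszul_module_carrier lookup_in_group_ring_iff koszul_basis_def\<close>)
    also have "\<dots> = (\<lambda>T. \<Sum>S\<in>?I. (?c f S \<odot>\<^bsub>?K\<^esub> koszul_basis S) T)"
      by (rule koszul_module_finsum[OF fin])
        (use f in \<open>intro Pi_I smult_closed koszul_basis_carrier,
          auto simp: lookup_in_group_ring_iff koszul_module_carrier\<close>)
    also have "\<dots> = f"
    proof
      fix T
      have "(\<Sum>S\<in>?I. (?c f S \<odot>\<^bsub>?K\<^esub> koszul_basis S) T) = (\<Sum>S\<in>?I. if T = S then f S else 0)"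
        by (intro sum.cong) (simp_all add: koszul_module_sel koszul_basis_def lookup_inverse)
      also have "\<dots> = f T" using fin f by (auto simp: sum.delta koszul_module_carrier)
      finally show "(\<Sum>S\<in>?I. (?c f S \<odot>\<^bsub>?K\<^esub> koszul_basis S) T) = f T" .
    qed
    finally show ?thesis .
  qed
  moreover have "lookup (Abs_poly_mapping r * f S) = r \<otimes>\<^bsub>ZG n\<^esub> lookup (f S)"
    if "r \<in> carrier (ZG n)" "f \<in> carrier ?K" for r f S
    using that by (simp add: lookup_mult_group_ring[of _ "{1..n}"] Abs_supported_iff lookup_Abs_group_ring koszul_module_carrier)
  moreover have "koszul_basis \<in> ?I \<rightarrow> carrier ?K"
    by (simp add: Pi_iff koszul_basis_carrier)
  moreover have "?c f \<in> ?I \<rightarrow> carrier (ZG n)" "finite {S \<in> ?I. ?c f S \<noteq> \<zero>\<^bsub>ZG n\<^esub>}" if "f \<in> carrier ?K" for f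
    using that fin by (auto simp: koszul_module_carrier lookup_in_group_ring_iff)
  ultimately show ?thesis
    unfolding dual_basis_def koszul_module_sel
    by (simp add: lookup_add_group_ring[of _ _ "free_Abelian_group {1..n}"])
qed

lemma koszul_linear_map:
  assumes M: "left_module (ZG n) M" and m: "\<And>S. \<lbrakk>S \<subseteq> {1..n}; card S = i\<rbrakk> \<Longrightarrow> m S \<in> carrier M"
  obtains g where "g \<in> linear_maps (ZG n) (koszul_module n i) M"
    "\<And>S. \<lbrakk>S \<subseteq> {1..n}; card S = i\<rbrakk> \<Longrightarrow> g (koszul_basis S) = m S"
proof -
  interpret M: left_module "ZG n" M by fact
  let ?I = "{S. S \<subseteq> {1..n} \<and> card S = i}"
  define g where "g f = M.lincomb ?I (\<lambda>S. lookup (f S)) m"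
    for f :: "nat set \<Rightarrow> (nat \<Rightarrow>\<^sub>0 int) \<Rightarrow>\<^sub>0 int"
  have "g \<in> linear_maps (ZG n) (koszul_module n i) M"
    unfolding g_def
    by (rule dual_basis_linear[OF left_module_koszul_module M dual_basis_koszul_module]) (use m in auto)
  moreover have "g (koszul_basis S) = m S" if S: "S \<subseteq> {1..n}" "card S = i" for S
  proof -
    have "g (koszul_basis S) = finsum M (\<lambda>T. lookup (koszul_basis S T) \<odot>\<^bsub>M\<^esub> m T) {S}"
      unfolding g_def
    proof (rule M.lincomb_eq_finsum)
      show "{T \<in> ?I. lookup (koszul_basis S T) \<noteq> \<zero>\<^bsub>ZG n\<^esub>} \<subseteq> {S}"
        by (auto simp: koszul_basis_def lookup_zero_group_ring[symmetric])
      show "(\<lambda>T. lookup (koszul_basis S T)) \<in> ?I \<rightarrow> carrier (ZG n)"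
        by (auto simp: lookup_in_group_ring_iff koszul_basis_def)
    qed (use S m in auto)
    then show ?thesis
      using m[OF S] by (simp add: koszul_basis_def M.smult_one lookup_one_group_ring[of "{1..n}"] M.smult_closed)
  qed
  ultimately show thesis using that by blast
qed

lemma koszul_diff_carrier:
  assumes "f \<in> carrier (koszul_module n (Suc i))"
  shows "koszul_diff n f \<in> carrier (koszul_module n i)"
proof -
  have "S \<subseteq> {1..n} \<and> card S = i" if "koszul_diff n f S \<noteq> 0" for S
  proof -
    obtain j where j: "j \<in> {1..n} - S" "f (insert j S) \<noteq> 0"
    proof (rule ccontr)
      assume "\<not> thesis"
      then have "\<forall>j\<in>{1..n} - S. f (insert j S) = 0" using that by blast
      then show False using \<open>koszul_diff n f S \<noteq> 0\<close> by (simp add: koszul_diff_def)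
    qed
    then have "insert j S \<subseteq> {1..n}" "card (insert j S) = Suc i"
      using assms unfolding koszul_module_carrier by blast+
    moreover from this have "finite S" using finite_subset[of "insert j S" "{1..n}"] by auto
    ultimately show ?thesis using j by auto
  qed
  then show ?thesis using assms by (auto simp: koszul_module_carrier intro!: koszul_diff_supported)
qed

text \<open>Exactness in each degree: the preimage from \<open>koszul_exact\<close> is cut down to the coefficients of
  degree \<open>i + 1\<close>, the only ones that contribute to a boundary of degree \<open>i\<close>.\<close>

lemma koszul_exact_degree:
  assumes f: "f \<in> carrier (koszul_module n i)" and "koszul_diff n f = (\<lambda>S. 0)"
    and "f {} \<in> difference_ideal {1..n} n"
  shows "f \<in> koszul_diff n ` carrier (koszul_module n (Suc i))"
proof -
  obtain g where g: "\<And>S. g S \<in> supported {1..n}" "\<And>S. S \<subseteq> {1..n} \<Longrightarrow> koszul_diff n g S = f S"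
    using koszul_exact[of n n f] assms by (auto simp: koszul_module_carrier)
  define g' where "g' S = (if S \<subseteq> {1..n} \<and> card S = Suc i then g S else 0)" for S
  have g': "g' \<in> carrier (koszul_module n (Suc i))"
    using g by (auto simp: g'_def koszul_module_carrier)
  have "koszul_diff n g' S = f S" for S
  proof (cases "S \<subseteq> {1..n} \<and> card S = i")
    case True
    then have "g' (insert j S) = g (insert j S)" if "j \<in> {1..n} - S" for j
      using that finite_subset[of S "{1..n}"] by (simp add: g'_def)
    then have "koszul_diff n g' S = koszul_diff n g S"
      unfolding koszul_diff_def by (intro sum.cong) simp_all
    then show ?thesis using g True by simp
  next
    case False
    have "f S = 0" using f False unfolding koszul_module_carrier by blast
    moreover have "koszul_diff n g' S = 0"
      using koszul_diff_carrier[OF g'] False unfolding koszul_module_carrier by blast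
    ultimately show ?thesis by simp
  qed
  then show ?thesis using g' by (intro image_eqI[of _ _ g']) auto
qed

theorem koszul_resolution:
  "projective_resolution (ZG n) trivial_module (koszul_module n) (\<lambda>i. koszul_diff n)
     (\<lambda>f. evaluation (\<lambda>_. 1) (f {}))"
  unfolding projective_resolution_def
proof (intro conjI allI)
  let ?\<epsilon> = "\<lambda>f :: nat set \<Rightarrow> (nat \<Rightarrow>\<^sub>0 int) \<Rightarrow>\<^sub>0 int. evaluation (\<lambda>_. 1) (f {})"
  show "projective_module (ZG n) (koszul_module n i)" for i
    by (rule dual_basis_imp_projective[OF left_module_koszul_module dual_basis_koszul_module])
  show "koszul_diff n \<in> linear_maps (ZG n) (koszul_module n (Suc i)) (koszul_module n i)" for i
    by (rule linear_mapsI)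
      (simp_all add: koszul_diff_carrier koszul_module_sel koszul_diff_add koszul_diff_mult fun_eq_iff)
  show "?\<epsilon> \<in> linear_maps (ZG n) (koszul_module n 0) trivial_module"
    by (rule linear_mapsI)
      (auto simp: trivial_module_def module_along_def koszul_module_sel evaluation_add evaluation_mult
        evaluation_def[of _ "Abs_poly_mapping _"] lookup_Abs_group_ring keys.rep_eq)
  have "m \<in> ?\<epsilon> ` carrier (koszul_module n 0)" for m :: int
    by (rule image_eqI[of _ _ "\<lambda>S. if S = {} then single 0 m else 0"])
      (auto simp: koszul_module_carrier intro!: supported_single)
  then show "?\<epsilon> ` carrier (koszul_module n 0) = carrier trivial_module"
    by (auto simp: trivial_module_def module_along_def)
  show "koszul_diff n ` carrier (koszul_module n 1) =
      {f \<in> carrier (koszul_module n 0). ?\<epsilon> f = \<zero>\<^bsub>trivial_module\<^esub>}"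
  proof (intro subset_antisym subsetI)
    fix f assume "f \<in> koszul_diff n ` carrier (koszul_module n 1)"
    then obtain g where g: "g \<in> carrier (koszul_module n (Suc 0))" "f = koszul_diff n g" by (auto simp: One_nat_def)
    then have "f {} \<in> difference_ideal {1..n} n"
      by (auto simp: koszul_module_carrier intro!: koszul_diff_empty_in_difference_ideal)
    then show "f \<in> {f \<in> carrier (koszul_module n 0). ?\<epsilon> f = \<zero>\<^bsub>trivial_module\<^esub>}"
      using g koszul_diff_carrier evaluation_difference_ideal by (auto simp: trivial_module_def module_along_def)
  next
    fix f assume "f \<in> {f \<in> carrier (koszul_module n 0). ?\<epsilon> f = \<zero>\<^bsub>trivial_module\<^esub>}"
    then have f: "f \<in> carrier (koszul_module n 0)" "?\<epsilon> f = 0" by (auto simp: trivial_module_def module_along_def)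
    have "f (insert j S) = 0" if "j \<notin> S" for j S
    proof (rule ccontr)
      assume "f (insert j S) \<noteq> 0"
      then have "card (insert j S) = 0" "insert j S \<subseteq> {1..n}"
        using f(1) unfolding koszul_module_carrier by blast+
      then show False using finite_subset[of "insert j S" "{1..n}"] by simp
    qed
    then have "koszul_diff n f = (\<lambda>S. 0)"
      by (simp add: koszul_diff_def fun_eq_iff)
    moreover have "f {} \<in> difference_ideal {1..n} n"
      using f by (intro augmentation_ideal) (auto simp: koszul_module_carrier)
    ultimately have "f \<in> koszul_diff n ` carrier (koszul_module n (Suc 0))"
      using f by (intro koszul_exact_degree)
    then show "f \<in> koszul_diff n ` carrier (koszul_module n 1)" by (simp add: One_nat_def)
  qed
  show "koszul_diff n ` carrier (koszul_module n (Suc (Suc i))) =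
      {f \<in> carrier (koszul_module n (Suc i)). koszul_diff n f = \<zero>\<^bsub>koszul_module n i\<^esub>}" for i
  proof (intro subset_antisym subsetI)
    fix f assume "f \<in> koszul_diff n ` carrier (koszul_module n (Suc (Suc i)))"
    then obtain g where g: "g \<in> carrier (koszul_module n (Suc (Suc i)))" "f = koszul_diff n g" by auto
    then have f: "f \<in> carrier (koszul_module n (Suc i))" by (simp add: koszul_diff_carrier)
    have "koszul_diff n f S = 0" for S
    proof (cases "S \<subseteq> {1..n}")
      case True
      then show ?thesis using g by (simp add: koszul_diff_koszul_diff)
    next
      case False
      then show ?thesis using koszul_diff_carrier[OF f] unfolding koszul_module_carrier by blast
    qed
    then show "f \<in> {f \<in> carrier (koszul_module n (Suc i)). koszul_diff n f = \<zero>\<^bsub>koszul_module n i\<^esub>}"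
      using f by (auto simp: koszul_module_sel)
  next
    fix f assume "f \<in> {f \<in> carrier (koszul_module n (Suc i)). koszul_diff n f = \<zero>\<^bsub>koszul_module n i\<^esub>}"
    then have f: "f \<in> carrier (koszul_module n (Suc i))" "koszul_diff n f = (\<lambda>S. 0)"
      by (auto simp: koszul_module_sel)
    have "f {} = 0"
    proof (rule ccontr)
      assume "f {} \<noteq> 0"
      then have "card ({} :: nat set) = Suc i" using f(1) unfolding koszul_module_carrier by blast
      then show False by simp
    qed
    then show "f \<in> koszul_diff n ` carrier (koszul_module n (Suc (Suc i)))"
      using f by (intro koszul_exact_degree) (simp_all add: difference_ideal_0)
  qed
qed

section \<open>Cohomology in the top degree\<close>

text \<open>The submodule \<open>(X 1 - 1) M + ... + (X n - 1) M\<close>.\<close>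

definition difference_submodule ::
  "nat \<Rightarrow> ((nat \<Rightarrow>\<^sub>0 int) \<Rightarrow> int, 'm) module \<Rightarrow> 'm set" where
  "difference_submodule n M =
     {finsum M (\<lambda>j. lookup (shift_diff j) \<odot>\<^bsub>M\<^esub> m j) {1..n} | m. m \<in> {1..n} \<rightarrow> carrier M}"

abbreviation koszul_top :: "nat \<Rightarrow> nat set \<Rightarrow> (nat \<Rightarrow>\<^sub>0 int) \<Rightarrow>\<^sub>0 int" where
  "koszul_top n \<equiv> koszul_basis {1..n}"

text \<open>The sign of the face \<open>{1..n} - {j}\<close> in the boundary of the element of the basis of degree \<open>n\<close>.\<close>

definition face_sign :: "nat \<Rightarrow> nat \<Rightarrow> ((nat \<Rightarrow>\<^sub>0 int) \<Rightarrow>\<^sub>0 int)" where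
  "face_sign n j = (-1) ^ card {l \<in> {1..n} - {j}. j < l}"

lemma face_sign_supported: "face_sign n j \<in> supported S"
  by (simp add: face_sign_def supported_sign)

lemma face_sign_square: "face_sign n j * face_sign n j = 1"
  by (simp add: face_sign_def flip: power_add mult_2 power_mult)

lemma koszul_face_carrier:
  "j \<in> {1..Suc k} \<Longrightarrow> koszul_basis ({1..Suc k} - {j}) \<in> carrier (koszul_module (Suc k) k)"
  by (intro koszul_basis_carrier) auto

lemma koszul_diff_top:
  fixes k :: nat
  defines "n \<equiv> Suc k"
  shows "koszul_diff n (koszul_top n) =
    finsum (koszul_module n k) (\<lambda>j. lookup (shift_diff j) \<odot>\<^bsub>koszul_module n k\<^esub>
      (lookup (face_sign n j) \<odot>\<^bsub>koszul_module n k\<^esub> koszul_basis ({1..n} - {j}))) {1..n}"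
proof -
  let ?K = "koszul_module n k"
  interpret left_module "ZG n" ?K by (rule left_module_koszul_module)
  have cl: "lookup (face_sign n j) \<in> carrier (ZG n)"
    "j \<in> {1..n} \<Longrightarrow> lookup (shift_diff j :: (nat \<Rightarrow>\<^sub>0 int) \<Rightarrow>\<^sub>0 int) \<in> carrier (ZG n)" for j
    by (simp_all add: lookup_in_group_ring_iff face_sign_supported)
  have "koszul_diff n (koszul_top n) S =
      (\<Sum>j\<in>{1..n}. shift_diff j * (face_sign n j * koszul_basis ({1..n} - {j}) S))" for S
    unfolding koszul_diff_def
  proof (rule sum.mono_neutral_cong_left)
    have "S \<noteq> {1..n} - {j}" if "j \<in> S" for j using that by auto
    then show "\<forall>j\<in>{1..n} - ({1..n} - S). shift_diff j * (face_sign n j * koszul_basis ({1..n} - {j}) S) = 0"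
      by (simp add: koszul_basis_def)
  next
    fix j assume j: "j \<in> {1..n} - S"
    then have "insert j S = {1..n} \<longleftrightarrow> S = {1..n} - {j}" by auto
    then show "(- 1) ^ card {l \<in> S. j < l} * (shift_diff j * koszul_top n (insert j S)) =
         shift_diff j * (face_sign n j * koszul_basis ({1..n} - {j}) S)"
      by (simp add: koszul_basis_def face_sign_def)
  qed auto
  moreover have "(\<lambda>j. lookup (shift_diff j) \<odot>\<^bsub>?K\<^esub>
      (lookup (face_sign n j) \<odot>\<^bsub>?K\<^esub> koszul_basis ({1..n} - {j}))) \<in> {1..n} \<rightarrow> carrier ?K"
    by (intro Pi_I smult_closed cl) (simp_all add: koszul_face_carrier n_def)
  ultimately show ?thesis
    by (subst koszul_module_finsum) (simp_all add: koszul_module_sel lookup_inverse fun_eq_iff)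
qed

text \<open>The values that coboundaries of the Koszul complex take on the generator of degree \<open>n\<close> are exactly
  the elements of \<open>difference_submodule n M\<close>, since a linear map may take arbitrary values on the
  basis of degree \<open>n - 1\<close>.\<close>

lemma linear_image_koszul_diff_top:
  fixes k :: nat
  defines "n \<equiv> Suc k"
  assumes M: "left_module (ZG n) M"
  shows "(\<lambda>g. g (koszul_diff n (koszul_top n))) ` linear_maps (ZG n) (koszul_module n k) M =
    difference_submodule n M"
proof -
  let ?K = "koszul_module n k"
  interpret M: left_module "ZG n" M by fact
  have K: "left_module (ZG n) ?K" by (rule left_module_koszul_module)
  interpret K: left_module "ZG n" ?K by fact
  define x s where "x j = lookup (shift_diff j :: (nat \<Rightarrow>\<^sub>0 int) \<Rightarrow>\<^sub>0 int)"
    and "s j = lookup (face_sign n j)" for j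
  have s: "s j \<in> carrier (ZG n)" and x: "j \<in> {1..n} \<Longrightarrow> x j \<in> carrier (ZG n)" for j
    by (simp_all add: x_def s_def lookup_in_group_ring_iff face_sign_supported)
  have ss: "s j \<otimes>\<^bsub>ZG n\<^esub> s j = \<one>\<^bsub>ZG n\<^esub>" for j
    unfolding s_def
    by (simp add: face_sign_supported face_sign_square lookup_one_group_ring flip: lookup_mult_group_ring)
  have face: "koszul_basis ({1..n} - {j}) \<in> carrier ?K" if "j \<in> {1..n}" for j
    using that koszul_face_carrier[of j k] by (simp add: n_def)
  have eq: "g (koszul_diff n (koszul_top n)) =
      finsum M (\<lambda>j. x j \<odot>\<^bsub>M\<^esub> (s j \<odot>\<^bsub>M\<^esub> g (koszul_basis ({1..n} - {j})))) {1..n}"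
    if g: "g \<in> linear_maps (ZG n) ?K M" for g
  proof -
    have "g (koszul_diff n (koszul_top n)) = finsum M (\<lambda>j. g (x j \<odot>\<^bsub>?K\<^esub> (s j \<odot>\<^bsub>?K\<^esub> koszul_basis ({1..n} - {j})))) {1..n}"
      unfolding n_def koszul_diff_top unfolding n_def[symmetric] x_def[symmetric] s_def[symmetric]
      by (rule linear_maps_finsum[OF K M g]) (use x s face in \<open>auto intro!: K.smult_closed\<close>)
    also have "\<dots> = finsum M (\<lambda>j. x j \<odot>\<^bsub>M\<^esub> (s j \<odot>\<^bsub>M\<^esub> g (koszul_basis ({1..n} - {j})))) {1..n}"
      by (rule M.M.finsum_cong')
        (use x s face linear_maps_closed[OF g] in
          \<open>auto simp: linear_maps_smult[OF g] K.smult_closed M.smult_closed\<close>)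
    finally show ?thesis .
  qed
  show ?thesis
  proof (intro subset_antisym subsetI)
    fix y assume "y \<in> (\<lambda>g. g (koszul_diff n (koszul_top n))) ` linear_maps (ZG n) ?K M"
    then obtain g where g: "g \<in> linear_maps (ZG n) ?K M" "y = g (koszul_diff n (koszul_top n))" by auto
    then show "y \<in> difference_submodule n M"
      unfolding difference_submodule_def x_def[symmetric]
      using s face linear_maps_closed[OF g(1)]
      by (intro CollectI exI[of _ "\<lambda>j. s j \<odot>\<^bsub>M\<^esub> g (koszul_basis ({1..n} - {j}))"])
        (auto simp: eq intro!: M.smult_closed)
  next
    fix y assume "y \<in> difference_submodule n M"
    then obtain m where m: "m \<in> {1..n} \<rightarrow> carrier M" "y = finsum M (\<lambda>j. x j \<odot>\<^bsub>M\<^esub> m j) {1..n}"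
      by (auto simp: difference_submodule_def x_def)
    define m' where "m' S = (let j = (THE j. j \<in> {1..n} - S) in s j \<odot>\<^bsub>M\<^esub> m j)" for S
    have m': "m' ({1..n} - {j}) = s j \<odot>\<^bsub>M\<^esub> m j" if "j \<in> {1..n}" for j
    proof -
      have "{1..n} - ({1..n} - {j}) = {j}" using that by auto
      then show ?thesis by (simp add: m'_def)
    qed
    have faces: "\<exists>j\<in>{1..n}. S = {1..n} - {j}" if "S \<subseteq> {1..n}" "card S = k" for S
    proof -
      have "card ({1..n} - S) = 1" using that by (simp add: card_Diff_subset finite_subset n_def)
      then obtain j where "{1..n} - S = {j}" by (auto simp: card_1_singleton_iff One_nat_def)
      then show ?thesis using that by (intro bexI[of _ j]) auto
    qed
    obtain g where g: "g \<in> linear_maps (ZG n) ?K M"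
      "\<And>S. \<lbrakk>S \<subseteq> {1..n}; card S = k\<rbrakk> \<Longrightarrow> g (koszul_basis S) = m' S"
    proof (rule koszul_linear_map[OF M, of k m'])
      fix S assume "S \<subseteq> {1..n}" "card S = k"
      then obtain j where "j \<in> {1..n}" "S = {1..n} - {j}" using faces by blast
      then show "m' S \<in> carrier M" using m(1) s by (auto simp: m' intro!: M.smult_closed)
    qed blast
    have "g (koszul_diff n (koszul_top n)) = y"
      unfolding eq[OF g(1)] m(2)
    proof (rule M.M.finsum_cong')
      fix j assume j: "j \<in> {1..n}"
      then have "card ({1..n} - {j}) = k" by (simp add: n_def)
      from g(2)[OF Diff_subset this] have "g (koszul_basis ({1..n} - {j})) = s j \<odot>\<^bsub>M\<^esub> m j"
        by (simp only: m'[OF j])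
      moreover have "s j \<odot>\<^bsub>M\<^esub> (s j \<odot>\<^bsub>M\<^esub> m j) = m j"
      proof -
        have "m j \<in> carrier M" using m(1) j by auto
        then show ?thesis using M.smult_assoc[OF s s, of "m j" j j] by (simp add: ss M.smult_one)
      qed
      ultimately show "x j \<odot>\<^bsub>M\<^esub> (s j \<odot>\<^bsub>M\<^esub> g (koszul_basis ({1..n} - {j}))) = x j \<odot>\<^bsub>M\<^esub> m j"
        by simp
    qed (use m x in \<open>auto intro!: M.smult_closed\<close>)
    then show "y \<in> (\<lambda>g. g (koszul_diff n (koszul_top n))) ` linear_maps (ZG n) ?K M"
      using g(1) by auto
  qed
qed

lemma koszul_module_above_top: 
  assumes "f \<in> carrier (koszul_module n (Suc n))" shows "f = (\<lambda>S. 0)"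
proof (rule ext, rule ccontr)
  fix S assume "f S \<noteq> 0"
  then have "S \<subseteq> {1..n}" "card S = Suc n" using assms unfolding koszul_module_carrier by blast+
  then show False using card_mono[of "{1..n}" S] by simp
qed

lemma koszul_top_carrier: "koszul_top n \<in> carrier (koszul_module n n)"
  by (intro koszul_basis_carrier) simp_all

lemma koszul_top_generates:
  assumes "f \<in> carrier (koszul_module n n)"
  shows "lookup (f {1..n}) \<in> carrier (ZG n)"
    and "f = lookup (f {1..n}) \<odot>\<^bsub>koszul_module n n\<^esub> koszul_top n"
proof -
  have "f S = 0" if "S \<noteq> {1..n}" for S
  proof (rule ccontr)
    assume "f S \<noteq> 0"
    then have "S \<subseteq> {1..n}" "card S = n" using assms unfolding koszul_module_carrier by blast+
    then show False using that card_subset_eq[of "{1..n}" S] by simp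
  qed
  then show "f = lookup (f {1..n}) \<odot>\<^bsub>koszul_module n n\<^esub> koszul_top n"
    by (auto simp: koszul_module_sel koszul_basis_def lookup_inverse)
  show "lookup (f {1..n}) \<in> carrier (ZG n)"
    using assms by (simp add: koszul_module_carrier lookup_in_group_ring_iff)
qed

text \<open>Evaluation of cocycles at one element \<open>p\<close>, the image of the Koszul generator of degree \<open>n\<close> under
  a comparison map, induces an isomorphism from the \<open>n\<close>-th cohomology to the quotient of \<open>M\<close> by
  \<open>difference_submodule n M\<close>.\<close>

theorem top_cohomology:
  assumes n: "n \<ge> 1" and res: "projective_resolution (ZG n) trivial_module P d \<epsilon>"
    and M: "left_module (ZG n) M"
  shows "\<exists>p\<in>carrier (P n).
    (\<forall>f\<in>cocycles (ZG n) P d M n. f \<in> coboundaries (ZG n) P d M n \<longleftrightarrow> f p \<in> difference_submodule n M) \<and>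
    (\<forall>m\<in>carrier M. \<exists>f\<in>cocycles (ZG n) P d M n. f p \<ominus>\<^bsub>M\<^esub> m \<in> difference_submodule n M)"
proof -
  obtain k where nk: "n = Suc k" using n by (cases n) auto
  let ?R = "ZG n" and ?K = "koszul_module n" and ?D = "koszul_diff n" and ?e = "koszul_top n"
  note P = projective_resolution_simps[OF res]
    and K = projective_resolution_simps[OF koszul_resolution[of n]]
  note A = left_module_trivial_module[of n]
  note IM = linear_image_koszul_diff_top[of k M, folded nk, OF M]
  interpret M: left_module ?R M by fact
  obtain \<phi> where \<phi>: "chain_map ?R ?K (\<lambda>i. ?D) (\<lambda>f. evaluation (\<lambda>_. 1) (f {})) P d \<epsilon> \<phi>"
    using chain_map_exists[OF koszul_resolution res A] by blast
  obtain \<psi> where \<psi>: "chain_map ?R P d \<epsilon> ?K (\<lambda>i. ?D) (\<lambda>f. evaluation (\<lambda>_. 1) (f {})) \<psi>"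
    using chain_map_exists[OF res koszul_resolution A] by blast
  have \<phi>_lin: "\<phi> i \<in> linear_maps ?R (?K i) (P i)" and \<psi>_lin: "\<psi> i \<in> linear_maps ?R (P i) (?K i)" for i
    using \<phi> \<psi> by (auto simp: chain_map_def)
  have \<phi>_d: "d i (\<phi> (Suc i) y) = \<phi> i (?D y)" if "y \<in> carrier (?K (Suc i))" for i y
    using \<phi> that by (auto simp: chain_map_def)
  have \<psi>_d: "?D (\<psi> (Suc i) x) = \<psi> i (d i x)" if "x \<in> carrier (P (Suc i))" for i x
    using \<psi> that by (auto simp: chain_map_def)
  obtain h where h: "\<And>i. h i \<in> linear_maps ?R (P i) (P (Suc i))"
    "\<And>i x. x \<in> carrier (P (Suc i)) \<Longrightarrow> \<phi> (Suc i) (\<psi> (Suc i) x) \<ominus>\<^bsub>P (Suc i)\<^esub> x =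
       d (Suc i) (h (Suc i) x) \<oplus>\<^bsub>P (Suc i)\<^esub> h i (d i x)"
    using chain_maps_homotopic[OF res res A chain_map_comp[OF \<psi> \<phi>] chain_map_id] by blast
  obtain h' where h': "\<And>i. h' i \<in> linear_maps ?R (?K i) (?K (Suc i))"
    "\<And>i y. y \<in> carrier (?K (Suc i)) \<Longrightarrow> \<psi> (Suc i) (\<phi> (Suc i) y) \<ominus>\<^bsub>?K (Suc i)\<^esub> y =
       ?D (h' (Suc i) y) \<oplus>\<^bsub>?K (Suc i)\<^esub> h' i (?D y)"
    using chain_maps_homotopic[OF koszul_resolution koszul_resolution A chain_map_comp[OF \<phi> \<psi>]
        chain_map_id] by blast
  define p where "p = \<phi> n ?e"
  have e: "?e \<in> carrier (?K n)" by (rule koszul_top_carrier)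
  have p: "p \<in> carrier (P n)" unfolding p_def by (rule linear_maps_closed[OF \<phi>_lin e])
  have "f p \<in> difference_submodule n M" if f: "f \<in> coboundaries ?R P d M n" for f
  proof -
    obtain g where g: "g \<in> linear_maps ?R (P k) M" "f = compose (carrier (P n)) g (d k)"
      using f by (auto simp: coboundaries_def nk Hom_group_def)
    have "f p = g (\<phi> k (?D ?e))"
      using p e by (simp add: g(2) compose_def p_def \<phi>_d[of _ k, folded nk])
    moreover have "(\<lambda>y. g (\<phi> k y)) \<in> linear_maps ?R (?K k) M"
      by (rule linear_maps_comp[OF \<phi>_lin g(1)])
    ultimately show ?thesis unfolding IM[symmetric] by (intro image_eqI[of _ _ "\<lambda>y. g (\<phi> k y)"])
  qed
  moreover have "f \<in> coboundaries ?R P d M n"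
    if f: "f \<in> cocycles ?R P d M n" and fp: "f p \<in> difference_submodule n M" for f
  proof -
    have f_lin: "f \<in> linear_maps ?R (P n) M" and f_ext: "f \<in> extensional (carrier (P n))"
      and fd: "\<And>x. x \<in> carrier (P (Suc n)) \<Longrightarrow> f (d n x) = \<zero>\<^bsub>M\<^esub>"
      using f by (auto simp: cocycles_def Hom_group_def)
    obtain \<mu> where \<mu>: "\<mu> \<in> linear_maps ?R (?K k) M" "f p = \<mu> (?D ?e)"
      using fp unfolding IM[symmetric] by auto
    have Dlin: "?D \<in> linear_maps ?R (?K n) (?K k)" using K(3)[of k] by (simp add: nk)
    have f\<phi>: "f (\<phi> n y) = \<mu> (?D y)" if y: "y \<in> carrier (?K n)" for y
    proof -
      let ?r = "lookup (y {1..n})"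
      have r: "?r \<in> carrier ?R" and y_eq: "y = ?r \<odot>\<^bsub>?K n\<^esub> ?e"
        using koszul_top_generates[OF y] by auto
      have "f (\<phi> n (?r \<odot>\<^bsub>?K n\<^esub> ?e)) = ?r \<odot>\<^bsub>M\<^esub> f p"
        using linear_maps_smult[OF linear_maps_comp[OF \<phi>_lin f_lin] r e] by (simp add: p_def)
      also have "\<dots> = \<mu> (?D (?r \<odot>\<^bsub>?K n\<^esub> ?e))"
        using linear_maps_smult[OF linear_maps_comp[OF Dlin \<mu>(1)] r e] by (simp add: \<mu>(2))
      finally show ?thesis using y_eq by simp
    qed
    \<comment> \<open>By the homotopy h between the composite of the comparison maps and the identity of P,
      f is the coboundary of g.\<close>
    define g where "g y = \<mu> (\<psi> k y) \<ominus>\<^bsub>M\<^esub> f (h k y)" for y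
    have hk: "h k \<in> linear_maps ?R (P k) (P n)" using h(1)[of k] by (simp add: nk)
    have g: "g \<in> linear_maps ?R (P k) M"
      unfolding g_def
      by (intro linear_maps_diff[OF M] linear_maps_comp[OF \<psi>_lin \<mu>(1)] linear_maps_comp[OF hk f_lin])
    have "f x = g (d k x)" if x: "x \<in> carrier (P n)" for x
    proof -
      have dx: "d k x \<in> carrier (P k)" using x linear_maps_closed[OF P(3)[of k]] by (simp add: nk)
      have \<psi>x: "\<psi> n x \<in> carrier (?K n)" by (rule linear_maps_closed[OF \<psi>_lin x])
      have hx: "h n x \<in> carrier (P (Suc n))" by (rule linear_maps_closed[OF h(1) x])
      have fx: "f x \<in> carrier M" "f (h k (d k x)) \<in> carrier M" "\<mu> (\<psi> k (d k x)) \<in> carrier M"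
        using linear_maps_closed[OF f_lin x] linear_maps_closed[OF linear_maps_comp[OF hk f_lin] dx]
          linear_maps_closed[OF linear_maps_comp[OF \<psi>_lin \<mu>(1)] dx] by auto
      have "\<mu> (\<psi> k (d k x)) \<ominus>\<^bsub>M\<^esub> f x = f (\<phi> n (\<psi> n x)) \<ominus>\<^bsub>M\<^esub> f x"
        using f\<phi>[OF \<psi>x] \<psi>_d[of x k] x by (simp add: nk)
      also have "\<dots> = f (\<phi> n (\<psi> n x) \<ominus>\<^bsub>P n\<^esub> x)"
        by (rule linear_maps_minus[symmetric, OF P(2) M f_lin linear_maps_closed[OF \<phi>_lin \<psi>x] x])
      also have "\<dots> = f (d n (h n x) \<oplus>\<^bsub>P n\<^esub> h k (d k x))"
        using h(2)[of x k] x by (simp add: nk)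
      also have "\<dots> = f (h k (d k x))"
        using linear_maps_add[OF f_lin, of "d n (h n x)" "h k (d k x)"] fd[OF hx] fx(2)
          linear_maps_closed[OF P(3) hx] linear_maps_closed[OF hk dx] by simp
      finally have "\<mu> (\<psi> k (d k x)) \<ominus>\<^bsub>M\<^esub> f x = f (h k (d k x))" .
      then have "g (d k x) = \<mu> (\<psi> k (d k x)) \<ominus>\<^bsub>M\<^esub> (\<mu> (\<psi> k (d k x)) \<ominus>\<^bsub>M\<^esub> f x)"
        by (simp add: g_def)
      also have "\<dots> = f x"
        using fx by (simp add: a_minus_def M.M.minus_add M.M.r_neg2)
      finally show ?thesis by simp
    qed
    then have "f = compose (carrier (P n)) (restrict g (carrier (P k))) (d k)"
      using f_ext linear_maps_closed[OF P(3)[of k]]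
      by (intro extensionalityI[OF f_ext compose_extensional]) (simp add: compose_def nk)
    moreover have "restrict g (carrier (P k)) \<in> carrier (Hom_group ?R (P k) M)"
      using linear_maps_restrict[OF P(2) g] by (simp add: Hom_group_def)
    ultimately show ?thesis by (auto simp: coboundaries_def nk)
  qed
  moreover have "\<exists>f\<in>cocycles ?R P d M n. f p \<ominus>\<^bsub>M\<^esub> m \<in> difference_submodule n M"
    if m: "m \<in> carrier M" for m
  proof -
    obtain \<mu> where \<mu>: "\<mu> \<in> linear_maps ?R (?K n) M" "\<mu> ?e = m"
    proof (rule koszul_linear_map[OF M, of n "\<lambda>_. m"])
      fix g assume "g \<in> linear_maps ?R (?K n) M"
        "\<And>S. \<lbrakk>S \<subseteq> {1..n}; card S = n\<rbrakk> \<Longrightarrow> g (koszul_basis S) = m"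
      then show thesis using that by simp
    qed (use m in auto)
    \<comment> \<open>A cocycle because the Koszul complex vanishes in degree n + 1.\<close>
    define f where "f = restrict (\<lambda>x. \<mu> (\<psi> n x)) (carrier (P n))"
    have zero: "\<mu> \<zero>\<^bsub>?K n\<^esub> = \<zero>\<^bsub>M\<^esub>" by (rule linear_maps_zero[OF K(2) M \<mu>(1)])
    have D0: "?D y = \<zero>\<^bsub>?K n\<^esub>" if "y \<in> carrier (?K (Suc n))" for y
      using koszul_module_above_top[OF that] by (simp add: koszul_diff_def koszul_module_sel fun_eq_iff)
    have "f (d n x) = \<zero>\<^bsub>M\<^esub>" if x: "x \<in> carrier (P (Suc n))" for x
      using D0[OF linear_maps_closed[OF \<psi>_lin x]] linear_maps_closed[OF P(3) x]
      by (simp add: f_def zero \<psi>_d[OF x, symmetric])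
    moreover have "f \<in> linear_maps ?R (P n) M"
      unfolding f_def by (intro linear_maps_restrict[OF P(2)] linear_maps_comp[OF \<psi>_lin \<mu>(1)])
    ultimately have "f \<in> cocycles ?R P d M n"
      by (simp add: cocycles_def Hom_group_def f_def)
    moreover have "f p \<ominus>\<^bsub>M\<^esub> m \<in> difference_submodule n M"
    proof -
      have h'k: "h' k \<in> linear_maps ?R (?K k) (?K n)" using h'(1)[of k] by (simp add: nk)
      have De: "?D ?e \<in> carrier (?K k)" using e koszul_diff_carrier[of ?e n k] by (simp add: nk)
      have "f p \<ominus>\<^bsub>M\<^esub> m = \<mu> (\<psi> n (\<phi> n ?e) \<ominus>\<^bsub>?K n\<^esub> ?e)"
        using p linear_maps_minus[OF K(2) M \<mu>(1) linear_maps_closed[OF \<psi>_lin p] e]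
        by (simp add: f_def p_def \<mu>(2))
      also have "\<dots> = \<mu> (?D (h' n ?e) \<oplus>\<^bsub>?K n\<^esub> h' k (?D ?e))"
        using h'(2)[of ?e k] e by (simp add: nk)
      also have "\<dots> = \<mu> (h' k (?D ?e))"
        using D0[OF linear_maps_closed[OF h'(1) e]] by (simp add: koszul_module_sel)
      finally show ?thesis
        unfolding IM[symmetric]
        by (intro image_eqI[of _ _ "\<lambda>y. \<mu> (h' k y)"]) (auto intro: linear_maps_comp[OF h'k \<mu>(1)])
    qed
    ultimately show ?thesis by blast
  qed
  ultimately show ?thesis using p by blast
qed

lemma comm_group_Hom_group:
  assumes "left_module R P" and M: "left_module R M"
  shows "comm_group (Hom_group R P M)"
proof -
  interpret P: left_module R P by fact
  interpret M: left_module R M by fact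
  let ?H = "Hom_group R P M"
  note sel = Hom_group_def
  have cl: "f x \<in> carrier M" if "f \<in> carrier ?H" "x \<in> carrier P" for f x
    using that by (auto simp: sel intro: linear_maps_closed)
  have lin_add: "(\<lambda>x. f x \<oplus>\<^bsub>M\<^esub> g x) \<in> linear_maps R P M"
    if f: "f \<in> linear_maps R P M" and g: "g \<in> linear_maps R P M" for f g
    by (rule linear_mapsI)
      (auto simp: linear_maps_add[OF f] linear_maps_add[OF g] linear_maps_smult[OF f] linear_maps_smult[OF g]
        linear_maps_closed[OF f] linear_maps_closed[OF g] M.M.a_ac M.smult_r_distr)
  have lin_zero: "(\<lambda>x. \<zero>\<^bsub>M\<^esub>) \<in> linear_maps R P M"
    by (rule linear_mapsI) (auto simp: M.smult_r_zero)
  show ?thesis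
  proof (rule comm_groupI)
    fix f g assume "f \<in> carrier ?H" "g \<in> carrier ?H"
    then show "f \<otimes>\<^bsub>?H\<^esub> g \<in> carrier ?H"
      using linear_maps_restrict[OF \<open>left_module R P\<close> lin_add[of f g]] by (auto simp: sel)
  next
    show "\<one>\<^bsub>?H\<^esub> \<in> carrier ?H"
      using linear_maps_restrict[OF \<open>left_module R P\<close> lin_zero] by (auto simp: sel)
  next
    fix f g h assume "f \<in> carrier ?H" "g \<in> carrier ?H" "h \<in> carrier ?H"
    then show "f \<otimes>\<^bsub>?H\<^esub> g \<otimes>\<^bsub>?H\<^esub> h = f \<otimes>\<^bsub>?H\<^esub> (g \<otimes>\<^bsub>?H\<^esub> h)"
      using cl by (simp add: sel restrict_def fun_eq_iff M.M.a_assoc)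
  next
    fix f g assume "f \<in> carrier ?H" "g \<in> carrier ?H"
    then show "f \<otimes>\<^bsub>?H\<^esub> g = g \<otimes>\<^bsub>?H\<^esub> f"
      using cl by (simp add: sel restrict_def fun_eq_iff M.M.a_comm)
  next
    fix f assume "f \<in> carrier ?H"
    then show "\<one>\<^bsub>?H\<^esub> \<otimes>\<^bsub>?H\<^esub> f = f"
      using cl by (auto simp: sel restrict_def fun_eq_iff extensional_def)
  next
    fix f assume f: "f \<in> carrier ?H"
    have "(\<lambda>x. \<zero>\<^bsub>M\<^esub> \<ominus>\<^bsub>M\<^esub> f x) \<in> linear_maps R P M"
      using f by (intro linear_maps_diff[OF M lin_zero]) (simp add: sel)
    then have "restrict (\<lambda>x. \<zero>\<^bsub>M\<^esub> \<ominus>\<^bsub>M\<^esub> f x) (carrier P) \<in> carrier ?H"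
      using linear_maps_restrict[OF \<open>left_module R P\<close>] by (simp add: sel)
    moreover have "restrict (\<lambda>x. \<zero>\<^bsub>M\<^esub> \<ominus>\<^bsub>M\<^esub> f x) (carrier P) \<otimes>\<^bsub>?H\<^esub> f = \<one>\<^bsub>?H\<^esub>"
      using cl[OF f] by (simp add: sel restrict_def fun_eq_iff a_minus_def M.M.l_neg)
    ultimately show "\<exists>g\<in>carrier ?H. g \<otimes>\<^bsub>?H\<^esub> f = \<one>\<^bsub>?H\<^esub>" by blast
  qed
qed

lemma subgroup_cocycles:
  assumes res: "projective_resolution R A P d \<epsilon>" and M: "left_module R M"
  shows "subgroup (cocycles R P d M n) (Hom_group R (P n) M)"
proof -
  note P = projective_resolution_simps[OF res]
  interpret M: left_module R M by fact
  interpret H: comm_group "Hom_group R (P n) M" by (rule comm_group_Hom_group[OF P(2) M])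
  have dx: "d n x \<in> carrier (P n)" if "x \<in> carrier (P (Suc n))" for x
    by (rule linear_maps_closed[OF P(3) that])
  show ?thesis
  proof (rule H.subgroupI)
    show "cocycles R P d M n \<noteq> {}"
    proof -
      have "\<one>\<^bsub>Hom_group R (P n) M\<^esub> \<in> cocycles R P d M n"
        using H.one_closed dx by (auto simp: cocycles_def Hom_group_def)
      then show ?thesis by blast
    qed
  next
    fix f assume f: "f \<in> cocycles R P d M n"
    then have fH: "f \<in> carrier (Hom_group R (P n) M)" by (simp add: cocycles_def)
    let ?g = "inv\<^bsub>Hom_group R (P n) M\<^esub> f"
    have "?g (d n x) = \<zero>\<^bsub>M\<^esub>" if x: "x \<in> carrier (P (Suc n))" for x
    proof -
      have "(?g \<otimes>\<^bsub>Hom_group R (P n) M\<^esub> f) (d n x) = \<one>\<^bsub>Hom_group R (P n) M\<^esub> (d n x)"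
        using fH by simp
      moreover have "?g (d n x) \<in> carrier M"
        using H.inv_closed[OF fH] dx[OF x] by (auto simp: Hom_group_def intro: linear_maps_closed)
      ultimately show ?thesis using f x dx by (simp add: Hom_group_def cocycles_def)
    qed
    then show "?g \<in> cocycles R P d M n" using H.inv_closed[OF fH] by (simp add: cocycles_def)
  next
    fix f g assume fg: "f \<in> cocycles R P d M n" "g \<in> cocycles R P d M n"
    then have "f \<otimes>\<^bsub>Hom_group R (P n) M\<^esub> g \<in> carrier (Hom_group R (P n) M)"
      by (intro H.m_closed) (simp_all add: cocycles_def)
    then show "f \<otimes>\<^bsub>Hom_group R (P n) M\<^esub> g \<in> cocycles R P d M n"
      using fg dx by (auto simp: cocycles_def Hom_group_def)
  qed (auto simp: cocycles_def)
qed

lemma coboundaries_subset_cocycles: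
  assumes res: "projective_resolution R A P d \<epsilon>" and M: "left_module R M"
  shows "coboundaries R P d M (Suc k) \<subseteq> cocycles R P d M (Suc k)"
proof
  note P = projective_resolution_simps[OF res]
  fix f assume "f \<in> coboundaries R P d M (Suc k)"
  then obtain g where g: "g \<in> linear_maps R (P k) M" "f = compose (carrier (P (Suc k))) g (d k)"
    by (auto simp: coboundaries_def Hom_group_def)
  have "(\<lambda>x. g (d k x)) \<in> linear_maps R (P (Suc k)) M" by (rule linear_maps_comp[OF P(3) g(1)])
  then have "f \<in> carrier (Hom_group R (P (Suc k)) M)"
    using linear_maps_restrict[OF P(2)] by (simp add: g(2) compose_def Hom_group_def)
  moreover have "f (d (Suc k) x) = \<zero>\<^bsub>M\<^esub>" if "x \<in> carrier (P (Suc (Suc k)))" for x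
    using that linear_maps_zero[OF P(2) M g(1)] linear_maps_closed[OF P(3)[of "Suc k"]]
    by (simp add: g(2) compose_def P(8))
  ultimately show "f \<in> cocycles R P d M (Suc k)" by (simp add: cocycles_def)
qed

text \<open>The same in terms of any presentation \<open>\<theta>\<close> of the quotient.\<close>

theorem top_cohomology_iso:
  assumes n: "n \<ge> 1" and res: "projective_resolution (ZG n) trivial_module P d \<epsilon>"
    and M: "left_module (ZG n) M" and H: "group H"
    and \<theta>: "\<theta> \<in> hom (add_monoid M) H" "\<theta> ` carrier M = carrier H"
    and ker: "\<And>m. m \<in> carrier M \<Longrightarrow> \<theta> m = \<one>\<^bsub>H\<^esub> \<longleftrightarrow> m \<in> difference_submodule n M"
  shows "Hom_cohomology (ZG n) P d M n \<cong> H"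
proof -
  note P = projective_resolution_simps[OF res]
  interpret M: left_module "ZG n" M by fact
  interpret H: group H by fact
  let ?Hom = "Hom_group (ZG n) (P n) M" and ?Z = "cocycles (ZG n) P d M n"
    and ?B = "coboundaries (ZG n) P d M n"
  let ?C = "?Hom\<lparr>carrier := ?Z\<rparr>"
  obtain p where p: "p \<in> carrier (P n)"
    "\<And>f. f \<in> ?Z \<Longrightarrow> f \<in> ?B \<longleftrightarrow> f p \<in> difference_submodule n M"
    "\<And>m. m \<in> carrier M \<Longrightarrow> \<exists>f\<in>?Z. f p \<ominus>\<^bsub>M\<^esub> m \<in> difference_submodule n M"
    using top_cohomology[OF n res M] by blast
  have fp: "f p \<in> carrier M" if "f \<in> ?Z" for f
    using that p(1) by (auto simp: cocycles_def Hom_group_def intro: linear_maps_closed)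
  have "group ?Hom" by (rule comm_group.axioms(2)[OF comm_group_Hom_group[OF P(2) M]])
  then interpret C: group ?C
    by (rule subgroup.subgroup_is_group[OF subgroup_cocycles[OF res M]])
  have add: "\<theta> (x \<oplus>\<^bsub>M\<^esub> y) = \<theta> x \<otimes>\<^bsub>H\<^esub> \<theta> y" if "x \<in> carrier M" "y \<in> carrier M" for x y
    using hom_mult[OF \<theta>(1)] that by simp
  have "(\<lambda>f. \<theta> (f p)) \<in> hom ?C H"
  proof (rule homI)
    show "\<theta> (f p) \<in> carrier H" if "f \<in> carrier ?C" for f using fp that \<theta>(2) by auto
    show "\<theta> ((f \<otimes>\<^bsub>?C\<^esub> g) p) = \<theta> (f p) \<otimes>\<^bsub>H\<^esub> \<theta> (g p)" if "f \<in> carrier ?C" "g \<in> carrier ?C" for f g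
      using that p(1) fp by (simp add: Hom_group_def add)
  qed
  then interpret h: group_hom ?C H "\<lambda>f. \<theta> (f p)"
    by (intro group_hom.intro group_hom_axioms.intro C.group_axioms H)
  have "y \<in> (\<lambda>f. \<theta> (f p)) ` carrier ?C" if "y \<in> carrier H" for y
  proof -
    obtain m where m: "m \<in> carrier M" "y = \<theta> m" using \<theta>(2) \<open>y \<in> carrier H\<close> by auto
    obtain f where f: "f \<in> ?Z" "f p \<ominus>\<^bsub>M\<^esub> m \<in> difference_submodule n M" using p(3)[OF m(1)] by blast
    have "f p = (f p \<ominus>\<^bsub>M\<^esub> m) \<oplus>\<^bsub>M\<^esub> m"
      using fp[OF f(1)] m(1) by (simp add: a_minus_def M.M.a_assoc M.M.l_neg)
    then have "\<theta> (f p) = \<theta> (f p \<ominus>\<^bsub>M\<^esub> m) \<otimes>\<^bsub>H\<^esub> \<theta> m"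
      using add[of "f p \<ominus>\<^bsub>M\<^esub> m" m] fp[OF f(1)] m(1) by simp
    also have "\<theta> (f p \<ominus>\<^bsub>M\<^esub> m) = \<one>\<^bsub>H\<^esub>"
      using ker f fp[OF f(1)] m(1) by simp
    finally have "\<theta> (f p) = y" using m that by simp
    then show ?thesis using f(1) by auto
  qed
  then have "(\<lambda>f. \<theta> (f p)) ` carrier ?C = carrier H"
    using h.hom_closed by auto
  then have "?C Mod kernel ?C H (\<lambda>f. \<theta> (f p)) \<cong> H"
    by (rule h.FactGroup_iso)
  moreover have "kernel ?C H (\<lambda>f. \<theta> (f p)) = ?B"
  proof -
    obtain k where "n = Suc k" using n by (cases n) auto
    then have "?B \<subseteq> ?Z" using coboundaries_subset_cocycles[OF res M, of k] by simp
    then show ?thesis using p(2) ker fp by (auto simp: kernel_def)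
  qed
  ultimately show ?thesis by (simp add: Hom_cohomology_def)
qed

section \<open>The Fourier transform and the operator norm\<close>

text \<open>The value of the monomial with exponents \<open>g\<close> at the point \<open>z\<close>, which for \<open>z\<close> in the torus is a
  character of the free abelian group.\<close>

definition character :: "nat \<Rightarrow> (nat \<Rightarrow> complex) \<Rightarrow> (nat \<Rightarrow>\<^sub>0 int) \<Rightarrow> complex" where
  "character n z g = (\<Prod>i\<in>{1..n}. z i powi lookup g i)"

text \<open>The Fourier transform of \<open>p\<close>, a Laurent polynomial in the coordinates of \<open>z\<close>.\<close>

abbreviation fourier :: "nat \<Rightarrow> ((nat \<Rightarrow>\<^sub>0 int) \<Rightarrow>\<^sub>0 complex) \<Rightarrow> (nat \<Rightarrow> complex) \<Rightarrow> complex" where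
  "fourier n p z \<equiv> evaluation (character n z) p"

lemma torus_norm: "\<lbrakk>z \<in> torus n; i \<in> {1..n}\<rbrakk> \<Longrightarrow> cmod (z i) = 1"
  by (auto simp: torus_def)

lemma torus_nonzero: "\<lbrakk>z \<in> torus n; i \<in> {1..n}\<rbrakk> \<Longrightarrow> z i \<noteq> 0"
  using torus_norm by fastforce

lemma character_add: "z \<in> torus n \<Longrightarrow> character n z (g + h) = character n z g * character n z h"
  unfolding character_def prod.distrib[symmetric]
  by (intro prod.cong) (auto simp: lookup_add power_int_add torus_nonzero)

lemma character_0 [simp]: "character n z 0 = 1"
  by (simp add: character_def)

lemma norm_character: "z \<in> torus n \<Longrightarrow> cmod (character n z g) = 1"
  by (simp add: character_def prod_norm[symmetric] norm_power_int torus_norm)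

lemma character_uminus: "z \<in> torus n \<Longrightarrow> character n z (- g) = cnj (character n z g)"
proof -
  assume z: "z \<in> torus n"
  have "character n z g * cnj (character n z g) = 1"
    using norm_character[OF z, of g] complex_norm_square[of "character n z g"] by simp
  moreover have "character n z g * character n z (- g) = 1"
    using character_add[OF z, of g "- g"] by simp
  ultimately show ?thesis
    by (metis mult_cancel_left mult_zero_left zero_neq_one)
qed

lemma character_diff: "z \<in> torus n \<Longrightarrow> character n z (g - h) = character n z g * cnj (character n z h)"
  using character_add[of z n g "- h"] character_uminus by simp

lemma character_single: "i \<in> {1..n} \<Longrightarrow> character n z (single i m) = z i powi m"
proof -
  assume i: "i \<in> {1..n}"
  have "character n z (single i m) = (\<Prod>j\<in>{1..n}. if j = i then z i powi m else 1)"
    unfolding character_def by (intro prod.cong) (auto simp: lookup_single when_def)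
  then show ?thesis using i by (simp add: prod.delta)
qed

lemma fourier_mult: "z \<in> torus n \<Longrightarrow> fourier n (p * q) z = fourier n p z * fourier n q z"
  by (rule evaluation_mult) (rule character_add)

lemma fourier_1 [simp]: "fourier n 1 z = 1"
  by (simp flip: single_one)

lemma continuous_on_fourier: "continuous_on (torus n) (fourier n p)"
  unfolding evaluation_def character_def
  by (intro continuous_intros continuous_on_subset[OF continuous_on_product_coordinates])
    (auto simp: torus_nonzero)

lemma norm_fourier_le: "z \<in> torus n \<Longrightarrow> cmod (fourier n p z) \<le> (\<Sum>g\<in>keys p. cmod (lookup p g))"
  unfolding evaluation_def by (rule order_trans[OF norm_sum]) (simp add: norm_mult norm_character)

text \<open>The square of the \<open>L2\<close>-norm of a finite formal sum.\<close>

definition norm2 :: "('g \<Rightarrow>\<^sub>0 complex) \<Rightarrow> real" where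
  "norm2 p = (\<Sum>g\<in>keys p. (cmod (lookup p g))\<^sup>2)"

lemma norm2_superset:
  "\<lbrakk>finite U; keys p \<subseteq> U\<rbrakk> \<Longrightarrow> norm2 p = (\<Sum>g\<in>U. (cmod (lookup p g))\<^sup>2)"
  unfolding norm2_def by (rule sum.mono_neutral_left) (auto simp: in_keys_iff)

lemma norm2_nonneg: "norm2 p \<ge> 0"
  by (simp add: norm2_def sum_nonneg)

lemma sum_le_norm2: "finite F \<Longrightarrow> (\<Sum>g\<in>F. (cmod (lookup p g))\<^sup>2) \<le> norm2 p"
  by (subst norm2_superset[of "F \<union> keys p"]) (auto intro!: sum_mono2)

text \<open>The points of the torus whose coordinates are \<open>N\<close>-th roots of unity.\<close>

definition root_point :: "nat \<Rightarrow> nat \<Rightarrow> (nat \<Rightarrow> nat) \<Rightarrow> nat \<Rightarrow> complex" where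
  "root_point n N k = (\<lambda>i\<in>{1..n}. cis (2 * pi * real (k i) / real N))"

lemma root_point_torus: "root_point n N k \<in> torus n"
  by (auto simp: root_point_def torus_def)

lemma sum_roots_of_unity:
  assumes "\<bar>m\<bar> < int N"
  shows "(\<Sum>k<N. cis (2 * pi * real k / real N) powi m) = (if m = 0 then of_nat N else 0)"
proof (cases "m = 0")
  case False
  define w where "w = cis (2 * pi * of_int m / real N)"
  have N: "real N > 0" using assms by simp
  have "cis (2 * pi * real k / real N) powi m = w ^ k" for k
    unfolding w_def cis_power_int Complex.DeMoivre by (rule arg_cong[of _ _ cis]) (simp add: mult_ac)
  moreover have "w \<noteq> 1"
  proof
    assume "w = 1"
    then have "cos (2 * pi * of_int m / real N) = 1" by (simp add: w_def complex_eq_iff)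
    then obtain l :: int where "2 * pi * of_int m / real N = of_int l * 2 * pi"
      unfolding cos_one_2pi_int by blast
    then have "of_int m = (of_int (l * int N) :: real)" using N by (simp add: field_simps)
    then have "m = l * int N" unfolding of_int_eq_iff .
    then show False using assms False
      by (metis abs_ge_zero abs_mult abs_of_nat dvd_triv_right dvd_imp_le_int not_le)
  qed
  moreover have "w ^ N = cis (2 * pi * of_int m)"
    unfolding w_def Complex.DeMoivre using N by simp
  then have "w ^ N = 1" by (simp add: cis_multiple_2pi)
  ultimately show ?thesis using False by (simp add: sum_gp_strict)
qed simp

lemma sum_character_root_point:
  assumes "keys g \<subseteq> {1..n}" "\<And>i. i \<in> {1..n} \<Longrightarrow> \<bar>lookup g i\<bar> < int N"
  shows "(\<Sum>k\<in>{1..n} \<rightarrow>\<^sub>E {..<N}. character n (root_point n N k) g) = (if g = 0 then of_nat N ^ n else 0)"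
proof -
  have "(\<Sum>k\<in>{1..n} \<rightarrow>\<^sub>E {..<N}. character n (root_point n N k) g) =
      (\<Sum>k\<in>{1..n} \<rightarrow>\<^sub>E {..<N}. \<Prod>i\<in>{1..n}. cis (2 * pi * real (k i) / real N) powi lookup g i)"
    by (simp add: character_def root_point_def)
  also have "\<dots> = (\<Prod>i\<in>{1..n}. \<Sum>k<N. cis (2 * pi * real k / real N) powi lookup g i)"
    by (rule prod_sum_PiE[symmetric]) auto
  also have "\<dots> = (\<Prod>i\<in>{1..n}. if lookup g i = 0 then of_nat N else 0)"
    by (intro prod.cong refl sum_roots_of_unity assms)
  also have "\<dots> = (if g = 0 then of_nat N ^ n else 0)"
  proof (cases "g = 0")
    case False
    then obtain i where "i \<in> keys g" by fastforce
    then have "i \<in> {1..n}" "lookup g i \<noteq> 0" using assms(1) by (auto simp: in_keys_iff)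
    then have "(\<Prod>i\<in>{1..n}. if lookup g i = 0 then (of_nat :: nat \<Rightarrow> complex) N else 0) = 0"
      by (intro prod_zero) auto
    then show ?thesis using False by simp
  qed simp
  finally show ?thesis .
qed

text \<open>The Parseval identity on the grid of \<open>N\<close>-th roots of unity. It is exact as soon as \<open>N\<close> exceeds
  all differences of exponents in the support of \<open>p\<close>.\<close>

lemma discrete_Parseval:
  assumes "p \<in> supported {1..n}"
  shows "\<forall>\<^sub>F N in sequentially.
    (\<Sum>k\<in>{1..n} \<rightarrow>\<^sub>E {..<N}. (cmod (fourier n p (root_point n N k)))\<^sup>2) = real N ^ n * norm2 p"
proof -
  let ?K = "keys p" and ?p = "lookup p"
  have "\<forall>\<^sub>F N in sequentially. \<bar>m\<bar> < int N" for m :: int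
    by (rule eventually_sequentiallyI[of "nat \<bar>m\<bar> + 1"]) linarith
  then have "\<forall>\<^sub>F N in sequentially. \<forall>g\<in>?K. \<forall>h\<in>?K. \<forall>i\<in>{1..n}. \<bar>lookup (g - h) i\<bar> < int N"
    by (intro eventually_ball_finite ballI) auto
  then show ?thesis
  proof (eventually_elim)
    case (elim N)
    let ?E = "{1..n} \<rightarrow>\<^sub>E {..<N}" and ?z = "root_point n N"
    have "complex_of_real (\<Sum>k\<in>?E. (cmod (fourier n p (?z k)))\<^sup>2) =
        (\<Sum>k\<in>?E. fourier n p (?z k) * cnj (fourier n p (?z k)))"
      by (simp add: complex_norm_square del: of_real_power)
    also have "\<dots> = (\<Sum>k\<in>?E. \<Sum>g\<in>?K. \<Sum>h\<in>?K. ?p g * cnj (?p h) * character n (?z k) (g - h))"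
      by (simp add: evaluation_def sum_product character_diff root_point_torus mult_ac)
    also have "\<dots> = (\<Sum>g\<in>?K. \<Sum>h\<in>?K. ?p g * cnj (?p h) * (\<Sum>k\<in>?E. character n (?z k) (g - h)))"
      unfolding sum_distrib_left
      by (subst sum.swap, intro sum.cong refl, rule sum.swap)
    also have "\<dots> = (\<Sum>g\<in>?K. \<Sum>h\<in>?K. ?p g * cnj (?p h) * (if g = h then of_nat N ^ n else 0))"
    proof (intro sum.cong refl)
      fix g h assume gh: "g \<in> ?K" "h \<in> ?K"
      then have "keys (g - h) \<subseteq> {1..n}"
        using assms keys_diff[of g h] by (auto simp: supported_def)
      then show "?p g * cnj (?p h) * (\<Sum>k\<in>?E. character n (?z k) (g - h)) =
          ?p g * cnj (?p h) * (if g = h then of_nat N ^ n else 0)"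
        using elim gh by (subst sum_character_root_point) auto
    qed
    also have "\<dots> = (\<Sum>g\<in>?K. ?p g * cnj (?p g) * of_nat N ^ n)"
      by (simp add: if_distrib[where f = "\<lambda>x. _ * x"] sum.delta' sum.delta cong: if_cong)
    also have "\<dots> = complex_of_real (real N ^ n * norm2 p)"
      by (simp add: norm2_def complex_norm_square sum_distrib_left mult_ac del: of_real_power)
        (simp add: of_real_power)
    finally show ?case unfolding of_real_eq_iff .
  qed
qed

text \<open>The Fourier transform turns the product into a pointwise product, so on a common grid for \<open>q\<close>
  and \<open>p * q\<close> the bound is immediate from the Parseval identity.\<close>

lemma norm2_mult_le:
  assumes p: "p \<in> supported {1..n}" and q: "q \<in> supported {1..n}"
    and C: "\<And>z. z \<in> torus n \<Longrightarrow> cmod (fourier n p z) \<le> C"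
  shows "norm2 (p * q) \<le> C\<^sup>2 * norm2 q"
proof -
  have "\<forall>\<^sub>F N in sequentially. N > 0 \<and>
      (\<Sum>k\<in>{1..n} \<rightarrow>\<^sub>E {..<N}. (cmod (fourier n q (root_point n N k)))\<^sup>2) = real N ^ n * norm2 q \<and>
      (\<Sum>k\<in>{1..n} \<rightarrow>\<^sub>E {..<N}. (cmod (fourier n (p * q) (root_point n N k)))\<^sup>2) = real N ^ n * norm2 (p * q)"
    by (intro eventually_conj discrete_Parseval supported_mult assms eventually_gt_at_top)
  from eventually_happens'[OF sequentially_bot this] obtain N :: nat where N: "N > 0"
    "(\<Sum>k\<in>{1..n} \<rightarrow>\<^sub>E {..<N}. (cmod (fourier n q (root_point n N k)))\<^sup>2) = real N ^ n * norm2 q"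
    "(\<Sum>k\<in>{1..n} \<rightarrow>\<^sub>E {..<N}. (cmod (fourier n (p * q) (root_point n N k)))\<^sup>2) = real N ^ n * norm2 (p * q)"
    by (elim exE conjE)
  have "real N ^ n * norm2 (p * q) \<le> (\<Sum>k\<in>{1..n} \<rightarrow>\<^sub>E {..<N}. C\<^sup>2 * (cmod (fourier n q (root_point n N k)))\<^sup>2)"
    unfolding N(3)[symmetric]
    by (intro sum_mono)
      (auto simp: fourier_mult[OF root_point_torus] norm_mult power_mult_distrib
        intro!: mult_right_mono power_mono C root_point_torus)
  also have "\<dots> = real N ^ n * (C\<^sup>2 * norm2 q)"
    by (simp add: N(2) mult_ac flip: sum_distrib_left)
  finally show ?thesis using N(1) by simp
qed

abbreviation FA :: "nat \<Rightarrow> (nat \<Rightarrow>\<^sub>0 int) monoid" where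
  "FA n \<equiv> free_Abelian_group {1..n}"

lemma L2_norm_power2: "(L2_norm G b)\<^sup>2 = (\<Sum>\<^sub>\<infinity>g\<in>carrier G. (cmod (b g))\<^sup>2)"
  by (simp add: L2_norm_def infsum_nonneg)

lemma L2_norm_nonneg: "L2_norm G b \<ge> 0"
  by (simp add: L2_norm_def infsum_nonneg)

lemma lookup_L2:
  assumes "p \<in> supported {1..n}"
  shows "lookup p \<in> L2 (FA n)" and "L2_norm (FA n) (lookup p) = sqrt (norm2 p)"
proof -
  have keys: "keys p \<subseteq> carrier (FA n)" using assms by (auto simp: supported_def)
  have "(\<lambda>g. (cmod (lookup p g))\<^sup>2) summable_on carrier (FA n) \<longleftrightarrow>
      (\<lambda>g. (cmod (lookup p g))\<^sup>2) summable_on keys p"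
    by (rule summable_on_cong_neutral)
      (use keys in \<open>auto simp: in_keys_iff subset_iff simp del: carrier_free_Abelian_group_iff\<close>)
  moreover have "lookup p g = 0" if "g \<notin> carrier (FA n)" for g
    using keys that by (meson in_keys_iff subsetD)
  ultimately show "lookup p \<in> L2 (FA n)"
    by (simp add: L2_def)
  have "(\<Sum>\<^sub>\<infinity>g\<in>carrier (FA n). (cmod (lookup p g))\<^sup>2) =
      (\<Sum>\<^sub>\<infinity>g\<in>keys p. (cmod (lookup p g))\<^sup>2)"
    by (rule infsum_cong_neutral)
      (use keys in \<open>auto simp: in_keys_iff subset_iff simp del: carrier_free_Abelian_group_iff\<close>)
  then show "L2_norm (FA n) (lookup p) = sqrt (norm2 p)"
    by (simp add: L2_norm_def norm2_def)
qed

lemma convolution_lookup: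
  assumes "p \<in> supported {1..n}" "keys g \<subseteq> {1..n}"
  shows "convolution (FA n) (lookup p) b g =
    (\<Sum>h\<in>keys p. lookup p h * b (g - h))"
  unfolding convolution_def using assms
  by (auto simp: supported_def in_keys_iff intro!: sum.cong)

lemma L2_norm_convolution_le:
  assumes p: "p \<in> supported {1..n}" and C: "\<And>z. z \<in> torus n \<Longrightarrow> cmod (fourier n p z) \<le> C" "C \<ge> 0"
    and b: "b \<in> L2 (FA n)"
  shows "L2_norm (FA n) (convolution (FA n) (lookup p) b) \<le> C * L2_norm (FA n) b"
proof -
  let ?c = "convolution (FA n) (lookup p) b"
  have b_sum: "(\<lambda>g. (cmod (b g))\<^sup>2) summable_on carrier (FA n)" and b0: "\<And>g. g \<notin> carrier (FA n) \<Longrightarrow> b g = 0"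
    using b unfolding L2_def by blast+
  have bound: "(\<Sum>g\<in>F. (cmod (?c g))\<^sup>2) \<le> (C * L2_norm (FA n) b)\<^sup>2"
    if F: "finite F" "F \<subseteq> carrier (FA n)" for F
  proof -
    \<comment> \<open>On the finite set F the convolution only involves the values of b on the finite set T.\<close>
    define T where "T = (\<lambda>(g, h). g - h) ` (F \<times> keys p)"
    have T: "finite T" using F by (simp add: T_def)
    define q where "q = Abs_poly_mapping (\<lambda>g. if g \<in> T then b g else 0)"
    have q: "lookup q = (\<lambda>g. if g \<in> T then b g else 0)"
      unfolding q_def by (rule lookup_Abs_poly_mapping) (rule finite_subset[OF _ T], auto)
    have "keys g \<subseteq> {1..n}" if "g \<in> keys q" for g
      using b0[of g] that by (simp add: in_keys_iff q split: if_splits) blast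
    then have q_supp: "q \<in> supported {1..n}" by (simp add: supported_def)
    have "(\<Sum>g\<in>F. (cmod (?c g))\<^sup>2) = (\<Sum>g\<in>F. (cmod (lookup (p * q) g))\<^sup>2)"
    proof (intro sum.cong refl)
      fix g assume g: "g \<in> F"
      have "?c g = (\<Sum>h\<in>keys p. lookup p h * b (g - h))"
        using subsetD[OF F(2) g] by (intro convolution_lookup p) simp
      also have "\<dots> = lookup (p * q) g"
        unfolding lookup_mult_group q using g by (intro sum.cong refl) (auto simp: T_def)
      finally show "(cmod (?c g))\<^sup>2 = (cmod (lookup (p * q) g))\<^sup>2" by simp
    qed
    also have "\<dots> \<le> norm2 (p * q)" by (rule sum_le_norm2[OF F(1)])
    also have "\<dots> \<le> C\<^sup>2 * norm2 q" by (rule norm2_mult_le[OF p q_supp C(1)])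
    also have "norm2 q = (\<Sum>g\<in>keys q. (cmod (b g))\<^sup>2)"
      unfolding norm2_def by (intro sum.cong refl) (auto simp: q in_keys_iff split: if_splits)
    also have "\<dots> \<le> (L2_norm (FA n) b)\<^sup>2"
      unfolding L2_norm_power2
      by (rule finite_sum_le_infsum[OF b_sum]) (use q_supp in \<open>auto simp: supported_def\<close>)
    finally show ?thesis by (simp add: power_mult_distrib mult_left_mono)
  qed
  have "(\<lambda>g. (cmod (?c g))\<^sup>2) summable_on carrier (FA n)"
    by (rule nonneg_bdd_above_summable_on) (use bound in \<open>auto intro!: bdd_aboveI\<close>)
  then have "(L2_norm (FA n) ?c)\<^sup>2 \<le> (C * L2_norm (FA n) b)\<^sup>2"
    unfolding L2_norm_power2 by (rule infsum_le_finite_sums) (use bound in auto)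
  then show ?thesis
    by (rule power2_le_imp_le) (simp add: C(2) L2_norm_nonneg)
qed

lemma op_norm_set_nonempty:
  "{L2_norm (FA n) (convolution (FA n) a b) | b. b \<in> L2 (FA n) \<and> L2_norm (FA n) b = 1} \<noteq> {}"
proof -
  have "norm2 (1 :: (nat \<Rightarrow>\<^sub>0 int) \<Rightarrow>\<^sub>0 complex) = 1" by (simp add: norm2_def flip: single_one)
  then have "lookup 1 \<in> L2 (FA n)" "L2_norm (FA n) (lookup 1) = 1"
    using lookup_L2[of 1 n] by auto
  then show ?thesis by blast
qed

lemma op_norm_le:
  assumes p: "p \<in> supported {1..n}" and C: "\<And>z. z \<in> torus n \<Longrightarrow> cmod (fourier n p z) \<le> C" "C \<ge> 0"
  shows "op_norm (FA n) (lookup p) \<le> C"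
  unfolding op_norm_def
  by (rule cSup_least[OF op_norm_set_nonempty]) (use L2_norm_convolution_le[OF p C] in fastforce)

lemma L2_norm_convolution_le_op_norm:
  assumes p: "p \<in> supported {1..n}" and b: "b \<in> L2 (FA n)" "L2_norm (FA n) b = 1"
  shows "L2_norm (FA n) (convolution (FA n) (lookup p) b) \<le> op_norm (FA n) (lookup p)"
  unfolding op_norm_def
proof (rule cSup_upper)
  let ?C = "\<Sum>g\<in>keys p. cmod (lookup p g)"
  have "L2_norm (FA n) (convolution (FA n) (lookup p) b) \<le> ?C * L2_norm (FA n) b"
    if "b \<in> L2 (FA n)" for b
    by (rule L2_norm_convolution_le[OF p norm_fourier_le _ that]) (auto intro: sum_nonneg)
  then show "bdd_above {L2_norm (FA n) (convolution (FA n) (lookup p) b) | b.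
      b \<in> L2 (FA n) \<and> L2_norm (FA n) b = 1}"
    by (intro bdd_aboveI[of _ ?C]) fastforce
qed (use b in blast)

lemma lookup_scale:
  "lookup (single 0 c * q) g = c * lookup (q :: 'g::ab_group_add \<Rightarrow>\<^sub>0 'k::comm_ring_1) g"
  by (cases "c = 0") (simp_all add: lookup_mult_group)

lemma norm2_scale: "norm2 (single 0 c * q) = (cmod c)\<^sup>2 * norm2 (q :: 'g::ab_group_add \<Rightarrow>\<^sub>0 complex)"
proof -
  have "norm2 (single 0 c * q) =
      (\<Sum>g\<in>keys q. (cmod (lookup (single 0 c * q) g))\<^sup>2)"
    by (rule norm2_superset) (auto simp: in_keys_iff lookup_scale)
  then show ?thesis
    by (simp add: norm2_def lookup_scale norm_mult power_mult_distrib sum_distrib_left)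
qed

text \<open>The defining property of the operator norm, without normalization of \<open>q\<close>.\<close>

lemma norm2_mult_le_op_norm:
  assumes p: "p \<in> supported {1..n}" and q: "q \<in> supported {1..n}"
  shows "norm2 (p * q) \<le> (op_norm (FA n) (lookup p))\<^sup>2 * norm2 q"
proof (cases "norm2 q = 0")
  case True
  then have "\<forall>g\<in>keys q. (cmod (lookup q g))\<^sup>2 = 0"
    unfolding norm2_def by (subst (asm) sum_nonneg_eq_0_iff) auto
  then have "q = 0" by (intro poly_mapping_eqI) (auto simp: in_keys_iff)
  then show ?thesis by (simp add: norm2_def)
next
  case False
  then have pos: "norm2 q > 0" using norm2_nonneg[of q] by simp
  define c where "c = complex_of_real (1 / sqrt (norm2 q))"
  have c: "(cmod c)\<^sup>2 = 1 / norm2 q"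
    using pos by (simp add: c_def norm_divide power_divide)
  let ?q = "single 0 c * q"
  have supp: "?q \<in> supported {1..n}" by (intro supported_mult supported_single q) simp
  have "L2_norm (FA n) (lookup ?q) = 1"
    using lookup_L2(2)[OF supp] pos by (simp add: norm2_scale c)
  then have "L2_norm (FA n) (convolution (FA n) (lookup p) (lookup ?q))
      \<le> op_norm (FA n) (lookup p)"
    by (intro L2_norm_convolution_le_op_norm p lookup_L2(1) supp)
  moreover have "convolution (FA n) (lookup p) (lookup ?q) = lookup (p * ?q)"
    using lookup_mult_group_ring[OF p supp] by (simp add: group_ring_def)
  ultimately have "sqrt (norm2 (p * ?q)) \<le> op_norm (FA n) (lookup p)"
    using lookup_L2(2)[OF supported_mult[OF p supp]] by simp
  then have "norm2 (p * ?q) \<le> (op_norm (FA n) (lookup p))\<^sup>2"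
    by (rule sqrt_le_D)
  moreover have "p * ?q = single 0 c * (p * q)" by (simp add: mult_ac)
  then have "norm2 (p * ?q) = norm2 (p * q) / norm2 q" by (simp only: norm2_scale c) simp
  ultimately show ?thesis using pos by (simp only: pos_divide_le_eq)
qed

text \<open>The group elements all of whose coordinates lie in the half-open interval from \<open>a\<close> to \<open>b\<close>.\<close>

definition exponent_box :: "nat \<Rightarrow> int \<Rightarrow> int \<Rightarrow> (nat \<Rightarrow>\<^sub>0 int) set" where
  "exponent_box n a b = {g. keys g \<subseteq> {1..n} \<and> (\<forall>i\<in>{1..n}. lookup g i \<in> {a..<b})}"

lemma card_exponent_box: "finite (exponent_box n a b)" "card (exponent_box n a b) = nat (b - a) ^ n"
proof -
  let ?r = "\<lambda>g. \<lambda>i\<in>{1..n}. lookup g i"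
  have "bij_betw ?r (exponent_box n a b) ({1..n} \<rightarrow>\<^sub>E {a..<b})"
    unfolding bij_betw_def
  proof
    show "inj_on ?r (exponent_box n a b)"
    proof (rule inj_onI, rule poly_mapping_eqI)
      fix g h i assume gh: "g \<in> exponent_box n a b" "h \<in> exponent_box n a b" and eq: "?r g = ?r h"
      show "lookup g i = lookup h i"
      proof (cases "i \<in> {1..n}")
        case True
        then show ?thesis using fun_cong[OF eq, of i] by simp
      next
        case False
        then have "i \<notin> keys g" "i \<notin> keys h" using gh by (auto simp: exponent_box_def)
        then show ?thesis by (simp add: in_keys_iff)
      qed
    qed
    show "?r ` exponent_box n a b = {1..n} \<rightarrow>\<^sub>E {a..<b}"
    proof (intro subset_antisym subsetI)
      fix f assume f: "f \<in> {1..n} \<rightarrow>\<^sub>E {a..<b}"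
      let ?g = "Abs_poly_mapping (\<lambda>i. if i \<in> {1..n} then f i else 0)"
      have "finite {i. (if i \<in> {1..n} then f i else 0) \<noteq> 0}"
        by (rule finite_subset[of _ "{1..n}"]) auto
      then have l: "lookup ?g = (\<lambda>i. if i \<in> {1..n} then f i else 0)"
        by (rule lookup_Abs_poly_mapping)
      have "?r ?g = f" using f by (auto simp: l restrict_def PiE_def extensional_def fun_eq_iff)
      moreover have "?g \<in> exponent_box n a b"
      proof -
        have "keys ?g \<subseteq> {1..n}" unfolding subset_iff in_keys_iff l by simp
        moreover have "lookup ?g i \<in> {a..<b}" if "i \<in> {1..n}" for i
          unfolding l using f that by (simp add: PiE_iff)
        ultimately show ?thesis by (simp add: exponent_box_def)
      qed
      ultimately show "f \<in> ?r ` exponent_box n a b" by (intro image_eqI[of _ _ ?g]) simp_all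
    qed (auto simp: exponent_box_def PiE_iff)
  qed
  then have "finite (exponent_box n a b) = finite ({1..n} \<rightarrow>\<^sub>E {a..<b})" "card (exponent_box n a b) = card ({1..n} \<rightarrow>\<^sub>E {a..<b})"
    by (rule bij_betw_finite, rule bij_betw_same_card)
  then show "finite (exponent_box n a b)" "card (exponent_box n a b) = nat (b - a) ^ n"
    by (simp_all add: finite_PiE card_PiE)
qed

text \<open>The test vector \<open>q\<close> is the conjugate of the character at \<open>z\<close>, cut off to a box of side \<open>N\<close>. With
  \<open>L\<close> a bound for the exponents in \<open>p\<close>, the product \<open>p * q\<close> equals \<open>q\<close> times the number
  \<open>fourier n p z\<close> on the box of side \<open>N - 2 L\<close> inside; for large \<open>N\<close> the two boxes have almost the
  same number of elements.\<close>

lemma norm_fourier_le_op_norm: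
  assumes p: "p \<in> supported {1..n}" and z: "z \<in> torus n"
  shows "cmod (fourier n p z) \<le> op_norm (FA n) (lookup p)"
proof -
  let ?op = "op_norm (FA n) (lookup p)"
  have "finite (\<Union>h\<in>keys p. (\<lambda>i. \<bar>lookup h i\<bar>) ` {1..n})" by simp
  then obtain L0 where L0: "\<forall>x\<in>(\<Union>h\<in>keys p. (\<lambda>i. \<bar>lookup h i\<bar>) ` {1..n}). x \<le> L0"
    using bdd_above_finite unfolding bdd_above_def by blast
  define L where "L = nat L0"
  have L: "\<bar>lookup h i\<bar> \<le> int L" if "h \<in> keys p" "i \<in> {1..n}" for h i
    using L0 that by (fastforce simp: L_def)
  have bound: "((real N - 2 * real L) / real N) ^ n * (cmod (fourier n p z))\<^sup>2 \<le> ?op\<^sup>2" if N: "N > 2 * L" for N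
  proof -
    define B where "B = exponent_box n 0 (int N)"
    define B' where "B' = exponent_box n (int L) (int N - int L)"
    define q where "q = Abs_poly_mapping (\<lambda>g. if g \<in> B then character n z (- g) else 0)"
    have finB: "finite B" by (simp add: B_def card_exponent_box)
    have q: "lookup q = (\<lambda>g. if g \<in> B then character n z (- g) else 0)"
      unfolding q_def by (rule lookup_Abs_poly_mapping) (rule finite_subset[OF _ finB], auto split: if_splits)
    have keys_q: "keys q \<subseteq> B" by (auto simp: in_keys_iff q split: if_splits)
    then have q_supp: "q \<in> supported {1..n}" by (auto simp: supported_def B_def exponent_box_def)
    have "norm2 q = (\<Sum>g\<in>B. 1)"
      unfolding norm2_superset[OF finB keys_q] by (intro sum.cong) (auto simp: q norm_character z)
    then have norm_q: "norm2 q = real N ^ n" by (simp add: B_def card_exponent_box)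
    have eq: "lookup (p * q) g = character n z (- g) * fourier n p z" if g: "g \<in> B'" for g
    proof -
      have "lookup q (g - h) = character n z (- g) * character n z h" if h: "h \<in> keys p" for h
      proof -
        have "keys g \<subseteq> {1..n}" "keys h \<subseteq> {1..n}"
          using g h p by (auto simp: B'_def exponent_box_def supported_def)
        moreover have "lookup (g - h) i \<in> {0..<int N}" if "i \<in> {1..n}" for i
        proof -
          have "int L \<le> lookup g i" "lookup g i < int N - int L"
            using g that by (auto simp: B'_def exponent_box_def)
          then show ?thesis using L[OF h that] by (simp add: lookup_minus) linarith
        qed
        ultimately have "g - h \<in> B"
          using keys_diff[of g h] unfolding B_def exponent_box_def by blast
        then show ?thesis by (simp add: q character_add[OF z, symmetric])
      qed
      then show ?thesis
        unfolding lookup_mult_group evaluation_def sum_distrib_left by (intro sum.cong) simp_all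
    qed
    have "(real N - 2 * real L) ^ n * (cmod (fourier n p z))\<^sup>2 =
        (\<Sum>g\<in>B'. (cmod (lookup (p * q) g))\<^sup>2)"
    proof -
      have "real (nat (int N - int L - int L)) = real N - 2 * real L" using N by linarith
      then show ?thesis by (simp add: eq norm_mult norm_character z B'_def card_exponent_box)
    qed
    also have "\<dots> \<le> norm2 (p * q)" by (rule sum_le_norm2) (simp add: B'_def card_exponent_box)
    also have "\<dots> \<le> ?op\<^sup>2 * real N ^ n" using norm2_mult_le_op_norm[OF p q_supp] by (simp add: norm_q)
    finally show ?thesis using N by (simp add: power_divide field_simps)
  qed
  have "(\<lambda>N. (1 - 2 * real L * (1 / real N)) ^ n * (cmod (fourier n p z))\<^sup>2) \<longlonglongrightarrow>
      (1 - 2 * real L * 0) ^ n * (cmod (fourier n p z))\<^sup>2"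
    by (intro tendsto_intros lim_1_over_n)
  moreover have "\<forall>\<^sub>F N in sequentially. (1 - 2 * real L * (1 / real N)) ^ n * (cmod (fourier n p z))\<^sup>2 \<le> ?op\<^sup>2"
    using eventually_gt_at_top[of "2 * L"]
  proof eventually_elim
    case (elim N)
    then have "1 - 2 * real L * (1 / real N) = (real N - 2 * real L) / real N" by (simp add: field_simps)
    then show ?case using bound[OF elim] by simp
  qed
  ultimately have "(1 - 2 * real L * 0) ^ n * (cmod (fourier n p z))\<^sup>2 \<le> ?op\<^sup>2"
    by (rule tendsto_upperbound) simp
  then have sq: "(cmod (fourier n p z))\<^sup>2 \<le> ?op\<^sup>2" by simp
  have "?op \<ge> 0"
  proof -
    obtain b where b: "b \<in> L2 (FA n)" "L2_norm (FA n) b = 1" using op_norm_set_nonempty[of n] by blast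
    show ?thesis
      by (rule order_trans[OF L2_norm_nonneg L2_norm_convolution_le_op_norm[OF p b]])
  qed
  then show ?thesis using sq by (rule power2_le_imp_le[rotated])
qed

section \<open>Density of Laurent polynomials\<close>

lemma compact_torus: "compact (torus n)"
proof -
  let ?S = "\<lambda>i. if i \<in> {1..n} then {w. cmod w = 1} else {undefined}"
  have "torus n = PiE UNIV ?S"
    by (auto simp: torus_def PiE_def Pi_def extensional_def split: if_splits)
  moreover have "compact {w. cmod w = 1}"
    using compact_sphere[of "0 :: complex" 1] by (simp add: sphere_def dist_norm)
  then have "compactin (product_topology (\<lambda>i. euclidean) UNIV) (PiE UNIV ?S)"
    by (simp add: compactin_PiE compactin_euclidean_iff)
  ultimately show ?thesis by (simp add: euclidean_product_topology compactin_euclidean_iff)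
qed

text \<open>Stone-Weierstrass for the real algebra of those real functions that agree on the torus with a
  Laurent polynomial with complex coefficients.\<close>

lemma fourier_dense_real:
  fixes f :: "(nat \<Rightarrow> complex) \<Rightarrow> real"
  assumes f: "continuous_on (torus n) f" and "e > 0"
  shows "\<exists>p\<in>supported {1..n}. \<forall>z\<in>torus n. cmod (complex_of_real (f z) - fourier n p z) < e"
proof -
  define P where "P g \<longleftrightarrow> (\<exists>p\<in>supported {1..n}. \<forall>z\<in>torus n. complex_of_real (g z) = fourier n p z)"
    for g :: "(nat \<Rightarrow> complex) \<Rightarrow> real"
  have "\<exists>g. P g \<and> (\<forall>z\<in>torus n. \<bar>f z - g z\<bar> < e)"
  proof (rule Stone_Weierstrass_HOL)
    show "P (\<lambda>z. c)" for c
      unfolding P_def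
      by (intro bexI[of _ "single 0 (complex_of_real c)"]) (auto intro!: supported_single)
    show "continuous_on (torus n) g" if g: "P g" for g
    proof -
      obtain p where "\<forall>z\<in>torus n. complex_of_real (g z) = fourier n p z" using g by (auto simp: P_def)
      then have "continuous_on (torus n) (\<lambda>z. complex_of_real (g z))"
        using continuous_on_fourier[of n p] continuous_on_cong by (metis (no_types, lifting))
      from continuous_on_Re[OF this] show ?thesis by simp
    qed
    show "P (\<lambda>z. g z + h z)" if "P g \<and> P h" for g h
      using that unfolding P_def by (metis (no_types, lifting) evaluation_add of_real_add supported_add)
    show "P (\<lambda>z. g z * h z)" if gh: "P g \<and> P h" for g h
    proof -
      obtain p q where "p \<in> supported {1..n}" "\<forall>z\<in>torus n. complex_of_real (g z) = fourier n p z"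
        "q \<in> supported {1..n}" "\<forall>z\<in>torus n. complex_of_real (h z) = fourier n q z"
        using gh unfolding P_def by blast
      then show ?thesis
        unfolding P_def by (intro bexI[of _ "p * q"]) (simp_all add: fourier_mult supported_mult)
    qed
    fix x y assume xy: "x \<in> torus n \<and> y \<in> torus n \<and> x \<noteq> y"
    then obtain i where i: "i \<in> {1..n}" "x i \<noteq> y i"
      unfolding torus_def by (metis PiE_ext)
    have inv: "inverse (z i) = cnj (z i)" if "z \<in> torus n" for z
    proof -
      have "z i * cnj (z i) = 1"
        using complex_norm_square[of "z i"] torus_norm[OF that i(1)] by simp
      then show ?thesis by (rule inverse_unique)
    qed
    define u where "u m c = single (single i m) c" for m :: int and c :: complex
    have u: "u m c \<in> supported {1..n}" "fourier n (u m c) z = c * z i powi m" for m c z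
      using i by (auto simp: u_def character_single intro!: supported_single split: if_splits)
    \<comment> \<open>On the torus the inverse of a coordinate is its conjugate, so real and imaginary parts of the
      coordinates are Laurent polynomials.\<close>
    have "P (\<lambda>z. Re (z i))"
      unfolding P_def
    proof (intro bexI ballI)
      show "u 1 (1/2) + u (-1) (1/2) \<in> supported {1..n}" by (intro supported_add u)
      fix z assume z: "z \<in> torus n"
      show "complex_of_real (Re (z i)) = fourier n (u 1 (1/2) + u (-1) (1/2)) z"
        using inv[OF z] by (simp add: evaluation_add u power_int_minus complex_eq_iff)
    qed
    moreover have "P (\<lambda>z. Im (z i))"
      unfolding P_def
    proof (intro bexI ballI)
      show "u 1 (- \<i>/2) + u (-1) (\<i>/2) \<in> supported {1..n}" by (intro supported_add u)
      fix z assume z: "z \<in> torus n"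
      show "complex_of_real (Im (z i)) = fourier n (u 1 (- \<i>/2) + u (-1) (\<i>/2)) z"
        using inv[OF z] by (simp add: evaluation_add u power_int_minus complex_eq_iff)
    qed
    ultimately show "\<exists>g. P g \<and> g x \<noteq> g y"
      using i(2) complex_eq_iff[of "x i" "y i"] by blast
  qed (use compact_torus assms in auto)
  then obtain g where g: "P g" "\<forall>z\<in>torus n. \<bar>f z - g z\<bar> < e" by blast
  then obtain p where p: "p \<in> supported {1..n}" "\<forall>z\<in>torus n. complex_of_real (g z) = fourier n p z"
    by (auto simp: P_def)
  have "cmod (complex_of_real (f z) - fourier n p z) = \<bar>f z - g z\<bar>" if "z \<in> torus n" for z
    using p(2) that by (metis norm_of_real of_real_diff real_norm_def)
  then show ?thesis using p(1) g(2) by (intro bexI[of _ p] ballI) simp_all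
qed

lemma fourier_dense:
  assumes f: "continuous_on (torus n) f" and e: "e > 0"
  shows "\<exists>p\<in>supported {1..n}. \<forall>z\<in>torus n. cmod (f z - fourier n p z) < e"
proof -
  obtain p where p: "p \<in> supported {1..n}" "\<And>z. z \<in> torus n \<Longrightarrow> cmod (complex_of_real (Re (f z)) - fourier n p z) < e / 2"
    using fourier_dense_real[of n "\<lambda>z. Re (f z)" "e / 2"] f e by (auto intro: continuous_intros)
  obtain q where q: "q \<in> supported {1..n}" "\<And>z. z \<in> torus n \<Longrightarrow> cmod (complex_of_real (Im (f z)) - fourier n q z) < e / 2"
    using fourier_dense_real[of n "\<lambda>z. Im (f z)" "e / 2"] f e by (auto intro: continuous_intros)
  let ?r = "p + single 0 \<i> * q"
  have "cmod (f z - fourier n ?r z) < e" if z: "z \<in> torus n" for z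
  proof -
    have "f z - fourier n ?r z = (complex_of_real (Re (f z)) - fourier n p z) +
        \<i> * (complex_of_real (Im (f z)) - fourier n q z)"
      using complex_eq[of "f z"] by (simp add: evaluation_add fourier_mult z algebra_simps)
    then have "cmod (f z - fourier n ?r z) \<le> cmod (complex_of_real (Re (f z)) - fourier n p z) +
        cmod (complex_of_real (Im (f z)) - fourier n q z)"
      by (metis norm_ii norm_mult mult_1 norm_triangle_ineq)
    then show ?thesis using p(2)[OF z] q(2)[OF z] by linarith
  qed
  moreover have "?r \<in> supported {1..n}"
    by (intro supported_add supported_mult supported_single p q) simp
  ultimately show ?thesis by blast
qed

section \<open>The reduced C*-algebra and the continuous functions on the torus\<close>

abbreviation CG :: "nat \<Rightarrow> ((nat \<Rightarrow>\<^sub>0 int) \<Rightarrow> complex) ring" where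
  "CG n \<equiv> complex_group_ring (FA n)"

text \<open>The Fourier transform of an element of the complex group ring, given as a function.\<close>

abbreviation function_fourier :: "nat \<Rightarrow> ((nat \<Rightarrow>\<^sub>0 int) \<Rightarrow> complex) \<Rightarrow> (nat \<Rightarrow> complex) \<Rightarrow> complex" where
  "function_fourier n a \<equiv> fourier n (Abs_poly_mapping a)"

lemma function_fourier_add:
  "\<lbrakk>a \<in> carrier (CG n); b \<in> carrier (CG n)\<rbrakk> \<Longrightarrow>
    function_fourier n (a \<oplus>\<^bsub>CG n\<^esub> b) z = function_fourier n a z + function_fourier n b z"
  by (simp add: Abs_group_ring_simps evaluation_add)

lemma function_fourier_mult:
  "\<lbrakk>a \<in> carrier (CG n); b \<in> carrier (CG n); z \<in> torus n\<rbrakk> \<Longrightarrow>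
    function_fourier n (a \<otimes>\<^bsub>CG n\<^esub> b) z = function_fourier n a z * function_fourier n b z"
  by (simp add: Abs_group_ring_simps fourier_mult)

lemma function_fourier_one: "function_fourier n \<one>\<^bsub>CG n\<^esub> z = 1"
  by (simp add: Abs_group_ring_one)

lemma function_fourier_zero: "function_fourier n \<zero>\<^bsub>CG n\<^esub> z = 0"
  by (simp add: lookup_inverse flip: lookup_zero_group_ring)

lemma group_ring_diff:
  assumes "a \<in> carrier (CG n)" "b \<in> carrier (CG n)"
  shows "(\<lambda>g. a g - b g) \<in> carrier (CG n)"
    and "function_fourier n (\<lambda>g. a g - b g) z = function_fourier n a z - function_fourier n b z"
proof -
  obtain p q where pq: "p \<in> supported {1..n}" "a = lookup p" "q \<in> supported {1..n}" "b = lookup q"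
    using assms by (elim lookup_Abs_group_ring_bij)
  then have eq: "(\<lambda>g. a g - b g) = lookup (p - q)" by (simp add: fun_eq_iff lookup_minus)
  show "(\<lambda>g. a g - b g) \<in> carrier (CG n)"
    unfolding eq lookup_in_group_ring_iff using pq by (simp add: supported_diff)
  show "function_fourier n (\<lambda>g. a g - b g) z = function_fourier n a z - function_fourier n b z"
    unfolding eq by (simp add: pq lookup_inverse evaluation_minus)
qed

lemma function_fourier_le_op_norm:
  "\<lbrakk>a \<in> carrier (CG n); z \<in> torus n\<rbrakk> \<Longrightarrow> cmod (function_fourier n a z) \<le> op_norm (FA n) a"
  using norm_fourier_le_op_norm[OF Abs_supported_iff] by (simp add: lookup_Abs_group_ring)

lemma op_norm_le_function_fourier:
  assumes "a \<in> carrier (CG n)" "\<And>z. z \<in> torus n \<Longrightarrow> cmod (function_fourier n a z) \<le> C" "C \<ge> 0"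
  shows "op_norm (FA n) a \<le> C"
  using op_norm_le[OF Abs_supported_iff[OF assms(1)] assms(2,3)] by (simp add: lookup_Abs_group_ring[OF assms(1)])

lemma torus_nonempty: "torus n \<noteq> {}"
  by (auto simp: torus_def PiE_eq_empty_iff intro!: exI[of _ 1])

lemma op_norm_nonneg: "a \<in> carrier (CG n) \<Longrightarrow> op_norm (FA n) a \<ge> 0"
  using function_fourier_le_op_norm torus_nonempty order_trans[OF norm_ge_zero] by blast

text \<open>Because the Fourier transform is isometric, Cauchy sequences for the operator norm are the
  sequences with uniformly convergent Fourier transforms.\<close>

lemma Cauchy_ring_carrier:
  "s \<in> carrier (Cauchy_ring (FA n)) \<longleftrightarrow> (\<forall>k. s k \<in> carrier (CG n)) \<and>
     uniformly_convergent_on (torus n) (\<lambda>k. function_fourier n (s k))"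
proof (cases "\<forall>k. s k \<in> carrier (CG n)")
  case True
  have "(\<forall>e>0. \<exists>N. \<forall>j\<ge>N. \<forall>k\<ge>N. op_norm (FA n) (\<lambda>g. s j g - s k g) < e) \<longleftrightarrow>
      uniformly_Cauchy_on (torus n) (\<lambda>k. function_fourier n (s k))"
  proof
    assume op: "\<forall>e>0. \<exists>N. \<forall>j\<ge>N. \<forall>k\<ge>N. op_norm (FA n) (\<lambda>g. s j g - s k g) < e"
    show "uniformly_Cauchy_on (torus n) (\<lambda>k. function_fourier n (s k))"
    proof (rule uniformly_Cauchy_onI)
      fix e :: real assume "e > 0"
      then obtain N where N: "\<And>j k. \<lbrakk>j \<ge> N; k \<ge> N\<rbrakk> \<Longrightarrow> op_norm (FA n) (\<lambda>g. s j g - s k g) < e"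
        using op by blast
      have "dist (function_fourier n (s j) z) (function_fourier n (s k) z) < e"
        if "z \<in> torus n" "j \<ge> N" "k \<ge> N" for z j k
        using function_fourier_le_op_norm[OF group_ring_diff(1) that(1), of "s j" "s k"] N[OF that(2,3)] True
        by (simp add: group_ring_diff(2) dist_norm)
      then show "\<exists>M. \<forall>z\<in>torus n. \<forall>j\<ge>M. \<forall>k\<ge>M. dist (function_fourier n (s j) z) (function_fourier n (s k) z) < e"
        by blast
    qed
  next
    assume Cauchy: "uniformly_Cauchy_on (torus n) (\<lambda>k. function_fourier n (s k))"
    show "\<forall>e>0. \<exists>N. \<forall>j\<ge>N. \<forall>k\<ge>N. op_norm (FA n) (\<lambda>g. s j g - s k g) < e"
    proof (intro allI impI)
      fix e :: real assume e: "e > 0"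
      then obtain N where N: "\<And>z j k. \<lbrakk>z \<in> torus n; j \<ge> N; k \<ge> N\<rbrakk> \<Longrightarrow>
          dist (function_fourier n (s j) z) (function_fourier n (s k) z) < e / 2"
        using Cauchy unfolding uniformly_Cauchy_on_def by (meson half_gt_zero)
      have "op_norm (FA n) (\<lambda>g. s j g - s k g) \<le> e / 2" if "j \<ge> N" "k \<ge> N" for j k
      proof (rule op_norm_le_function_fourier)
        show "cmod (function_fourier n (\<lambda>g. s j g - s k g) z) \<le> e / 2" if "z \<in> torus n" for z
          using N[OF that \<open>j \<ge> N\<close> \<open>k \<ge> N\<close>] True by (simp add: group_ring_diff(2) dist_norm)
      qed (use True e in \<open>simp_all add: group_ring_diff\<close>)
      then show "\<exists>N. \<forall>j\<ge>N. \<forall>k\<ge>N. op_norm (FA n) (\<lambda>g. s j g - s k g) < e"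
        using e by (intro exI[of _ N]) fastforce
    qed
  qed
  then show ?thesis using True by (simp add: Cauchy_ring_def uniformly_convergent_eq_Cauchy)
qed (auto simp: Cauchy_ring_def)

text \<open>The limit of the Fourier transforms of a Cauchy sequence, extended by \<open>undefined\<close> off the torus as
  required of the elements of \<open>C_torus n\<close>.\<close>

definition limit_function :: "nat \<Rightarrow> (nat \<Rightarrow> (nat \<Rightarrow>\<^sub>0 int) \<Rightarrow> complex) \<Rightarrow> (nat \<Rightarrow> complex) \<Rightarrow> complex" where
  "limit_function n s = (\<lambda>z\<in>torus n. lim (\<lambda>k. function_fourier n (s k) z))"

lemma uniform_limit_limit_function:
  assumes "s \<in> carrier (Cauchy_ring (FA n))"
  shows "uniform_limit (torus n) (\<lambda>k. function_fourier n (s k)) (limit_function n s) sequentially"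
proof -
  have "uniform_limit (torus n) (\<lambda>k. function_fourier n (s k)) (\<lambda>z. lim (\<lambda>k. function_fourier n (s k) z)) sequentially"
    using assms unfolding Cauchy_ring_carrier uniformly_convergent_uniform_limit_iff by blast
  then show ?thesis
    by (rule uniform_limit_cong'[THEN iffD1, rotated 2]) (simp_all add: limit_function_def)
qed

lemma Cauchy_ring_uniform_limitI:
  assumes "\<And>k. s k \<in> carrier (CG n)"
    and lim: "uniform_limit (torus n) (\<lambda>k. function_fourier n (s k)) l sequentially"
  shows "s \<in> carrier (Cauchy_ring (FA n))" and "z \<in> torus n \<Longrightarrow> limit_function n s z = l z"
proof -
  show "s \<in> carrier (Cauchy_ring (FA n))"
    using assms by (auto simp: Cauchy_ring_carrier uniformly_convergent_on_def)
  show "limit_function n s z = l z" if "z \<in> torus n"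
    using tendsto_uniform_limitI[OF lim that] by (simp add: limit_function_def that limI)
qed

lemma limit_function_C_torus:
  assumes s: "s \<in> carrier (Cauchy_ring (FA n))"
  shows "limit_function n s \<in> carrier (C_torus n)"
proof -
  have "continuous_on (torus n) (limit_function n s)"
    by (rule uniform_limit_theorem[OF _ uniform_limit_limit_function[OF s]])
      (simp_all add: continuous_on_fourier)
  then show ?thesis by (simp add: C_torus_def limit_function_def)
qed

lemma bounded_limit_function:
  "s \<in> carrier (Cauchy_ring (FA n)) \<Longrightarrow> bounded (limit_function n s ` torus n)"
  using limit_function_C_torus[of s n]
  by (auto simp: C_torus_def intro!: compact_imp_bounded compact_continuous_image compact_torus)

lemma Cauchy_ring_mem: "s \<in> carrier (Cauchy_ring (FA n)) \<Longrightarrow> s k \<in> carrier (CG n)"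
  by (simp add: Cauchy_ring_carrier)

lemma Cauchy_ring_sel:
  "\<zero>\<^bsub>Cauchy_ring G\<^esub> = (\<lambda>k. \<zero>\<^bsub>complex_group_ring G\<^esub>)" "\<one>\<^bsub>Cauchy_ring G\<^esub> = (\<lambda>k. \<one>\<^bsub>complex_group_ring G\<^esub>)"
  "s \<oplus>\<^bsub>Cauchy_ring G\<^esub> t = (\<lambda>k. s k \<oplus>\<^bsub>complex_group_ring G\<^esub> t k)"
  "s \<otimes>\<^bsub>Cauchy_ring G\<^esub> t = (\<lambda>k. s k \<otimes>\<^bsub>complex_group_ring G\<^esub> t k)"
  by (simp_all add: Cauchy_ring_def)

lemma Cauchy_ring_const:
  assumes "a \<in> carrier (CG n)"
  shows "(\<lambda>k. a) \<in> carrier (Cauchy_ring (FA n))"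
    and "z \<in> torus n \<Longrightarrow> limit_function n (\<lambda>k. a) z = function_fourier n a z"
proof -
  have "uniform_limit (torus n) (\<lambda>k. function_fourier n a) (function_fourier n a) sequentially"
    by (rule uniform_limitI) simp
  then show "(\<lambda>k. a) \<in> carrier (Cauchy_ring (FA n))"
    and "z \<in> torus n \<Longrightarrow> limit_function n (\<lambda>k. a) z = function_fourier n a z"
    using Cauchy_ring_uniform_limitI[of "\<lambda>k. a" n "function_fourier n a"] assms by auto
qed

lemma Cauchy_ring_add:
  assumes s: "s \<in> carrier (Cauchy_ring (FA n))" and t: "t \<in> carrier (Cauchy_ring (FA n))"
  shows "s \<oplus>\<^bsub>Cauchy_ring (FA n)\<^esub> t \<in> carrier (Cauchy_ring (FA n))"
    and "z \<in> torus n \<Longrightarrow> limit_function n (s \<oplus>\<^bsub>Cauchy_ring (FA n)\<^esub> t) z = limit_function n s z + limit_function n t z"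
proof -
  interpret C: ring "CG n" by (rule ring_group_ring)
  have "uniform_limit (torus n) (\<lambda>k. function_fourier n ((s \<oplus>\<^bsub>Cauchy_ring (FA n)\<^esub> t) k))
      (\<lambda>z. limit_function n s z + limit_function n t z) sequentially"
    using uniform_limit_add[OF uniform_limit_limit_function[OF s] uniform_limit_limit_function[OF t]]
    by (simp add: Cauchy_ring_sel function_fourier_add Cauchy_ring_mem[OF s] Cauchy_ring_mem[OF t])
  moreover have "(s \<oplus>\<^bsub>Cauchy_ring (FA n)\<^esub> t) k \<in> carrier (CG n)" for k
    using Cauchy_ring_mem[OF s] Cauchy_ring_mem[OF t] by (simp add: Cauchy_ring_sel)
  ultimately show "s \<oplus>\<^bsub>Cauchy_ring (FA n)\<^esub> t \<in> carrier (Cauchy_ring (FA n))"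
    and "z \<in> torus n \<Longrightarrow> limit_function n (s \<oplus>\<^bsub>Cauchy_ring (FA n)\<^esub> t) z = limit_function n s z + limit_function n t z"
    using Cauchy_ring_uniform_limitI by blast+
qed

lemma Cauchy_ring_mult:
  assumes s: "s \<in> carrier (Cauchy_ring (FA n))" and t: "t \<in> carrier (Cauchy_ring (FA n))"
  shows "s \<otimes>\<^bsub>Cauchy_ring (FA n)\<^esub> t \<in> carrier (Cauchy_ring (FA n))"
    and "z \<in> torus n \<Longrightarrow> limit_function n (s \<otimes>\<^bsub>Cauchy_ring (FA n)\<^esub> t) z = limit_function n s z * limit_function n t z"
proof -
  interpret C: ring "CG n" by (rule ring_group_ring)
  have "uniform_limit (torus n) (\<lambda>k z. function_fourier n (s k) z * function_fourier n (t k) z)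
      (\<lambda>z. limit_function n s z * limit_function n t z) sequentially"
    by (rule uniform_lim_mult[OF uniform_limit_limit_function[OF s] uniform_limit_limit_function[OF t]
          bounded_limit_function[OF s] bounded_limit_function[OF t]])
  then have "uniform_limit (torus n) (\<lambda>k. function_fourier n ((s \<otimes>\<^bsub>Cauchy_ring (FA n)\<^esub> t) k))
      (\<lambda>z. limit_function n s z * limit_function n t z) sequentially"
    by (rule uniform_limit_cong'[THEN iffD1, rotated 2])
      (simp_all add: Cauchy_ring_sel function_fourier_mult Cauchy_ring_mem[OF s] Cauchy_ring_mem[OF t])
  moreover have "(s \<otimes>\<^bsub>Cauchy_ring (FA n)\<^esub> t) k \<in> carrier (CG n)" for k
    using Cauchy_ring_mem[OF s] Cauchy_ring_mem[OF t] by (simp add: Cauchy_ring_sel)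
  ultimately show "s \<otimes>\<^bsub>Cauchy_ring (FA n)\<^esub> t \<in> carrier (Cauchy_ring (FA n))"
    and "z \<in> torus n \<Longrightarrow> limit_function n (s \<otimes>\<^bsub>Cauchy_ring (FA n)\<^esub> t) z = limit_function n s z * limit_function n t z"
    using Cauchy_ring_uniform_limitI by blast+
qed

lemma ring_Cauchy_ring: "ring (Cauchy_ring (FA n))"
proof -
  interpret C: ring "CG n" by (rule ring_group_ring)
  note mem = Cauchy_ring_mem[of _ n]
  have minus: "(\<lambda>k. \<ominus>\<^bsub>CG n\<^esub> s k) \<in> carrier (Cauchy_ring (FA n))" if s: "s \<in> carrier (Cauchy_ring (FA n))" for s
  proof (rule Cauchy_ring_uniform_limitI(1))
    have "function_fourier n (\<ominus>\<^bsub>CG n\<^esub> s k) z = - function_fourier n (s k) z" for k z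
      using function_fourier_add[of "\<ominus>\<^bsub>CG n\<^esub> s k" n "s k" z] mem[OF s]
      by (simp add: C.l_neg function_fourier_zero add_eq_0_iff2)
    then show "uniform_limit (torus n) (\<lambda>k. function_fourier n (\<ominus>\<^bsub>CG n\<^esub> s k)) (\<lambda>z. - limit_function n s z) sequentially"
      using uniform_limit_uminus[OF uniform_limit_limit_function[OF s]] by simp
  qed (use mem[OF s] in simp)
  show ?thesis
  proof (intro ringI abelian_groupI monoidI)
    fix s assume s: "s \<in> carrier (Cauchy_ring (FA n))"
    then show "\<exists>t\<in>carrier (Cauchy_ring (FA n)). t \<oplus>\<^bsub>Cauchy_ring (FA n)\<^esub> s = \<zero>\<^bsub>Cauchy_ring (FA n)\<^esub>"
      using minus[OF s] mem[OF s] by (intro bexI[of _ "\<lambda>k. \<ominus>\<^bsub>CG n\<^esub> s k"]) (simp_all add: Cauchy_ring_sel C.l_neg)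
  next
    show "\<zero>\<^bsub>Cauchy_ring (FA n)\<^esub> \<in> carrier (Cauchy_ring (FA n))" "\<one>\<^bsub>Cauchy_ring (FA n)\<^esub> \<in> carrier (Cauchy_ring (FA n))"
      unfolding Cauchy_ring_sel by (rule Cauchy_ring_const, simp)+
  qed (simp_all add: Cauchy_ring_add Cauchy_ring_mult, simp_all add: Cauchy_ring_sel mem fun_eq_iff
      C.a_ac C.m_assoc C.l_distr C.r_distr)
qed

lemma C_torus_sel:
  "f \<in> carrier (C_torus n) \<longleftrightarrow> f \<in> extensional (torus n) \<and> continuous_on (torus n) f"
  "\<zero>\<^bsub>C_torus n\<^esub> = (\<lambda>z\<in>torus n. 0)" "\<one>\<^bsub>C_torus n\<^esub> = (\<lambda>z\<in>torus n. 1)"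
  "f \<oplus>\<^bsub>C_torus n\<^esub> g = (\<lambda>z\<in>torus n. f z + g z)" "f \<otimes>\<^bsub>C_torus n\<^esub> g = (\<lambda>z\<in>torus n. f z * g z)"
  by (simp_all add: C_torus_def)

lemma C_torus_restrict: "continuous_on (torus n) f \<Longrightarrow> restrict f (torus n) \<in> carrier (C_torus n)"
  by (simp add: C_torus_sel cong: continuous_on_cong)

lemma ring_C_torus: "ring (C_torus n)"
proof (intro ringI abelian_groupI monoidI)
  fix f assume f: "f \<in> carrier (C_torus n)"
  have "(\<lambda>z\<in>torus n. - f z) \<in> carrier (C_torus n)"
    by (rule C_torus_restrict) (use f in \<open>auto simp: C_torus_sel intro!: continuous_intros\<close>)
  then show "\<exists>g\<in>carrier (C_torus n). g \<oplus>\<^bsub>C_torus n\<^esub> f = \<zero>\<^bsub>C_torus n\<^esub>"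
    by (intro bexI[of _ "\<lambda>z\<in>torus n. - f z"]) (auto simp: C_torus_sel(2-) restrict_def fun_eq_iff)
next
  fix f g assume fg: "f \<in> carrier (C_torus n)" "g \<in> carrier (C_torus n)"
  show "f \<oplus>\<^bsub>C_torus n\<^esub> g \<in> carrier (C_torus n)" "f \<otimes>\<^bsub>C_torus n\<^esub> g \<in> carrier (C_torus n)"
    unfolding C_torus_sel(4,5)
    by (rule C_torus_restrict; use fg in \<open>auto simp: C_torus_sel(1) intro!: continuous_intros\<close>)+
next
  show "\<zero>\<^bsub>C_torus n\<^esub> \<in> carrier (C_torus n)" "\<one>\<^bsub>C_torus n\<^esub> \<in> carrier (C_torus n)"
    unfolding C_torus_sel(2,3) by (rule C_torus_restrict; simp)+
qed (auto simp: C_torus_sel restrict_def fun_eq_iff algebra_simps extensional_def)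

lemma limit_function_ring_hom: "limit_function n \<in> ring_hom (Cauchy_ring (FA n)) (C_torus n)"
proof (rule ring_hom_memI)
  fix s t assume st: "s \<in> carrier (Cauchy_ring (FA n))" "t \<in> carrier (Cauchy_ring (FA n))"
  show "limit_function n (s \<otimes>\<^bsub>Cauchy_ring (FA n)\<^esub> t) = limit_function n s \<otimes>\<^bsub>C_torus n\<^esub> limit_function n t"
    by (rule extensionalityI[of _ "torus n"])
      (simp_all add: Cauchy_ring_mult[OF st] C_torus_sel, simp add: limit_function_def)
  show "limit_function n (s \<oplus>\<^bsub>Cauchy_ring (FA n)\<^esub> t) = limit_function n s \<oplus>\<^bsub>C_torus n\<^esub> limit_function n t"
    by (rule extensionalityI[of _ "torus n"])
      (simp_all add: Cauchy_ring_add[OF st] C_torus_sel, simp add: limit_function_def)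
next
  interpret C: ring "CG n" by (rule ring_group_ring)
  show "limit_function n \<one>\<^bsub>Cauchy_ring (FA n)\<^esub> = \<one>\<^bsub>C_torus n\<^esub>"
    by (rule extensionalityI[of _ "torus n"])
      (simp_all add: Cauchy_ring_sel Cauchy_ring_const function_fourier_one C_torus_sel, simp add: limit_function_def)
qed (rule limit_function_C_torus)

lemma limit_function_surj: "limit_function n ` carrier (Cauchy_ring (FA n)) = carrier (C_torus n)"
proof (intro subset_antisym subsetI)
  fix f assume f: "f \<in> carrier (C_torus n)"
  have "\<exists>p\<in>supported {1..n}. \<forall>z\<in>torus n. cmod (f z - fourier n p z) < 1 / real (Suc k)" for k
    using f by (intro fourier_dense) (auto simp: C_torus_sel)
  then obtain p where p: "\<And>k. p k \<in> supported {1..n}"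
    "\<And>k z. z \<in> torus n \<Longrightarrow> cmod (f z - fourier n (p k) z) < 1 / real (Suc k)"
    by metis
  define s where "s k = lookup (p k)" for k
  have lim: "uniform_limit (torus n) (\<lambda>k. function_fourier n (s k)) f sequentially"
  proof (rule uniform_limitI)
    fix e :: real assume "e > 0"
    have "\<forall>\<^sub>F k in sequentially. 1 / real (Suc k) < e"
      using LIMSEQ_inverse_real_of_nat \<open>e > 0\<close> by (auto dest!: order_tendstoD(2) simp: inverse_eq_divide)
    then show "\<forall>\<^sub>F k in sequentially. \<forall>z\<in>torus n. dist (function_fourier n (s k) z) (f z) < e"
    proof eventually_elim
      case (elim k)
      then show ?case
        using p(2)[of _ k] by (auto simp: s_def lookup_inverse dist_norm norm_minus_commute intro: less_trans)
    qed
  qed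
  have s: "s k \<in> carrier (CG n)" for k using p by (simp add: s_def lookup_in_group_ring_iff)
  have "f = limit_function n s"
    by (rule extensionalityI[of _ "torus n"])
      (use f Cauchy_ring_uniform_limitI(2)[OF s lim] in \<open>auto simp: C_torus_sel limit_function_def\<close>)
  then show "f \<in> limit_function n ` carrier (Cauchy_ring (FA n))"
    using Cauchy_ring_uniform_limitI(1)[OF s lim] by blast
qed (auto intro: limit_function_C_torus)

lemma limit_function_kernel:
  "a_kernel (Cauchy_ring (FA n)) (C_torus n) (limit_function n) = null_sequences (FA n)"
proof (intro subset_antisym subsetI)
  fix s assume "s \<in> a_kernel (Cauchy_ring (FA n)) (C_torus n) (limit_function n)"
  then have s: "s \<in> carrier (Cauchy_ring (FA n))" and z: "limit_function n s = (\<lambda>z\<in>torus n. 0)"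
    by (auto simp: a_kernel_def' C_torus_sel)
  have "(\<lambda>k. op_norm (FA n) (s k)) \<longlonglongrightarrow> 0"
  proof (rule tendstoI)
    fix e :: real assume e: "e > 0"
    then have "\<forall>\<^sub>F k in sequentially. \<forall>z\<in>torus n. dist (function_fourier n (s k) z) (limit_function n s z) < e / 2"
      using uniform_limit_limit_function[OF s] by (intro uniform_limitD) simp_all
    then show "\<forall>\<^sub>F k in sequentially. dist (op_norm (FA n) (s k)) 0 < e"
    proof eventually_elim
      case (elim k)
      then have "op_norm (FA n) (s k) \<le> e / 2"
        using e by (intro op_norm_le_function_fourier Cauchy_ring_mem[OF s]) (auto simp: z intro: less_imp_le)
      then show ?case using e op_norm_nonneg[OF Cauchy_ring_mem[OF s]] by simp
    qed
  qed
  then show "s \<in> null_sequences (FA n)"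
    using Cauchy_ring_mem[OF s] by (simp add: null_sequences_def)
next
  fix s assume "s \<in> null_sequences (FA n)"
  then have s: "\<And>k. s k \<in> carrier (CG n)" and null: "(\<lambda>k. op_norm (FA n) (s k)) \<longlonglongrightarrow> 0"
    by (auto simp: null_sequences_def)
  have lim: "uniform_limit (torus n) (\<lambda>k. function_fourier n (s k)) (\<lambda>z. 0) sequentially"
  proof (rule uniform_limitI)
    fix e :: real assume "e > 0"
    then have "\<forall>\<^sub>F k in sequentially. op_norm (FA n) (s k) < e" using null by (rule order_tendstoD(2)[rotated])
    then show "\<forall>\<^sub>F k in sequentially. \<forall>z\<in>torus n. dist (function_fourier n (s k) z) 0 < e"
      by eventually_elim (use function_fourier_le_op_norm[OF s] in \<open>auto intro: le_less_trans\<close>)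
  qed
  have "limit_function n s = (\<lambda>z\<in>torus n. 0)"
    by (rule extensionalityI[of _ "torus n"])
      (use Cauchy_ring_uniform_limitI(2)[OF s lim] in \<open>simp_all add: limit_function_def\<close>)
  then show "s \<in> a_kernel (Cauchy_ring (FA n)) (C_torus n) (limit_function n)"
    using Cauchy_ring_uniform_limitI(1)[OF s lim] by (simp add: a_kernel_def' C_torus_sel)
qed

section \<open>The coefficient module and the coordinate ideal\<close>

lemma left_module_module_along:
  assumes "ring R" "ring A" and \<phi>: "\<phi> \<in> ring_hom R A"
  shows "left_module R (module_along \<phi> A)"
proof -
  interpret R: ring R by fact
  interpret A: ring A by fact
  have "abelian_group (module_along \<phi> A)"
    by (rule abelian_groupI) (auto simp: module_along_def A.a_ac intro: A.l_neg)
  then show ?thesis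
    by (intro left_module.intro left_module_axioms.intro R.ring_axioms)
      (simp_all add: module_along_def ring_hom_closed[OF \<phi>] ring_hom_add[OF \<phi>] ring_hom_mult[OF \<phi>]
        ring_hom_one[OF \<phi>] A.l_distr A.r_distr A.m_assoc)
qed

lemma limit_function_ring_hom_ring: "ring_hom_ring (Cauchy_ring (FA n)) (C_torus n) (limit_function n)"
  by (rule ring_hom_ringI2[OF ring_Cauchy_ring ring_C_torus limit_function_ring_hom])

lemma ideal_null_sequences: "ideal (null_sequences (FA n)) (Cauchy_ring (FA n))"
  using ring_hom_ring.kernel_is_ideal[OF limit_function_ring_hom_ring[of n]] by (simp add: limit_function_kernel)

lemma ring_reduced_Cstar: "ring (reduced_Cstar (FA n))"
  unfolding reduced_Cstar_def by (rule ideal.quotient_is_ring[OF ideal_null_sequences])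

text \<open>The map that \<open>limit_function\<close> induces on classes modulo null sequences. The image of a class is a
  singleton, and \<open>the_elem\<close> extracts its element.\<close>

definition gelfand :: "nat \<Rightarrow> (nat \<Rightarrow> (nat \<Rightarrow>\<^sub>0 int) \<Rightarrow> complex) set \<Rightarrow> (nat \<Rightarrow> complex) \<Rightarrow> complex" where
  "gelfand n c = the_elem (limit_function n ` c)"

theorem gelfand_ring_iso: "gelfand n \<in> ring_iso (reduced_Cstar (FA n)) (C_torus n)"
  using ring_hom_ring.FactRing_iso_set[OF limit_function_ring_hom_ring[of n] limit_function_surj]
  unfolding gelfand_def[abs_def] reduced_Cstar_def limit_function_kernel .

lemma gelfand_to_reduced_Cstar:
  assumes "a \<in> carrier (CG n)" "z \<in> torus n"
  shows "gelfand n (to_reduced_Cstar (FA n) a) z = function_fourier n a z"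
  using ring_hom_ring.the_elem_simp[OF limit_function_ring_hom_ring[of n] Cauchy_ring_const(1)[OF assms(1)]]
    Cauchy_ring_const(2)[OF assms]
  by (simp add: gelfand_def to_reduced_Cstar_def limit_function_kernel)

lemma of_int_ring_hom: "(\<lambda>r g. of_int (r g)) \<in> ring_hom (ZG n) (CG n)"
proof (rule ring_hom_memI)
  fix r s assume rs: "r \<in> carrier (ZG n)" "s \<in> carrier (ZG n)"
  show "(\<lambda>g. of_int (r g)) \<in> carrier (CG n)" using rs by (simp add: group_ring_def)
  show "(\<lambda>g. of_int ((r \<otimes>\<^bsub>ZG n\<^esub> s) g)) = (\<lambda>g. of_int (r g)) \<otimes>\<^bsub>CG n\<^esub> (\<lambda>g. of_int (s g))"
    by (simp add: group_ring_def convolution_def fun_eq_iff)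
  show "(\<lambda>g. of_int ((r \<oplus>\<^bsub>ZG n\<^esub> s) g)) = (\<lambda>g. of_int (r g)) \<oplus>\<^bsub>CG n\<^esub> (\<lambda>g. of_int (s g))"
    by (simp add: group_ring_def)
qed (simp add: group_ring_def fun_eq_iff)

lemma to_reduced_Cstar_ring_hom:
  "(\<lambda>r. to_reduced_Cstar (FA n) (\<lambda>g. of_int (r g))) \<in> ring_hom (ZG n) (reduced_Cstar (FA n))"
proof -
  have const: "(\<lambda>a k. a) \<in> ring_hom (CG n) (Cauchy_ring (FA n))"
    by (rule ring_hom_memI) (simp_all add: Cauchy_ring_const Cauchy_ring_sel)
  have "(+>\<^bsub>Cauchy_ring (FA n)\<^esub>) (null_sequences (FA n)) \<circ> ((\<lambda>a k. a) \<circ> (\<lambda>r g. of_int (r g)))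
      \<in> ring_hom (ZG n) (reduced_Cstar (FA n))"
    unfolding reduced_Cstar_def
    by (intro ring_hom_trans[OF ring_hom_trans[OF of_int_ring_hom const]] ideal.rcos_ring_hom ideal_null_sequences)
  then show ?thesis by (simp add: to_reduced_Cstar_def[abs_def] o_def)
qed

lemma left_module_reduced_Cstar: "left_module (ZG n) (reduced_Cstar_module (FA n))"
  unfolding reduced_Cstar_module_def
  by (rule left_module_module_along[OF ring_ZG ring_reduced_Cstar to_reduced_Cstar_ring_hom])

lemma gelfand_shift_diff:
  assumes j: "j \<in> {1..n}" and m: "m \<in> carrier (reduced_Cstar (FA n))"
  shows "gelfand n (lookup (shift_diff j) \<odot>\<^bsub>reduced_Cstar_module (FA n)\<^esub> m) =
    (\<lambda>z\<in>torus n. (z j - 1) * gelfand n m z)"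
proof -
  let ?x = "\<lambda>g. complex_of_int (lookup (shift_diff j) g)"
  have hom: "gelfand n \<in> ring_hom (reduced_Cstar (FA n)) (C_torus n)"
    using gelfand_ring_iso by (simp add: ring_iso_def)
  have x: "lookup (shift_diff j) \<in> carrier (ZG n)"
    using j by (simp only: lookup_in_group_ring_iff shift_diff_supported)
  have x': "?x \<in> carrier (CG n)" using ring_hom_closed[OF of_int_ring_hom x] .
  have eq: "?x = lookup (single (frag_of j) 1 - 1 :: (nat \<Rightarrow>\<^sub>0 int) \<Rightarrow>\<^sub>0 complex)"
    by (simp add: shift_diff_def fun_eq_iff lookup_minus lookup_single Poly_Mapping.lookup_one when_def)
  have "function_fourier n ?x z = z j - 1" for z
    unfolding eq lookup_inverse using character_single[OF j, of z 1] by (simp add: evaluation_minus)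
  then have "gelfand n (to_reduced_Cstar (FA n) ?x) z = z j - 1" if "z \<in> torus n" for z
    using gelfand_to_reduced_Cstar[OF x' that] by simp
  moreover have "gelfand n (lookup (shift_diff j) \<odot>\<^bsub>reduced_Cstar_module (FA n)\<^esub> m) =
      gelfand n (to_reduced_Cstar (FA n) ?x) \<otimes>\<^bsub>C_torus n\<^esub> gelfand n m"
    using ring_hom_mult[OF hom ring_hom_closed[OF to_reduced_Cstar_ring_hom x] m]
    by (simp add: reduced_Cstar_module_def module_along_def)
  ultimately show ?thesis by (simp add: C_torus_sel restrict_def fun_eq_iff)
qed

lemma gelfand_finsum:
  assumes "finite A" "m \<in> A \<rightarrow> carrier (reduced_Cstar_module (FA n))"
  shows "gelfand n (finsum (reduced_Cstar_module (FA n)) m A) = (\<lambda>z\<in>torus n. \<Sum>a\<in>A. gelfand n (m a) z)"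
  using assms
proof (induction A)
  case empty
  interpret M: left_module "ZG n" "reduced_Cstar_module (FA n)" by (rule left_module_reduced_Cstar)
  have "gelfand n \<zero>\<^bsub>reduced_Cstar (FA n)\<^esub> = \<zero>\<^bsub>C_torus n\<^esub>"
    using ring_hom_zero[OF _ ring_reduced_Cstar ring_C_torus] gelfand_ring_iso by (auto simp: ring_iso_def)
  moreover have "\<zero>\<^bsub>reduced_Cstar_module (FA n)\<^esub> = \<zero>\<^bsub>reduced_Cstar (FA n)\<^esub>"
    by (simp add: reduced_Cstar_module_def module_along_def)
  ultimately show ?case by (simp add: C_torus_sel)
next
  case (insert a A)
  interpret M: left_module "ZG n" "reduced_Cstar_module (FA n)" by (rule left_module_reduced_Cstar)
  have hom: "gelfand n \<in> ring_hom (reduced_Cstar (FA n)) (C_torus n)"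
    using gelfand_ring_iso by (simp add: ring_iso_def)
  have sel: "carrier (reduced_Cstar_module (FA n)) = carrier (reduced_Cstar (FA n))"
    "x \<oplus>\<^bsub>reduced_Cstar_module (FA n)\<^esub> y = x \<oplus>\<^bsub>reduced_Cstar (FA n)\<^esub> y" for x y
    by (simp_all add: reduced_Cstar_module_def module_along_def)
  have m: "m a \<in> carrier (reduced_Cstar_module (FA n))" "m \<in> A \<rightarrow> carrier (reduced_Cstar_module (FA n))"
    using insert.prems by auto
  have "gelfand n (finsum (reduced_Cstar_module (FA n)) m (insert a A)) =
      gelfand n (m a) \<oplus>\<^bsub>C_torus n\<^esub> gelfand n (finsum (reduced_Cstar_module (FA n)) m A)"
    using insert.hyps m M.M.finsum_closed[OF m(2)] ring_hom_add[OF hom, of "m a"] by (simp add: sel)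
  then show ?case
    using insert.hyps insert.IH[OF m(2)] by (simp add: C_torus_sel restrict_def fun_eq_iff)
qed

lemma gelfand_difference_submodule:
  "gelfand n ` difference_submodule n (reduced_Cstar_module (FA n)) = coordinate_ideal n"
proof -
  let ?M = "reduced_Cstar_module (FA n)"
  interpret M: left_module "ZG n" ?M by (rule left_module_reduced_Cstar)
  have sel: "carrier ?M = carrier (reduced_Cstar (FA n))"
    by (simp_all add: reduced_Cstar_module_def module_along_def)
  have bij: "bij_betw (gelfand n) (carrier ?M) (carrier (C_torus n))"
    using gelfand_ring_iso by (simp add: ring_iso_def sel)
  have eq: "gelfand n (finsum ?M (\<lambda>j. lookup (shift_diff j) \<odot>\<^bsub>?M\<^esub> m j) {1..n}) =
      (\<lambda>z\<in>torus n. \<Sum>j\<in>{1..n}. (z j - 1) * gelfand n (m j) z)"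
    if m: "m \<in> {1..n} \<rightarrow> carrier ?M" for m
  proof -
    have "lookup (shift_diff j) \<odot>\<^bsub>?M\<^esub> m j \<in> carrier ?M" if "j \<in> {1..n}" for j
      using that m by (intro M.smult_closed) (auto simp: lookup_in_group_ring_iff)
    then have "gelfand n (finsum ?M (\<lambda>j. lookup (shift_diff j) \<odot>\<^bsub>?M\<^esub> m j) {1..n}) =
        (\<lambda>z\<in>torus n. \<Sum>j\<in>{1..n}. gelfand n (lookup (shift_diff j) \<odot>\<^bsub>?M\<^esub> m j) z)"
      by (intro gelfand_finsum) auto
    also have "\<dots> = (\<lambda>z\<in>torus n. \<Sum>j\<in>{1..n}. (z j - 1) * gelfand n (m j) z)"
      using m by (intro restrict_ext sum.cong refl) (auto simp: gelfand_shift_diff sel Pi_iff)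
    finally show ?thesis .
  qed
  show ?thesis
  proof (intro subset_antisym subsetI)
    fix f assume "f \<in> gelfand n ` difference_submodule n ?M"
    then obtain m where m: "m \<in> {1..n} \<rightarrow> carrier ?M"
      "f = gelfand n (finsum ?M (\<lambda>j. lookup (shift_diff j) \<odot>\<^bsub>?M\<^esub> m j) {1..n})"
      by (auto simp: difference_submodule_def)
    then show "f \<in> coordinate_ideal n"
      using bij_betwE[OF bij] unfolding coordinate_ideal_def
      by (intro CollectI exI[of _ "\<lambda>j. gelfand n (m j)"]) (auto simp: eq)
  next
    fix f assume "f \<in> coordinate_ideal n"
    then obtain g where g: "\<And>j. j \<in> {1..n} \<Longrightarrow> g j \<in> carrier (C_torus n)"
      "f = (\<lambda>z\<in>torus n. \<Sum>j\<in>{1..n}. (z j - 1) * g j z)"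
      unfolding coordinate_ideal_def by blast
    define m where "m j = inv_into (carrier ?M) (gelfand n) (g j)" for j
    have m: "m j \<in> carrier ?M" "gelfand n (m j) = g j" if "j \<in> {1..n}" for j
      using g(1)[OF that] bij unfolding m_def bij_betw_def
      by (auto intro: inv_into_into f_inv_into_f)
    then have "f = gelfand n (finsum ?M (\<lambda>j. lookup (shift_diff j) \<odot>\<^bsub>?M\<^esub> m j) {1..n})"
      unfolding g(2) by (subst eq) (auto intro!: restrict_ext sum.cong)
    then show "f \<in> gelfand n ` difference_submodule n ?M"
      unfolding difference_submodule_def using m(1) by blast
  qed
qed

lemma ideal_coordinate_ideal: "ideal (coordinate_ideal n) (C_torus n)"
proof (rule idealI[OF ring_C_torus])
  interpret C: ring "C_torus n" by (rule ring_C_torus)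
  have mem: "f \<in> coordinate_ideal n \<longleftrightarrow> (\<exists>g. (\<forall>i\<in>{1..n}. g i \<in> carrier (C_torus n)) \<and>
      f = (\<lambda>z\<in>torus n. \<Sum>i\<in>{1..n}. (z i - 1) * g i z))" for f
    by (auto simp: coordinate_ideal_def)
  have sub: "f \<in> carrier (C_torus n)" if f: "f \<in> coordinate_ideal n" for f
  proof -
    obtain g where g: "\<forall>i\<in>{1..n}. g i \<in> carrier (C_torus n)" "f = (\<lambda>z\<in>torus n. \<Sum>i\<in>{1..n}. (z i - 1) * g i z)"
      using f unfolding mem by blast
    have "continuous_on (torus n) (\<lambda>z. \<Sum>i\<in>{1..n}. (z i - 1) * g i z)"
      using g(1)
      by (intro continuous_on_sum continuous_on_mult continuous_on_diff continuous_on_const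
          continuous_on_subset[OF continuous_on_product_coordinates subset_UNIV]) (simp add: C_torus_sel)
    then show ?thesis unfolding g(2) by (rule C_torus_restrict)
  qed
  have mult: "x \<otimes>\<^bsub>C_torus n\<^esub> f \<in> coordinate_ideal n" if f: "f \<in> coordinate_ideal n" and x: "x \<in> carrier (C_torus n)" for f x
  proof -
    obtain g where g: "\<forall>i\<in>{1..n}. g i \<in> carrier (C_torus n)" "f = (\<lambda>z\<in>torus n. \<Sum>i\<in>{1..n}. (z i - 1) * g i z)"
      using f unfolding mem by blast
    have "x \<otimes>\<^bsub>C_torus n\<^esub> f = (\<lambda>z\<in>torus n. \<Sum>i\<in>{1..n}. (z i - 1) * (x \<otimes>\<^bsub>C_torus n\<^esub> g i) z)"
      by (auto simp: C_torus_sel g(2) restrict_def fun_eq_iff sum_distrib_left mult_ac)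
    then show ?thesis
      unfolding mem using g(1) x by (intro exI[of _ "\<lambda>i. x \<otimes>\<^bsub>C_torus n\<^esub> g i"]) simp
  qed
  have add: "f \<oplus>\<^bsub>C_torus n\<^esub> h \<in> coordinate_ideal n" if f: "f \<in> coordinate_ideal n" and h: "h \<in> coordinate_ideal n" for f h
  proof -
    obtain g where g: "\<forall>i\<in>{1..n}. g i \<in> carrier (C_torus n)" "f = (\<lambda>z\<in>torus n. \<Sum>i\<in>{1..n}. (z i - 1) * g i z)"
      using f unfolding mem by blast
    obtain k where k: "\<forall>i\<in>{1..n}. k i \<in> carrier (C_torus n)" "h = (\<lambda>z\<in>torus n. \<Sum>i\<in>{1..n}. (z i - 1) * k i z)"
      using h unfolding mem by blast
    have "f \<oplus>\<^bsub>C_torus n\<^esub> h = (\<lambda>z\<in>torus n. \<Sum>i\<in>{1..n}. (z i - 1) * (g i \<oplus>\<^bsub>C_torus n\<^esub> k i) z)"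
      by (auto simp: C_torus_sel g(2) k(2) restrict_def fun_eq_iff sum.distrib distrib_left)
    then show ?thesis
      unfolding mem using g(1) k(1) by (intro exI[of _ "\<lambda>i. g i \<oplus>\<^bsub>C_torus n\<^esub> k i"]) simp
  qed
  have "(\<lambda>z\<in>torus n. 0) \<in> coordinate_ideal n"
    unfolding mem
    by (intro exI[of _ "\<lambda>i. \<zero>\<^bsub>C_torus n\<^esub>"] conjI ballI C.zero_closed restrict_ext) (simp add: C_torus_sel)
  moreover have "\<ominus>\<^bsub>C_torus n\<^esub> f \<in> coordinate_ideal n" if f: "f \<in> coordinate_ideal n" for f
    using mult[OF f, of "\<ominus>\<^bsub>C_torus n\<^esub> \<one>\<^bsub>C_torus n\<^esub>"] sub[OF f] by (simp add: C.l_minus)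
  ultimately show "subgroup (coordinate_ideal n) (add_monoid (C_torus n))"
    by (intro C.add.subgroupI) (use sub add in auto)
  show "x \<otimes>\<^bsub>C_torus n\<^esub> f \<in> coordinate_ideal n" if "f \<in> coordinate_ideal n" "x \<in> carrier (C_torus n)" for f x
    using mult that .
  show "f \<otimes>\<^bsub>C_torus n\<^esub> x \<in> coordinate_ideal n" if "f \<in> coordinate_ideal n" "x \<in> carrier (C_torus n)" for f x
  proof -
    have "f \<otimes>\<^bsub>C_torus n\<^esub> x = x \<otimes>\<^bsub>C_torus n\<^esub> f" by (simp add: C_torus_sel mult.commute)
    then show ?thesis using mult[OF that] by simp
  qed
qed

theorem theorem7:
  fixes n :: nat
    and G :: "(nat \<Rightarrow>\<^sub>0 int) monoid"
    and P :: "nat \<Rightarrow> ((nat \<Rightarrow>\<^sub>0 int) \<Rightarrow> int, 'p) module"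
    and d :: "nat \<Rightarrow> 'p \<Rightarrow> 'p"
    and \<epsilon> :: "'p \<Rightarrow> int"
  assumes "n \<ge> 1"
    and "G = free_Abelian_group {1..n}"
    and "projective_resolution (integral_group_ring G) trivial_module P d \<epsilon>"
  shows "Hom_cohomology (integral_group_ring G) P d (reduced_Cstar_module G) n
           \<cong> add_monoid (C_torus n Quot coordinate_ideal n)"
proof -
  let ?M = "reduced_Cstar_module (FA n)" and ?Q = "C_torus n Quot coordinate_ideal n"
  let ?\<theta> = "\<lambda>m. coordinate_ideal n +>\<^bsub>C_torus n\<^esub> gelfand n m"
  interpret I: ideal "coordinate_ideal n" "C_torus n" by (rule ideal_coordinate_ideal)
  interpret Q: ring ?Q by (rule I.quotient_is_ring)
  have sel: "carrier ?M = carrier (reduced_Cstar (FA n))"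
    "x \<oplus>\<^bsub>?M\<^esub> y = x \<oplus>\<^bsub>reduced_Cstar (FA n)\<^esub> y" for x y
    by (simp_all add: reduced_Cstar_module_def module_along_def)
  have hom: "gelfand n \<in> ring_hom (reduced_Cstar (FA n)) (C_torus n)"
    and bij: "bij_betw (gelfand n) (carrier ?M) (carrier (C_torus n))"
    using gelfand_ring_iso by (simp_all add: ring_iso_def sel)
  have \<theta>: "?\<theta> \<in> ring_hom (reduced_Cstar (FA n)) ?Q"
    using ring_hom_trans[OF hom I.rcos_ring_hom] by (simp add: o_def)
  have "Hom_cohomology (ZG n) P d ?M n \<cong> add_monoid ?Q"
  proof (rule top_cohomology_iso[OF assms(1) _ left_module_reduced_Cstar Q.a_group])
    show "projective_resolution (ZG n) trivial_module P d \<epsilon>" using assms(2,3) by simp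
    show "?\<theta> \<in> hom (add_monoid ?M) (add_monoid ?Q)"
      by (rule homI) (simp_all add: sel ring_hom_closed[OF \<theta>] ring_hom_add[OF \<theta>])
    have "?\<theta> ` carrier ?M = (\<lambda>f. coordinate_ideal n +>\<^bsub>C_torus n\<^esub> f) ` gelfand n ` carrier ?M"
      by (simp add: image_image)
    also have "\<dots> = carrier ?Q"
      using bij by (auto simp: bij_betw_def FactRing_def A_RCOSETS_def')
    finally show "?\<theta> ` carrier ?M = carrier (add_monoid ?Q)" by simp
    show "?\<theta> m = \<one>\<^bsub>add_monoid ?Q\<^esub> \<longleftrightarrow> m \<in> difference_submodule n ?M" if m: "m \<in> carrier ?M" for m
    proof -
      have gm: "gelfand n m \<in> carrier (C_torus n)" using bij m by (auto simp: bij_betw_def)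
      have "?\<theta> m = \<one>\<^bsub>add_monoid ?Q\<^esub> \<longleftrightarrow> gelfand n m \<in> coordinate_ideal n"
        using I.rcos_const_imp_mem[OF gm] I.a_rcos_const by (auto simp: FactRing_def)
      also have "\<dots> \<longleftrightarrow> m \<in> difference_submodule n ?M"
      proof
        interpret M: left_module "ZG n" ?M by (rule left_module_reduced_Cstar)
        assume "gelfand n m \<in> coordinate_ideal n"
        then obtain m' where m': "m' \<in> difference_submodule n ?M" "gelfand n m = gelfand n m'"
          unfolding gelfand_difference_submodule[symmetric] by blast
        have "m' \<in> carrier ?M"
          using m'(1) by (auto simp: difference_submodule_def lookup_in_group_ring_iff
              intro!: M.M.finsum_closed M.smult_closed)
        then show "m \<in> difference_submodule n ?M"
          using m m' bij by (auto simp: bij_betw_def dest: inj_onD)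
      next
        assume "m \<in> difference_submodule n ?M"
        then show "gelfand n m \<in> coordinate_ideal n"
          unfolding gelfand_difference_submodule[symmetric] by (rule imageI)
      qed
      finally show ?thesis .
    qed
  qed
  then show ?thesis using assms(2) by simp
qed

end
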